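(* Suppose that the standing assumption (i)–(iii) of the context holds, with constants $L_f,L_{\nabla f},C,\theta,\gamma,\sigma$. Let $M=(1-\theta)^{-1}C^{-1/\theta}L_{\nabla f}^{1/\theta}$, $\nu=\theta^{-1}(1-\theta)$, let $\epsilon$ and $(x^0,y^0)$ be inputs of Algorithm 2 (described in the context), and set $$A=(1-\theta)^{-2}C^{-2}L_{\nabla f}^2,\qquad \underline{L}=L_{\nabla f}+M^{2/(1+\nu)},$$ $$a=8\big(\Psi(x^0)-\Psi^*+3+2A\underline{L}^{-1}\big),\qquad b=8\big(3/2+A\underline{L}^{-1}\big),$$ $$\widehat C_1=\Big(36(1+\nu)\nu^{-1}b\underline L\,\lceil\log(18(1+\nu)\nu^{-1}b\underline L)\rceil_+ +72(1+\nu)\nu^{-1}b\underline L+1\Big)^{\frac{1+\nu}{2\nu}},$$ $$\widehat C_2=\Big(\tfrac{4b(1+\nu)(3M)^{2/\nu}}{M^{2/(1+\nu)}}\Big\lceil\log\Big(\tfrac{2b(1+\nu)(3M)^{2/\nu}}{M^{2/(1+\nu)}}\Big)\Big\rceil_+ +\tfrac{8b(1+\nu)(3M)^{2/\nu}}{\nu M^{2/(1+\nu)}}+1\Big)^{\frac{1+\nu}{2}},$$ $$\widehat C_3=(36\underline La)^{\frac{1+\nu}{2\nu}}+M^{-1}\big(4a(3M)^{2/\nu}\big)^{\frac{1+\nu}{2}},\qquad \widehat C_4=72A,$$ $$\widehat C_5=\Big(\tfrac{144(1+\nu)bL_{\nabla f}^2}{M^{2/(1+\nu)}}\Big\lceil\log\Big(\tfrac{72(1+\nu)bL_{\nabla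 f}^2}{M^{2/(1+\nu)}}\Big)\Big\rceil_+ +\tfrac{288(1+\nu)bL_{\nabla f}^2}{M^{2/(1+\nu)}}+1\Big)^{\frac{1+\nu}{2}},\qquad \widehat C_6=(144aL_{\nabla f}^2)^{\frac{1+\nu}{2}}/M,$$ $$\widehat C_7=\Big(\tfrac{64(1+\nu)bL_f^2}{\gamma^2M^{2/(1+\nu)}}\Big\lceil\log\Big(\tfrac{32(1+\nu)bL_f^2}{\gamma^2M^{2/(1+\nu)}}\Big)\Big\rceil_+ +\tfrac{128\sigma(1+\nu)bL_f^2}{\gamma^2M^{2/(1+\nu)}}+1\Big)^{\frac{1+\nu}{2}},\qquad \widehat C_8=(64aL_f^2)^{\frac{1+\nu}{2}}/(\gamma^{1+\nu}M),$$ $$\widehat K_\epsilon=\Big\lceil\widehat C_1\epsilon^{-\frac{1+\nu}{\nu}}(\log\epsilon^{-1})^{\frac{1+\nu}{2\nu}}+\widehat C_2\epsilon^{-\frac{1+\nu}{\nu}}(\log\epsilon^{-1})^{\frac{1+\nu}{2}}+\widehat C_3\epsilon^{-\frac{1+\nu}{\nu}}+\widehat C_4\epsilon^{-2}+\widehat C_5\epsilon^{-(1+\nu)}(\log\epsilon^{-1})^{\frac{1+\nu}{2}}+\widehat C_6\epsilon^{-(1+\nu)}+\widehat C_7\epsilon^{-(1+\nu)\sigma}(\log\epsilon^{-1})^{\frac{1+\nu}{2}}+\widehat C_8\epsilon^{-(1+\nu)\sigma}\Big\rceil.$$ Suppose that $\epsilon\in(0,1/e]$. Then Algorithm 2 generates,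 in at most $\widehat K_\epsilon$ iterations, a pair $(x^k,y^k)$ such that $x^k$ is a $(\gamma\epsilon^\sigma/(4L_f),\epsilon)$-stationary point of the problem $\min_x\Psi(x)$, and $y^k$ satisfies $$F^*(x^k)-F(x^k,y^k)\le\min\Big\{\frac{\gamma\epsilon^\sigma}{2},\frac1{k+1}\Big\},\qquad \operatorname{dist}\big(y^k,Y^*(x^k)\big)\le\frac1{C(1-\theta)}\min\Big\{\Big(\frac\gamma2\Big)^{1-\theta}\epsilon^{\sigma(1-\theta)},\frac1{\sqrt{k+1}}\Big\}.$$
   Context: Problem: $\min_x\max_y\{f(x,y)+p(x)-q(y)\}$, where $f:\mathbb{R}^n\times\mathbb{R}^m\to\mathbb{R}$ is a smooth function, $p:\mathbb{R}^n\to\mathbb{R}\cup\{+\infty\}$, $q:\mathbb{R}^m\to\mathbb{R}\cup\{+\infty\}$. $\|\cdot\|$ is the Euclidean norm, $\mathcal{B}(x,r)$ the closed ball of center $x$ and radius $r$. Notation: $\mathcal{X}=\operatorname{dom}p$, $\mathcal{Y}=\operatorname{dom}q$, $F(x,y)=f(x,y)-q(y)$, $F^*(x)=\max_yF(x,y)$, $Y^*(x)=\{y:F(x,y)=F^*(x)\}$, $\Psi(x)=F^*(x)+p(x)$, $\Psi^*=\min_x\Psi(x)$. $L$-smooth on a set means that the gradient is $L$-Lipschitz there. $\lceil t\rceil_+=\max\{\lceil t\rceil,0\}$. $\partial$ denotes the limiting subdifferential: for proper closed $\phi$ and $x\in\operatorname{dom}\phi$, $v\in\partial\phi(x)$ iff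 there are $x^k\to x$ with $\phi(x^k)\to\phi(x)$ and $v^k\to v$ with $\liminf_{z\to x^k,z\ne x^k}\frac{\phi(z)-\phi(x^k)-\langle v^k,z-x^k\rangle}{\|z-x^k\|}\ge0$ for all $k$. $\partial_yF(x,y)$ means $\nabla_yf(x,y)-\partial q(y)$. $\operatorname{dist}(0,\emptyset)=+\infty$. Standing assumption: (i) For each fixed $y\in\mathcal{Y}$, $f(\cdot,y)$ is $L_f$-Lipschitz continuous on $\mathcal{X}$; moreover $f$ is $L_{\nabla f}$-smooth on $\mathcal{X}\times\mathcal{Y}$. (ii) $p$ and $q$ are proper closed convex (with exactly computable proximal operators), and the affine hull of $\mathcal{X}$ is $\mathbb{R}^n$. (iii) For each $x\in\mathcal{X}$, $\max_yF(x,y)$ has a nonempty solution set and finite optimal value, and there are constants $C>0$, $\theta\in[1/2,1)$, $\gamma>0$, $\sigma>0$ such that for any $x\in\mathcal{X}$, $C(F^*(x)-F(x,y))^\theta\le\operatorname{dist}(0,\partial_yF(x,y))$ for all $y\in\mathcal{L}(x)$, where $\mathcal{L}(x)=\{y:0<F^*(x)-F(x,y)\le\gamma\operatorname{dist}(0,\partial\Psi(x))^\sigma\}$. Stationarity: for proper closed $\phi$, $\epsilon>0$, $r\ge0$, a point $\bar x$ is an $(r,\epsilon)$-stationary point of $\min_x\phi(x)$ if $\bar x\in\operatorname{dom}\phi$ and $\operatorname{dist}(\bar x,\mathscr S_\epsilon)\le r$, where $\mathscr S_\epsilon=\{x:\operatorname{dist}(0,\partial\phi(x))\le\epsilon\}$.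 (The minimax problem is identified with $\min_x\Psi(x)$.) Algorithm 1 (proximal gradient subroutine for $\min_z h(z)=g(z)+q(z)$; inputs $z^0$, $\overline\lambda>0$, $\rho\in(0,1)$, $\tau>0$): for $k=0,1,2,\dots$: for $i=0,1,2,\dots$ set $\lambda_{k,i}=\overline\lambda\rho^i$, $z^{k+1,i}=\arg\min_z\{\langle\nabla g(z^k),z\rangle+\frac1{2\lambda_{k,i}}\|z-z^k\|^2+q(z)\}$; at the first $i$ with $h(z^{k+1,i})+\frac1{2\lambda_{k,i}}\|z^{k+1,i}-z^k\|^2\le h(z^k)$ set $z^{k+1}=z^{k+1,i}$, $\lambda_k=\lambda_{k,i}$ and leave the inner loop; if $\|z^{k+1}-z^k\|\le\tau$, return $z^{k+1}$. Algorithm 2 (inexact proximal gradient method). Inputs: $L_f,L_{\nabla f},C,\theta,\gamma,\sigma$ from the standing assumption; $\epsilon>0$, $\overline\lambda>0$, $\rho\in(0,1)$, and $(x^0,y^0)\in\mathcal{X}\times\mathcal{Y}$ with $F^*(x^0)-F(x^0,y^0)\le\min\{\gamma\epsilon^\sigma/2,1\}$. Set $r=\gamma\epsilon^\sigma/(4L_f)$, $\underline\lambda=\min\{\rho/L_{\nabla f},\overline\lambda\}$, $M=(1-\theta)^{-1}C^{-1/\theta}L_{\nabla f}^{1/\theta}$, $\nu=\theta^{-1}(1-\theta)$. For $k=0,1,2,\dots$: set $\delta_k=\eta_k=1/(k+1)$ and $L_k=L_{\nabla f}+\delta_k^{(\nu-1)/(1+\nu)}M^{2/(1+\nu)}$;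 compute $x^{k+1}=\arg\min_{x\in\mathcal{B}(x^k,r)}\{\langle\nabla_xf(x^k,y^k),x\rangle+\frac{L_k}2\|x-x^k\|^2+p(x)\}$; let $y^{k+1}$ be the output of Algorithm 1 applied with $g(\cdot)=-f(x^{k+1},\cdot)$, the function $q$, parameters $\overline\lambda,\rho$, initial point $z^0=y^k$, and $\tau=\frac{C}{L_{\nabla f}+\underline\lambda^{-1}}\min\{(\frac12\gamma\epsilon^\sigma)^\theta,\eta_{k+1}^{\theta/(2(1-\theta))}\}$.
   Formalization: The bound on dist(y^k,Y*(x^k)) is claimed only if x^0 is not already ε-critical, i.e. dist(0,∂Ψ(x^0))>ε; otherwise it can fail, e.g. f=-(c/2)y², p=q=0, y^0=1, C=4, tiny c. Stationarity and the function-value bound hold without this proviso. *)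

theory Defs
  imports "HOL-Analysis.Analysis"
begin

definition edom :: "('a \<Rightarrow> ereal) \<Rightarrow> 'a set" where
  "edom \<phi> = {x. \<phi> x < \<infinity>}"

definition proper_fun :: "('a \<Rightarrow> ereal) \<Rightarrow> bool" where
  "proper_fun \<phi> \<longleftrightarrow> edom \<phi> \<noteq> {} \<and> (\<forall>x. \<phi> x \<noteq> - \<infinity>)"

definition epi :: "('a \<Rightarrow> ereal) \<Rightarrow> ('a \<times> real) set" where
  "epi \<phi> = {(x, t). \<phi> x \<le> ereal t}"

definition proper_closed_convex :: "('a::real_normed_vector \<Rightarrow> ereal) \<Rightarrow> bool" where
  "proper_closed_convex \<phi> \<longleftrightarrow> proper_fun \<phi> \<and> closed (epi \<phi>) \<and> convex (epi \<phi>)"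

text \<open>The library functions \<^const>\<open>infdist\<close> and \<^const>\<open>setdist\<close> return 0 for the
  empty set; here the distance to the empty set has to be \<open>\<infinity>\<close>.\<close>

definition edist :: "'a::metric_space \<Rightarrow> 'a set \<Rightarrow> ereal" where
  "edist x S = (INF s\<in>S. ereal (dist x s))"

text \<open>Meant for \<open>t \<ge> 0\<close> and \<open>s > 0\<close> only, so that \<open>epowr 0 s = 0\<close>.\<close>

definition epowr :: "ereal \<Rightarrow> real \<Rightarrow> ereal" where
  "epowr t s = (if t = \<infinity> then \<infinity> else ereal (real_of_ereal t powr s))"

definition pos_ceiling :: "real \<Rightarrow> real" where
  "pos_ceiling t = real_of_int (max \<lceil>t\<rceil> 0)"

definition gradient :: "('a::euclidean_space \<Rightarrow> real) \<Rightarrow> 'a \<Rightarrow> 'a" where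
  "gradient g x = (THE D. GDERIV g x :> D)"

definition regular_subdiff :: "('a::euclidean_space \<Rightarrow> ereal) \<Rightarrow> 'a \<Rightarrow> 'a set" where
  "regular_subdiff \<phi> x =
     {v. 0 \<le> Liminf (at x) (\<lambda>z. (\<phi> z - \<phi> x - ereal (v \<bullet> (z - x))) / ereal (norm (z - x)))}"

definition limiting_subdiff :: "('a::euclidean_space \<Rightarrow> ereal) \<Rightarrow> 'a \<Rightarrow> 'a set" where
  "limiting_subdiff \<phi> x =
     {v. x \<in> edom \<phi> \<and>
         (\<exists>xs vs. (\<forall>k. xs k \<in> edom \<phi> \<and> vs k \<in> regular_subdiff \<phi> (xs k)) \<and>
            xs \<longlonglongrightarrow> x \<and> (\<lambda>k. \<phi> (xs k)) \<longlonglongrightarrow> \<phi> x \<and> vs \<longlonglongrightarrow> v)}"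

text \<open>The complexity theorem asserts its estimate of the distance of \<open>ys k\<close> to the set of inner
  maximizers only if \<open>x0\<close> is not in this set. If \<open>x0\<close> is in it, the local Kurdyka-Lojasiewicz
  condition need not say anything near \<open>x0\<close> and the estimate can fail for all relevant iterates:
  take \<open>f (x, y) = - (c / 2) * y\<^sup>2\<close> with tiny \<open>c > 0\<close>, \<open>p = q = 0\<close>, \<open>y0 = 1\<close> and a large constant
  \<open>C\<close>; every \<open>x\<close> is critical, so the condition is vacuous.\<close>

definition eps_critical :: "('a::euclidean_space \<Rightarrow> ereal) \<Rightarrow> real \<Rightarrow> 'a set" where
  "eps_critical \<phi> \<epsilon> = {x. edist 0 (limiting_subdiff \<phi> x) \<le> ereal \<epsilon>}"

definition stationary_point :: "('a::euclidean_space \<Rightarrow> ereal) \<Rightarrow> real \<Rightarrow> real \<Rightarrow> 'a \<Rightarrow> bool" where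
  "stationary_point \<phi> r \<epsilon> x \<longleftrightarrow> x \<in> edom \<phi> \<and> edist x (eps_critical \<phi> \<epsilon>) \<le> ereal r"

definition Fobj :: "('a \<times> 'b \<Rightarrow> real) \<Rightarrow> ('b \<Rightarrow> ereal) \<Rightarrow> 'a \<Rightarrow> 'b \<Rightarrow> ereal" where
  "Fobj f q x y = ereal (f (x, y)) - q y"

definition Fmax :: "('a \<times> 'b \<Rightarrow> real) \<Rightarrow> ('b \<Rightarrow> ereal) \<Rightarrow> 'a \<Rightarrow> ereal" where
  "Fmax f q x = (SUP y. Fobj f q x y)"

definition Ymax :: "('a \<times> 'b \<Rightarrow> real) \<Rightarrow> ('b \<Rightarrow> ereal) \<Rightarrow> 'a \<Rightarrow> 'b set" where
  "Ymax f q x = {y. Fobj f q x y = Fmax f q x}"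

definition Psi ::
  "('a \<times> 'b \<Rightarrow> real) \<Rightarrow> ('a \<Rightarrow> ereal) \<Rightarrow> ('b \<Rightarrow> ereal) \<Rightarrow> 'a \<Rightarrow> ereal" where
  "Psi f p q x = Fmax f q x + p x"

text \<open>The infimum; attainment is not required, only finiteness.\<close>

definition Psi_min ::
  "('a \<times> 'b \<Rightarrow> real) \<Rightarrow> ('a \<Rightarrow> ereal) \<Rightarrow> ('b \<Rightarrow> ereal) \<Rightarrow> ereal" where
  "Psi_min f p q = (INF x. Psi f p q x)"

definition subdiff_y ::
  "('a \<times> 'b::euclidean_space \<Rightarrow> real) \<Rightarrow> ('b \<Rightarrow> ereal) \<Rightarrow> 'a \<Rightarrow> 'b \<Rightarrow> 'b set" where
  "subdiff_y f q x y = (\<lambda>v. gradient (\<lambda>u. f (x, u)) y - v) ` limiting_subdiff q y"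

definition KL_region ::
  "('a::euclidean_space \<times> 'b \<Rightarrow> real) \<Rightarrow> ('a \<Rightarrow> ereal) \<Rightarrow> ('b \<Rightarrow> ereal) \<Rightarrow>
    real \<Rightarrow> real \<Rightarrow> 'a \<Rightarrow> 'b set" where
  "KL_region f p q \<gamma> \<sigma> x =
     {y. 0 < Fmax f q x - Fobj f q x y \<and>
         Fmax f q x - Fobj f q x y
           \<le> ereal \<gamma> * epowr (edist 0 (limiting_subdiff (Psi f p q) x)) \<sigma>}"

definition prox_trial ::
  "('b::euclidean_space \<Rightarrow> real) \<Rightarrow> ('b \<Rightarrow> ereal) \<Rightarrow> real \<Rightarrow> 'b \<Rightarrow> 'b \<Rightarrow> bool" where
  "prox_trial g q lam z w \<longleftrightarrow>
     is_arg_min (\<lambda>u. ereal (gradient g z \<bullet> u + 1 / (2 * lam) * (norm (u - z))\<^sup>2) + q u)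
       (\<lambda>u. True) w"

definition pg_accept ::
  "('b::euclidean_space \<Rightarrow> real) \<Rightarrow> ('b \<Rightarrow> ereal) \<Rightarrow> real \<Rightarrow> 'b \<Rightarrow> 'b \<Rightarrow> bool" where
  "pg_accept g q lam z w \<longleftrightarrow>
     ereal (g w) + q w + ereal (1 / (2 * lam) * (norm (w - z))\<^sup>2) \<le> ereal (g z) + q z"

definition pg_step ::
  "('b::euclidean_space \<Rightarrow> real) \<Rightarrow> ('b \<Rightarrow> ereal) \<Rightarrow> real \<Rightarrow> real \<Rightarrow> 'b \<Rightarrow> 'b \<Rightarrow> bool" where
  "pg_step g q lam_bar \<rho> z z' \<longleftrightarrow>
     (\<exists>i. prox_trial g q (lam_bar * \<rho> ^ i) z z' \<and> pg_accept g q (lam_bar * \<rho> ^ i) z z' \<and>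
        (\<forall>j<i. \<exists>w. prox_trial g q (lam_bar * \<rho> ^ j) z w \<and>
                   \<not> pg_accept g q (lam_bar * \<rho> ^ j) z w))"

text \<open>Proximal gradient subroutine with backtracking for \<open>min g + q\<close>. The inductive definition
  means that \<open>pg_returns\<close> holds only if the subroutine, started at \<open>z\<close>, terminates.\<close>

inductive pg_returns ::
  "('b::euclidean_space \<Rightarrow> real) \<Rightarrow> ('b \<Rightarrow> ereal) \<Rightarrow> real \<Rightarrow> real \<Rightarrow> real \<Rightarrow> 'b \<Rightarrow> 'b \<Rightarrow> bool"
  for g q lam_bar \<rho> \<tau> where
  stop: "pg_step g q lam_bar \<rho> z z' \<Longrightarrow> norm (z' - z) \<le> \<tau> \<Longrightarrow> pg_returns g q lam_bar \<rho> \<tau> z z'"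
| continue: "pg_step g q lam_bar \<rho> z z' \<Longrightarrow> \<not> norm (z' - z) \<le> \<tau> \<Longrightarrow>
    pg_returns g q lam_bar \<rho> \<tau> z' w \<Longrightarrow> pg_returns g q lam_bar \<rho> \<tau> z w"

text \<open>\<open>xs\<close> and \<open>ys\<close> are the iterates of a run of the method started at \<open>(x0, y0)\<close>. In
  particular every call of the subroutine along a run terminates.\<close>

definition ipg_run ::
  "('a::euclidean_space \<times> 'b::euclidean_space \<Rightarrow> real) \<Rightarrow> ('a \<Rightarrow> ereal) \<Rightarrow> ('b \<Rightarrow> ereal) \<Rightarrow>
    real \<Rightarrow> real \<Rightarrow> real \<Rightarrow> real \<Rightarrow> real \<Rightarrow> real \<Rightarrow> real \<Rightarrow> real \<Rightarrow> real \<Rightarrow> 'a \<Rightarrow> 'b \<Rightarrow>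
    (nat \<Rightarrow> 'a) \<Rightarrow> (nat \<Rightarrow> 'b) \<Rightarrow> bool" where
  "ipg_run f p q Lf Lg C \<theta> \<gamma> \<sigma> \<epsilon> lam_bar \<rho> x0 y0 xs ys \<longleftrightarrow>
    (let r = \<gamma> * \<epsilon> powr \<sigma> / (4 * Lf);
         lam_low = min (\<rho> / Lg) lam_bar;
         M = inverse (1 - \<theta>) * C powr (- 1 / \<theta>) * Lg powr (1 / \<theta>);
         \<nu> = inverse \<theta> * (1 - \<theta>);
         \<delta> = (\<lambda>k::nat. 1 / (real k + 1));
         \<eta> = (\<lambda>k::nat. 1 / (real k + 1));
         L = (\<lambda>k. Lg + \<delta> k powr ((\<nu> - 1) / (1 + \<nu>)) * M powr (2 / (1 + \<nu>)));
         \<tau> = (\<lambda>k. C / (Lg + inverse lam_low) *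
                    min ((\<gamma> * \<epsilon> powr \<sigma> / 2) powr \<theta>)
                        (\<eta> (Suc k) powr (\<theta> / (2 * (1 - \<theta>)))))
     in xs 0 = x0 \<and> ys 0 = y0 \<and>
        (\<forall>k. is_arg_min
               (\<lambda>x. ereal (gradient (\<lambda>u. f (u, ys k)) (xs k) \<bullet> x
                            + L k / 2 * (norm (x - xs k))\<^sup>2) + p x)
               (\<lambda>x. x \<in> cball (xs k) r) (xs (Suc k)) \<and>
             pg_returns (\<lambda>y. - f (xs (Suc k), y)) q lam_bar \<rho> (\<tau> k) (ys k) (ys (Suc k))))"

end

theory Submission
  imports Defs
begin

text \<open>
  Away from \<open>\<epsilon>\<close>-critical points of \<open>\<Psi>\<close> the local KL inequality turns the inner maximization into a
  well-behaved problem, and a point \<open>x\<close> that is not \<open>(r, \<epsilon>)\<close>-stationary has no \<open>\<epsilon>\<close>-critical point in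
  its whole \<open>r\<close>-ball. So let all iterates be non-stationary. Three facts then hold in the
  ball around an iterate.

  \<^item> The KL inequality implies an error bound: the distance of \<open>y\<close> to the set of maximizers is at most
    \<open>gap powr (1 - \<theta>) / (C (1 - \<theta>))\<close> (\<open>error_bound\<close>). In particular \<open>y\<^sup>k\<close> yields an inexact gradient with an error of
    order \<open>1 / sqrt (k + 1)\<close>.
  \<^item> A maximizer \<open>y\<close> at \<open>x\<close> stays nearly optimal at a nearby point \<open>x'\<close>, since its residual at
    \<open>x'\<close> is at most \<open>Lg |x' - x|\<close>. This gives an upper bound of \<open>F_max\<close> with the remainder
    \<open>Lg/2 |d|\<^sup>2 + (1 - \<theta>) M |d| powr (1 + \<nu>)\<close>, where \<open>1 + \<nu> = 1 / \<theta>\<close> (\<open>F_max_Holder_upper_bound\<close>).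
  \<^item> The subroutine returns a point of small residual, hence by KL of small gap; the radius \<open>r\<close> is chosen
    so that the gap before the call is still in the KL region (\<open>run_gap\<close>).

  Young's inequality absorbs the Hoelder term into the quadratic model with the constant \<open>L k\<close> at the price of
  an error of \<open>1 / (2 (k + 1))\<close>, so that the potential \<open>\<Psi>\<close> decreases by \<open>L k/4 |d|\<^sup>2\<close> up to a multiple of \<open>1 / (k + 1)\<close>
  (\<open>descent\<close>). Averaging over the second half of \<open>n\<close> steps produces a step with
  \<open>L k |d|\<^sup>2 < (a + b ln n) / n\<close>. If \<open>n\<close> is as large as the complexity bound, this step is shorter than
  \<open>r\<close>, so the ball constraint is inactive, and \<open>\<Psi>\<close> has a subgradient of norm at most \<open>\<epsilon>\<close> at the new point
  (\<open>small_step_small_residual\<close>, \<open>residual_bound\<close>). Thus the new point is \<open>\<epsilon>\<close>-critical within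
  distance \<open>r\<close> of a non-stationary one, which is absurd. Subgradients of \<open>\<Psi>\<close> are cheap: for a maximizer \<open>y\<close>
  at \<open>x\<close> the function \<open>f(\<cdot>, y) - q y + p\<close> touches \<open>\<Psi>\<close> from below at \<open>x\<close>.

  The claimed iterate is the first stationary one: its predecessors are non-stationary, which gives the
  gap estimate. Unless it is \<open>x0\<close>, it is in the \<open>r\<close>-ball of a non-stationary predecessor, so it is not
  \<open>\<epsilon>\<close>-critical and the error bound applies; for \<open>x0\<close> this has to be assumed.
\<close>

section \<open>Extended-valued convex functions\<close>

abbreviation (input) rv :: "('a \<Rightarrow> ereal) \<Rightarrow> 'a \<Rightarrow> real" where
  "rv \<phi> x \<equiv> real_of_ereal (\<phi> x)"

definition convex_subgradient :: "('a::euclidean_space \<Rightarrow> ereal) \<Rightarrow> 'a \<Rightarrow> 'a \<Rightarrow> bool" where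
  "convex_subgradient \<phi> x v \<longleftrightarrow> (\<forall>u. \<phi> x + ereal (v \<bullet> (u - x)) \<le> \<phi> u)"

lemma proper_closed_convexD:
  assumes "proper_closed_convex \<phi>"
  shows "proper_fun \<phi>" "closed (epi \<phi>)" "convex (epi \<phi>)"
  using assms by (auto simp: proper_closed_convex_def)

lemma proper_eq_ereal:
  assumes "proper_fun \<phi>" "x \<in> edom \<phi>"
  shows "\<phi> x = ereal (rv \<phi> x)"
  using assms by (cases "\<phi> x") (auto simp: proper_fun_def edom_def)

lemma notin_edom: "x \<notin> edom \<phi> \<Longrightarrow> \<phi> x = \<infinity>"
  by (auto simp: edom_def)

lemma edomI: "\<phi> x \<le> ereal c \<Longrightarrow> x \<in> edom \<phi>"
  by (cases "\<phi> x") (auto simp: edom_def)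

lemma proper_convex_combination:
  assumes "proper_fun \<phi>" "convex (epi \<phi>)" "x \<in> edom \<phi>" "u \<in> edom \<phi>" "0 \<le> t" "t \<le> 1"
  shows "x + t *\<^sub>R (u - x) \<in> edom \<phi>"
    and "rv \<phi> (x + t *\<^sub>R (u - x)) \<le> (1 - t) * rv \<phi> x + t * rv \<phi> u"
proof -
  have "(x, rv \<phi> x) \<in> epi \<phi>" "(u, rv \<phi> u) \<in> epi \<phi>"
    using assms proper_eq_ereal[of \<phi>] by (auto simp: epi_def)
  then have "(1 - t) *\<^sub>R (x, rv \<phi> x) + t *\<^sub>R (u, rv \<phi> u) \<in> epi \<phi>"
    using assms by (intro convexD) auto
  moreover have "(1 - t) *\<^sub>R x + t *\<^sub>R u = x + t *\<^sub>R (u - x)"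
    by (simp add: algebra_simps)
  ultimately have le: "\<phi> (x + t *\<^sub>R (u - x)) \<le> ereal ((1 - t) * rv \<phi> x + t * rv \<phi> u)"
    by (simp add: epi_def)
  then show in_dom: "x + t *\<^sub>R (u - x) \<in> edom \<phi>" by (rule edomI)
  show "rv \<phi> (x + t *\<^sub>R (u - x)) \<le> (1 - t) * rv \<phi> x + t * rv \<phi> u"
    using le proper_eq_ereal[OF assms(1) in_dom] by (metis ereal_less_eq(3))
qed

lemma convex_edom:
  assumes "proper_fun \<phi>" "convex (epi \<phi>)"
  shows "convex (edom \<phi>)"
proof -
  have "(1 - t) *\<^sub>R x + t *\<^sub>R u \<in> edom \<phi>" if "x \<in> edom \<phi>" "u \<in> edom \<phi>" "0 \<le> t" "t \<le> 1" for x u t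
    using proper_convex_combination(1)[OF assms that] by (simp add: algebra_simps)
  then show ?thesis by (auto simp: convex_alt)
qed

lemma convex_subgradientI:
  assumes "proper_fun \<phi>" "x \<in> edom \<phi>"
    and "\<And>u. u \<in> edom \<phi> \<Longrightarrow> rv \<phi> x + v \<bullet> (u - x) \<le> rv \<phi> u"
  shows "convex_subgradient \<phi> x v"
  unfolding convex_subgradient_def
proof
  fix u
  show "\<phi> x + ereal (v \<bullet> (u - x)) \<le> \<phi> u"
  proof (cases "u \<in> edom \<phi>")
    case True
    then show ?thesis
      using assms(3)[OF True] proper_eq_ereal[OF assms(1,2)] proper_eq_ereal[OF assms(1) True]
      by (metis ereal_less_eq(3) plus_ereal.simps(1))
  qed (simp add: notin_edom)
qed

text \<open>A minorant that is smooth up to a quadratic term and touches \<open>\<phi>\<close> at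
  \<open>x\<close> has its gradient in the regular subdifferential, because the quadratic term
  vanishes in the difference quotient. With \<open>B = 0\<close> this covers convex subgradients,
  with \<open>B > 0\<close> the function \<open>\<Psi>\<close>.\<close>

lemma limiting_subdiffI:
  fixes \<phi> :: "'a::euclidean_space \<Rightarrow> ereal"
  assumes x: "\<phi> x = ereal c"
    and minorant: "\<And>z. ereal (c + v \<bullet> (z - x) - B * (norm (z - x))\<^sup>2) \<le> \<phi> z"
  shows "v \<in> limiting_subdiff \<phi> x"
proof -
  have quotient: "ereal (- B * norm (z - x))
      \<le> (\<phi> z - \<phi> x - ereal (v \<bullet> (z - x))) / ereal (norm (z - x))" if "z \<noteq> x" for z
  proof (cases "\<phi> z")
    case (real s)
    have "- B * (norm (z - x))\<^sup>2 \<le> s - c - v \<bullet> (z - x)"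
      using minorant[of z] real by simp
    then have "- B * norm (z - x) \<le> (s - c - v \<bullet> (z - x)) / norm (z - x)"
      using that by (simp add: field_simps power2_eq_square)
    then show ?thesis using real x that by simp
  next
    case PInf
    then show ?thesis using x that by simp
  next
    case MInf
    then show ?thesis using minorant[of z] by simp
  qed
  have "((\<lambda>z. - B * norm (z - x)) \<longlongrightarrow> - B * norm (x - x)) (at x)"
    by (intro tendsto_intros)
  then have "((\<lambda>z. ereal (- B * norm (z - x))) \<longlongrightarrow> ereal 0) (at x)"
    by (intro tendsto_ereal) simp
  then have "Liminf (at x) (\<lambda>z. ereal (- B * norm (z - x))) = 0"
    by (intro lim_imp_Liminf) (auto simp: zero_ereal_def)
  moreover have "Liminf (at x) (\<lambda>z. ereal (- B * norm (z - x)))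
      \<le> Liminf (at x) (\<lambda>z. (\<phi> z - \<phi> x - ereal (v \<bullet> (z - x))) / ereal (norm (z - x)))"
    by (intro Liminf_mono) (use quotient in \<open>auto simp: eventually_at_filter\<close>)
  ultimately have "v \<in> regular_subdiff \<phi> x" by (simp add: regular_subdiff_def)
  then have "(\<forall>k::nat. x \<in> edom \<phi> \<and> v \<in> regular_subdiff \<phi> x) \<and> (\<lambda>_. x) \<longlonglongrightarrow> x
      \<and> (\<lambda>_. \<phi> x) \<longlonglongrightarrow> \<phi> x \<and> (\<lambda>_. v) \<longlonglongrightarrow> v"
    using x by (simp add: edom_def)
  then show ?thesis unfolding limiting_subdiff_def
    by (intro CollectI conjI exI[of _ "\<lambda>_. x"] exI[of _ "\<lambda>_. v"]) auto
qed

lemma convex_subgradient_limiting: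
  assumes "proper_fun \<phi>" "x \<in> edom \<phi>" "convex_subgradient \<phi> x v"
  shows "v \<in> limiting_subdiff \<phi> x"
proof (rule limiting_subdiffI[where B = 0])
  show "\<phi> x = ereal (rv \<phi> x)" by (rule proper_eq_ereal) fact+
  then show "ereal (rv \<phi> x + v \<bullet> (z - x) - 0 * (norm (z - x))\<^sup>2) \<le> \<phi> z" for z
    using assms(3) unfolding convex_subgradient_def
    by (metis diff_zero mult_zero_left plus_ereal.simps(1))
qed

lemma nonneg_of_affine_nonneg:
  fixes a b t0 :: real
  assumes "t0 > 0" and "\<And>t. 0 < t \<Longrightarrow> t \<le> t0 \<Longrightarrow> 0 \<le> a + t * b"
  shows "0 \<le> a"
proof -
  have "((\<lambda>t. a + t * b) \<longlongrightarrow> a + 0 * b) (at_right 0)"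
    by (intro tendsto_intros)
  moreover have "\<forall>\<^sub>F t in at_right 0. 0 \<le> a + t * b"
    using assms by (auto simp: eventually_at_right_field intro!: exI[of _ t0])
  ultimately have "0 \<le> a + 0 * b"
    by (intro tendsto_lowerbound) auto
  then show ?thesis by simp
qed

text \<open>First-order optimality of a constrained proximal point: compare \<open>w\<close> with
  points of the segment towards \<open>u\<close>, use convexity of \<open>\<phi>\<close> on it and
  let the step tend to 0. The predicate \<open>P\<close> is tested near \<open>w\<close> only, so
  that the inequality serves the unconstrained subroutine, the descent towards the previous iterate,
  and arbitrary \<open>u\<close> if a ball constraint is inactive at \<open>w\<close>.\<close>

lemma prox_variational_inequality:
  fixes \<phi> :: "'a::euclidean_space \<Rightarrow> ereal"
  assumes "proper_fun \<phi>" "convex (epi \<phi>)"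
    and min: "is_arg_min (\<lambda>u. ereal (g \<bullet> u + c * (norm (u - z))\<^sup>2) + \<phi> u) P w"
    and w: "w \<in> edom \<phi>" and u: "u \<in> edom \<phi>"
    and "t0 > 0" and feasible: "\<And>t. 0 < t \<Longrightarrow> t \<le> t0 \<Longrightarrow> P (w + t *\<^sub>R (u - w))"
  shows "rv \<phi> w - (g + (2 * c) *\<^sub>R (w - z)) \<bullet> (u - w) \<le> rv \<phi> u"
proof -
  define \<alpha> where "\<alpha> = (g + (2 * c) *\<^sub>R (w - z)) \<bullet> (u - w) + rv \<phi> u - rv \<phi> w"
  have "0 \<le> \<alpha> + t * (c * (norm (u - w))\<^sup>2)" if t: "0 < t" "t \<le> min t0 1" for t
  proof -
    let ?v = "w + t *\<^sub>R (u - w)"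
    have v: "?v \<in> edom \<phi>" "rv \<phi> ?v \<le> (1 - t) * rv \<phi> w + t * rv \<phi> u"
      using proper_convex_combination[OF assms(1,2) w u, of t] t by auto
    have "ereal (g \<bullet> w + c * (norm (w - z))\<^sup>2) + \<phi> w \<le> ereal (g \<bullet> ?v + c * (norm (?v - z))\<^sup>2) + \<phi> ?v"
      using min feasible[of t] t by (auto simp: is_arg_min_linorder)
    then have "ereal (g \<bullet> w + c * (norm (w - z))\<^sup>2 + rv \<phi> w)
        \<le> ereal (g \<bullet> ?v + c * (norm (?v - z))\<^sup>2 + rv \<phi> ?v)"
      using proper_eq_ereal[OF assms(1) w] proper_eq_ereal[OF assms(1) v(1)]
      by (metis plus_ereal.simps(1))
    then have "g \<bullet> w + c * (norm (w - z))\<^sup>2 + rv \<phi> w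
        \<le> g \<bullet> ?v + c * (norm (?v - z))\<^sup>2 + (1 - t) * rv \<phi> w + t * rv \<phi> u"
      using v(2) by simp
    moreover have sq: "(norm (?v - z))\<^sup>2
        = (norm (w - z))\<^sup>2 + 2 * t * ((w - z) \<bullet> (u - w)) + t\<^sup>2 * (norm (u - w))\<^sup>2"
      unfolding power2_norm_eq_inner
      by (simp add: algebra_simps inner_commute power2_eq_square)
    moreover have "g \<bullet> ?v = g \<bullet> w + t * (g \<bullet> (u - w))" by (simp add: algebra_simps)
    ultimately have "0 \<le> t * (g \<bullet> (u - w)) + c * (2 * t * ((w - z) \<bullet> (u - w)) + t\<^sup>2 * (norm (u - w))\<^sup>2)
        + t * rv \<phi> u - t * rv \<phi> w"
      by (simp only: distrib_left left_diff_distrib)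
    also have "\<dots> = t * (\<alpha> + t * (c * (norm (u - w))\<^sup>2))"
      unfolding \<alpha>_def by (simp add: algebra_simps power2_eq_square)
    finally show ?thesis using t(1) zero_le_mult_iff[of t] by (metis not_less_iff_gr_or_eq not_le)
  qed
  then have "0 \<le> \<alpha>"
    by (rule nonneg_of_affine_nonneg[of "min t0 1", rotated]) (use \<open>t0 > 0\<close> in auto)
  then show ?thesis by (simp add: \<alpha>_def)
qed

text \<open>Otherwise the nested compact sublevel sets for the levels \<open>- n\<close> have a
  common point, where \<open>\<phi>\<close> is \<open>- \<infinity>\<close>.\<close>

lemma closed_epi_bounded_below_on_compact:
  fixes \<phi> :: "'a::euclidean_space \<Rightarrow> ereal"
  assumes "proper_fun \<phi>" "closed (epi \<phi>)" "compact S"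
  shows "\<exists>m. \<forall>z\<in>S. ereal m \<le> \<phi> z"
proof (rule ccontr)
  assume unbounded: "\<not> ?thesis"
  define T where "T n = S \<inter> {z. \<phi> z \<le> ereal (- real n)}" for n
  have "closed ((\<lambda>z. (z, c)) -` epi \<phi>)" for c
    using assms(2) by (intro closed_vimage) (auto intro!: continuous_intros)
  then have "closed {z. \<phi> z \<le> ereal c}" for c by (simp add: epi_def vimage_def)
  then have "compact (T n)" for n
    unfolding T_def using assms(3) by (intro compact_Int_closed)
  moreover have "T n \<noteq> {}" for n
    using unbounded by (auto simp: T_def not_le dest!: spec[of _ "- real n"] intro: less_imp_le)
  moreover have "T n \<subseteq> T m" if "m \<le> n" for m n
    using that by (auto simp: T_def intro: order_trans)
  ultimately obtain z where z: "z \<in> \<Inter>(range T)"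
    using compact_nest[of T] by blast
  have "\<phi> z \<noteq> - \<infinity>" using assms(1) by (auto simp: proper_fun_def)
  moreover have "\<phi> z \<le> ereal (- real n)" for n using z by (auto simp: T_def)
  ultimately show False
    by (cases "\<phi> z") (auto, metis add.inverse_inverse linorder_not_le neg_le_iff_le reals_Archimedean2)
qed

text \<open>Lower semicontinuity is used through the epigraph: a continuous function is minimized
  over a compact piece of \<open>epi \<phi>\<close>.\<close>

lemma attains_min_on_compact:
  fixes \<phi> :: "'a::euclidean_space \<Rightarrow> ereal" and r :: "'a \<Rightarrow> real"
  assumes "proper_fun \<phi>" "closed (epi \<phi>)" "compact S" "continuous_on S r" "z0 \<in> S" "z0 \<in> edom \<phi>"
  shows "\<exists>w\<in>S. w \<in> edom \<phi> \<and> (\<forall>u\<in>S. ereal (r w) + \<phi> w \<le> ereal (r u) + \<phi> u)"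
proof -
  obtain m where m: "ereal m \<le> \<phi> z" if "z \<in> S" for z
    using closed_epi_bounded_below_on_compact[OF assms(1-3)] by blast
  have "compact (r ` S)" using assms(3,4) by (rule compact_continuous_image[rotated])
  then obtain B where B: "\<bar>r z\<bar> \<le> B" if "z \<in> S" for z
    using compact_imp_bounded bounded_iff by (metis imageI real_norm_def)
  define c0 where "c0 = r z0 + rv \<phi> z0"
  define T where "T = (S \<times> {m..c0 + B}) \<inter> epi \<phi>"
  have z0: "\<phi> z0 = ereal (rv \<phi> z0)" by (rule proper_eq_ereal) fact+
  have "compact T" unfolding T_def
    using assms(2,3) by (intro compact_Int_closed compact_Times) auto
  moreover have z0T: "(z0, rv \<phi> z0) \<in> T"
    using z0 m[OF \<open>z0 \<in> S\<close>] B[OF \<open>z0 \<in> S\<close>] \<open>z0 \<in> S\<close>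
    by (auto simp: T_def epi_def c0_def)
      (metis ereal_less_eq(3))
  moreover have "continuous_on T (\<lambda>x. r (fst x) + snd x)"
    by (intro continuous_intros continuous_on_compose2[OF assms(4)]) (auto simp: T_def)
  ultimately obtain x where x: "x \<in> T" "\<And>y. y \<in> T \<Longrightarrow> r (fst x) + snd x \<le> r (fst y) + snd y"
    using continuous_attains_inf[of T "\<lambda>x. r (fst x) + snd x"] by blast
  obtain w t where wt: "x = (w, t)" by (cases x)
  have w: "w \<in> S" "\<phi> w \<le> ereal t" using x(1) by (auto simp: T_def epi_def wt)
  have "ereal (r w) + \<phi> w \<le> ereal (r u) + \<phi> u" if "u \<in> S" for u
  proof (cases "\<phi> u \<le> ereal (c0 + B)")
    case True
    then have u: "\<phi> u = ereal (rv \<phi> u)" by (intro proper_eq_ereal assms(1) edomI)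
    then have "(u, rv \<phi> u) \<in> T"
      using True m[OF that] that by (auto simp: T_def epi_def) (metis ereal_less_eq(3))+
    then have "r w + t \<le> r u + rv \<phi> u" using x(2)[of "(u, rv \<phi> u)"] by (simp add: wt)
    moreover have "ereal (r w) + \<phi> w \<le> ereal (r w) + ereal t" using w(2) by (rule add_left_mono)
    ultimately show ?thesis using u by (metis ereal_less_eq(3) order_trans plus_ereal.simps(1))
  next
    case False
    have "r w + t \<le> c0" using x(2)[OF z0T] by (simp add: wt c0_def)
    moreover have "ereal (r w) + \<phi> w \<le> ereal (r w) + ereal t" using w(2) by (rule add_left_mono)
    ultimately have "ereal (r w) + \<phi> w \<le> ereal c0" by (metis ereal_less_eq(3) order_trans plus_ereal.simps(1))
    also have "\<dots> \<le> ereal (r u) + ereal (c0 + B)" using B[OF that] by simp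
    also have "\<dots> \<le> ereal (r u) + \<phi> u" using False by (intro add_left_mono) auto
    finally show ?thesis .
  qed
  with w show ?thesis by (intro bexI[of _ w]) (auto intro: edomI)
qed

text \<open>A convex function that is bounded below on a ball around \<open>y\<close> decreases at
  most linearly in the distance to \<open>y\<close>, so the quadratic term dominates outside a large
  ball, and a minimizer over this ball is a global one.\<close>

lemma proximal_point_exists:
  fixes \<phi> :: "'a::euclidean_space \<Rightarrow> ereal"
  assumes "proper_closed_convex \<phi>" and "c > 0"
  shows "\<exists>w. is_arg_min (\<lambda>u. ereal (g \<bullet> u + c * (norm (u - z))\<^sup>2) + \<phi> u) (\<lambda>u. True) w"
proof -
  note \<phi> = proper_closed_convexD[OF assms(1)]
  obtain y where y: "y \<in> edom \<phi>" using \<phi>(1) by (auto simp: proper_fun_def)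
  note yr = proper_eq_ereal[OF \<phi>(1) y]
  obtain m where m: "ereal m \<le> \<phi> u" if "u \<in> cball y 1" for u
    using closed_epi_bounded_below_on_compact[OF \<phi>(1,2) compact_cball] by blast
  define s where "s = rv \<phi> y - m"
  have "s \<ge> 0" using m[of y] yr by (simp add: s_def) (metis ereal_less_eq(3))
  have lower: "rv \<phi> y - s * norm (u - y) \<le> rv \<phi> u" if u: "u \<in> edom \<phi>" "norm (u - y) \<ge> 1" for u
  proof -
    let ?R = "norm (u - y)" and ?v = "y + (1 / norm (u - y)) *\<^sub>R (u - y)"
    have v: "?v \<in> edom \<phi>" "rv \<phi> ?v \<le> (1 - 1 / ?R) * rv \<phi> y + 1 / ?R * rv \<phi> u"
      using proper_convex_combination[OF \<phi>(1,3) y u(1), of "1 / ?R"] u(2)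
      by (simp_all add: divide_le_eq_1)
    have "norm ((1 / ?R) *\<^sub>R (u - y)) = 1" using u(2) by auto
    then have "?v \<in> cball y 1" by (simp add: dist_norm)
    then have "m \<le> rv \<phi> ?v" using m proper_eq_ereal[OF \<phi>(1) v(1)] by (metis ereal_less_eq(3))
    with v(2) have "m \<le> (1 - 1 / ?R) * rv \<phi> y + 1 / ?R * rv \<phi> u" by linarith
    then have "m * ?R \<le> ((1 - 1 / ?R) * rv \<phi> y + 1 / ?R * rv \<phi> u) * ?R"
      by (intro mult_right_mono) auto
    also have "\<dots> = (?R - 1) * rv \<phi> y + rv \<phi> u"
      using u(2) by (simp add: field_simps)
    finally show ?thesis by (simp add: s_def algebra_simps)
  qed
  let ?E = "\<lambda>u. ereal (g \<bullet> u + c * (norm (u - z))\<^sup>2) + \<phi> u"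
  define e where "e = norm (z - y)"
  \<comment> \<open>Outside this radius the quadratic term beats the linear terms \<open>norm g\<close> and \<open>s\<close>.\<close>
  define R0 where "R0 = 1 + 2 * e + (norm g + s) / c"
  have R0: "R0 \<ge> 1" using \<open>s \<ge> 0\<close> \<open>c > 0\<close> by (simp add: R0_def e_def)
  have "\<exists>w\<in>cball y R0. w \<in> edom \<phi> \<and> (\<forall>u\<in>cball y R0. ?E w \<le> ?E u)"
    using R0 by (intro attains_min_on_compact[OF \<phi>(1,2), where ?z0.0 = y] y)
      (auto intro!: continuous_intros)
  then obtain w where w: "w \<in> cball y R0" "\<And>u. u \<in> cball y R0 \<Longrightarrow> ?E w \<le> ?E u" by blast
  have "?E w \<le> ?E u" for u
  proof (cases "u \<in> cball y R0")
    case False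
    then have R: "norm (u - y) > R0" by (simp add: dist_norm norm_minus_commute)
    show ?thesis
    proof (cases "u \<in> edom \<phi>")
      case True
      let ?R = "norm (u - y)"
      have "?R - e \<le> norm (u - z)" using norm_triangle_ineq[of "u - z" "z - y"] by (simp add: e_def)
      moreover have "0 \<le> ?R - e" using R \<open>s \<ge> 0\<close> \<open>c > 0\<close> unfolding R0_def e_def
        by (smt (verit) divide_nonneg_pos norm_ge_zero)
      ultimately have 1: "(?R - e)\<^sup>2 \<le> (norm (u - z))\<^sup>2" by (rule power_mono)
      have 2: "- (norm g * ?R) \<le> g \<bullet> (u - y)"
        using Cauchy_Schwarz_ineq2[of g "u - y"] by linarith
      have 3: "rv \<phi> y - s * ?R \<le> rv \<phi> u" using lower[OF True] R R0 by linarith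
      have "norm g + s \<le> c * (?R - 2 * e)"
      proof -
        have "(norm g + s) / c \<le> ?R - 2 * e" using R by (simp add: R0_def)
        then show ?thesis using \<open>c > 0\<close> by (simp add: field_simps)
      qed
      then have "(norm g + s) * ?R \<le> c * (?R - 2 * e) * ?R" by (rule mult_right_mono) simp
      also have "\<dots> = c * (?R - e)\<^sup>2 - c * e\<^sup>2" by (simp add: power2_eq_square algebra_simps)
      also have "\<dots> \<le> c * (norm (u - z))\<^sup>2 - c * e\<^sup>2" using 1 \<open>c > 0\<close> by simp
      finally have "g \<bullet> y + c * (norm (y - z))\<^sup>2 + rv \<phi> y \<le> g \<bullet> u + c * (norm (u - z))\<^sup>2 + rv \<phi> u"
        using 2 3 by (simp add: e_def norm_minus_commute algebra_simps)
      then have "?E y \<le> ?E u"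
        using yr proper_eq_ereal[OF \<phi>(1) True] by (metis ereal_less_eq(3) plus_ereal.simps(1))
      moreover have "?E w \<le> ?E y" using R0 by (intro w(2)) auto
      ultimately show ?thesis by (rule order_trans[rotated])
    qed (simp add: notin_edom)
  qed (rule w(2))
  then show ?thesis by (auto simp: is_arg_min_linorder)
qed

text \<open>The sum rule for the convex function \<open>\<phi>\<close> and the perturbation
  \<open>\<kappa> |u - z|\<close>: a hyperplane separates the epigraph of \<open>\<phi>\<close> from
  the open hypograph of the concave minorant. It is not vertical, since the hypograph projects onto
  the whole space, and its slope is the required subgradient.\<close>

lemma subgradient_near_perturbed_minorant:
  fixes \<phi> :: "'a::euclidean_space \<Rightarrow> ereal"
  assumes "proper_fun \<phi>" "convex (epi \<phi>)" "z \<in> edom \<phi>" "\<kappa> \<ge> 0"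
    and minorant: "\<And>u. u \<in> edom \<phi> \<Longrightarrow> rv \<phi> z + g \<bullet> (u - z) - \<kappa> * norm (u - z) \<le> rv \<phi> u"
  shows "\<exists>v. convex_subgradient \<phi> z v \<and> norm (g - v) \<le> \<kappa>"
proof -
  define h where "h u = rv \<phi> z + g \<bullet> (u - z) - \<kappa> * norm (u - z)" for u
  \<comment> \<open>The hypograph is taken open, so that it is disjoint from the epigraph even though the two touch at \<open>z\<close>.\<close>
  define H where "H = {(u, t). t < h u}"
  have h_concave: "(1 - s) * h u + s * h v \<le> h ((1 - s) *\<^sub>R u + s *\<^sub>R v)" if "0 \<le> s" "s \<le> 1" for u v s
  proof -
    have "norm ((1 - s) *\<^sub>R u + s *\<^sub>R v - z) = norm ((1 - s) *\<^sub>R (u - z) + s *\<^sub>R (v - z))"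
      by (simp add: algebra_simps)
    also have "\<dots> \<le> (1 - s) * norm (u - z) + s * norm (v - z)"
      using norm_triangle_ineq[of "(1 - s) *\<^sub>R (u - z)" "s *\<^sub>R (v - z)"] that by simp
    finally have "\<kappa> * norm ((1 - s) *\<^sub>R u + s *\<^sub>R v - z) \<le> \<kappa> * ((1 - s) * norm (u - z) + s * norm (v - z))"
      using \<open>\<kappa> \<ge> 0\<close> by (rule mult_left_mono)
    then show ?thesis by (simp add: h_def algebra_simps)
  qed
  have convex_H: "convex H"
    unfolding convex_alt
  proof (intro ballI allI impI)
    fix x y and s :: real assume x: "x \<in> H" and y: "y \<in> H" and s: "0 \<le> s \<and> s \<le> 1"
    obtain u a v b where eq: "x = (u, a)" "y = (v, b)" by (cases x; cases y)
    have ab: "a < h u" "b < h v" using x y by (auto simp: H_def eq)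
    have "(1 - s) * a + s * b < (1 - s) * h u + s * h v"
    proof (cases "s = 0")
      case False
      then show ?thesis using ab s
        by (intro add_le_less_mono mult_left_mono mult_strict_left_mono) auto
    qed (use ab in simp)
    then show "(1 - s) *\<^sub>R x + s *\<^sub>R y \<in> H"
      using h_concave[of s u v] s by (simp add: H_def eq)
  qed
  have "(z, h z - 1) \<in> H" by (simp add: H_def)
  then have nonempty_H: "H \<noteq> {}" by blast
  have z_epi: "(z, rv \<phi> z) \<in> epi \<phi>"
    using proper_eq_ereal[OF assms(1,3)] by (simp add: epi_def)
  have disjoint: "H \<inter> epi \<phi> = {}"
  proof -
    have False if "t < h u" "\<phi> u \<le> ereal t" for u t
    proof -
      have u: "u \<in> edom \<phi>" using that(2) by (rule edomI)
      then have "rv \<phi> u \<le> t" using that(2) proper_eq_ereal[OF assms(1) u] by (metis ereal_less_eq(3))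
      then show False using minorant[OF u] that(1) by (simp add: h_def)
    qed
    then show ?thesis by (auto simp: H_def epi_def)
  qed
  have "epi \<phi> \<noteq> {}" using z_epi by blast
  then obtain n b where n: "n \<noteq> 0" "\<And>x. x \<in> H \<Longrightarrow> n \<bullet> x \<le> b" "\<And>x. x \<in> epi \<phi> \<Longrightarrow> b \<le> n \<bullet> x"
    using separating_hyperplane_sets[OF convex_H assms(2) nonempty_H _ disjoint] by blast
  obtain a \<beta> where n_eq: "n = (a, \<beta>)" by (cases n)
  have H_le: "a \<bullet> u + \<beta> * t \<le> b" if "t < h u" for u t
    using n(2)[of "(u, t)"] that by (simp add: H_def n_eq)
  have H_closure: "a \<bullet> u + \<beta> * h u \<le> b" for u
  proof -
    have "((\<lambda>s. a \<bullet> u + \<beta> * (h u - s)) \<longlongrightarrow> a \<bullet> u + \<beta> * (h u - 0)) (at_right 0)"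
      by (intro tendsto_intros)
    moreover have "\<forall>\<^sub>F s in at_right 0. a \<bullet> u + \<beta> * (h u - s) \<le> b"
      using H_le by (auto simp: eventually_at_right_field intro!: exI[of _ 1])
    ultimately have "a \<bullet> u + \<beta> * (h u - 0) \<le> b" by (rule tendsto_upperbound) simp
    then show ?thesis by simp
  qed
  have epi_ge: "b \<le> a \<bullet> u + \<beta> * rv \<phi> u" if "u \<in> edom \<phi>" for u
    using n(3)[of "(u, rv \<phi> u)"] proper_eq_ereal[OF assms(1) that] by (simp add: epi_def n_eq)
  have hz: "h z = rv \<phi> z" by (simp add: h_def)
  have b: "b = a \<bullet> z + \<beta> * rv \<phi> z"
    using H_closure[of z] epi_ge[OF assms(3)] by (simp add: hz)
  have "\<beta> \<ge> 0"
    using H_le[of "rv \<phi> z - 1" z] by (simp add: hz b algebra_simps)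
  moreover have "\<beta> \<noteq> 0"
  proof
    assume "\<beta> = 0"
    then have "a \<bullet> (z + a) \<le> a \<bullet> z" using H_closure[of "z + a"] by (simp add: b)
    then have "a \<bullet> a \<le> 0" by (simp add: inner_add_right)
    then have "a = 0" by (metis inner_ge_zero inner_eq_zero_iff order_antisym)
    with \<open>\<beta> = 0\<close> n(1) show False by (simp add: n_eq zero_prod_def)
  qed
  ultimately have "\<beta> > 0" by simp
  define v where "v = - (1 / \<beta>) *\<^sub>R a"
  have av: "a \<bullet> w = - \<beta> * (v \<bullet> w)" for w using \<open>\<beta> > 0\<close> by (simp add: v_def)
  have "convex_subgradient \<phi> z v"
  proof (rule convex_subgradientI[OF assms(1,3)])
    fix u assume "u \<in> edom \<phi>"
    from epi_ge[OF this] have "0 \<le> a \<bullet> (u - z) + \<beta> * (rv \<phi> u - rv \<phi> z)"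
      by (simp add: b algebra_simps)
    also have "\<dots> = \<beta> * (rv \<phi> u - rv \<phi> z - v \<bullet> (u - z))" by (simp add: av algebra_simps)
    finally show "rv \<phi> z + v \<bullet> (u - z) \<le> rv \<phi> u" using \<open>\<beta> > 0\<close> by (simp add: zero_le_mult_iff)
  qed
  moreover have "norm (g - v) \<le> \<kappa>"
  proof -
    let ?w = "g - v"
    have "a \<bullet> ?w + \<beta> * (g \<bullet> ?w - \<kappa> * norm ?w) \<le> 0"
      using H_closure[of "z + ?w"] by (simp add: b h_def algebra_simps)
    moreover have "a \<bullet> ?w + \<beta> * (g \<bullet> ?w - \<kappa> * norm ?w) = \<beta> * (?w \<bullet> ?w - \<kappa> * norm ?w)"
      by (simp add: av algebra_simps)
    ultimately have "?w \<bullet> ?w - \<kappa> * norm ?w \<le> 0" using \<open>\<beta> > 0\<close> by (simp add: mult_le_0_iff)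
    then have "norm ?w * norm ?w \<le> \<kappa> * norm ?w"
      by (simp add: power2_norm_eq_inner[symmetric] power2_eq_square)
    then show ?thesis using \<open>\<kappa> \<ge> 0\<close> by (cases "norm ?w = 0") auto
  qed
  ultimately show ?thesis by blast
qed

section \<open>Smoothness on convex sets\<close>

lemma GDERIV_gradient:
  fixes f :: "'a::euclidean_space \<Rightarrow> real"
  assumes "f differentiable (at x)"
  shows "GDERIV f x :> gradient f x"
proof -
  obtain f' where f': "(f has_derivative f') (at x)" using assms by (auto simp: differentiable_def)
  interpret linear f' using f' by (rule has_derivative_linear)
  define D where "D = (\<Sum>i\<in>Basis. f' i *\<^sub>R i)"
  have "f' h = h \<bullet> D" for h
  proof -
    have "f' h = f' (\<Sum>i\<in>Basis. (h \<bullet> i) *\<^sub>R i)" by (simp add: euclidean_representation)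
    also have "\<dots> = h \<bullet> D" by (simp add: sum scale D_def inner_sum_right mult.commute)
    finally show ?thesis .
  qed
  then have "f' = (\<lambda>h. h \<bullet> D)" by blast
  with f' have D: "GDERIV f x :> D" by (simp add: gderiv_def)
  have "E = D" if "GDERIV f x :> E" for E
  proof -
    have "(\<lambda>h. h \<bullet> E) = (\<lambda>h. h \<bullet> D)"
      using has_derivative_unique[of f "\<lambda>h. h \<bullet> E" x "\<lambda>h. h \<bullet> D"] that D by (auto simp: gderiv_def)
    then show ?thesis by (metis vector_eq_ldot)
  qed
  with D show ?thesis unfolding gradient_def by (rule theI[of "\<lambda>D. GDERIV f x :> D"])
qed

lemma GDERIV_imp_gradient:
  assumes "GDERIV f x :> D" shows "gradient f x = D"
proof -
  have "f differentiable (at x)" using assms by (auto simp: gderiv_def differentiable_def)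
  then have "(\<lambda>h. h \<bullet> gradient f x) = (\<lambda>h. h \<bullet> D)"
    using has_derivative_unique[of f "\<lambda>h. h \<bullet> gradient f x" x "\<lambda>h. h \<bullet> D"] assms GDERIV_gradient[of f x]
    by (auto simp: gderiv_def)
  then show ?thesis by (metis vector_eq_ldot)
qed

lemma GDERIV_partial:
  fixes f :: "'a::euclidean_space \<times> 'b::euclidean_space \<Rightarrow> real"
  assumes "f differentiable (at (x, y))"
  shows "GDERIV (\<lambda>u. f (u, y)) x :> fst (gradient f (x, y))"
    and "GDERIV (\<lambda>u. f (x, u)) y :> snd (gradient f (x, y))"
proof -
  have f: "(f has_derivative (\<lambda>h. h \<bullet> gradient f (x, y))) (at (x, y))"
    using GDERIV_gradient[OF assms] by (simp add: gderiv_def)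
  have "((\<lambda>u. (u, y)) has_derivative (\<lambda>h. (h, 0))) (at x)"
    by (auto intro!: derivative_eq_intros)
  from has_derivative_compose[OF this f] show "GDERIV (\<lambda>u. f (u, y)) x :> fst (gradient f (x, y))"
    by (simp add: gderiv_def inner_prod_def)
  have "((\<lambda>u. (x, u)) has_derivative (\<lambda>h. (0, h))) (at y)"
    by (auto intro!: derivative_eq_intros)
  from has_derivative_compose[OF this f] show "GDERIV (\<lambda>u. f (x, u)) y :> snd (gradient f (x, y))"
    by (simp add: gderiv_def inner_prod_def)
qed

lemma GDERIV_along_line:
  assumes "GDERIV g (x + t *\<^sub>R d) :> G"
  shows "((\<lambda>s. g (x + s *\<^sub>R d)) has_real_derivative (d \<bullet> G)) (at t)"
proof -
  have "((\<lambda>s. x + s *\<^sub>R d) has_derivative (\<lambda>h. h *\<^sub>R d)) (at t)"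
    by (auto intro!: derivative_eq_intros)
  from has_derivative_compose[OF this assms[unfolded gderiv_def]] show ?thesis
    by (simp add: has_field_derivative_def mult.commute[of "d \<bullet> G"] mult_commute_abs)
qed

text \<open>The usual descent lemma; the gradient is Lipschitz on \<open>S\<close> only, so the
  segment has to stay in \<open>S\<close>.\<close>

lemma smooth_upper_bound:
  fixes g :: "'a::euclidean_space \<Rightarrow> real"
  assumes G: "\<And>u. GDERIV g u :> G u" and "convex S"
    and lip: "\<And>u v. u \<in> S \<Longrightarrow> v \<in> S \<Longrightarrow> norm (G u - G v) \<le> L * norm (u - v)"
    and x: "x \<in> S" and y: "y \<in> S"
  shows "g y \<le> g x + G x \<bullet> (y - x) + L / 2 * (norm (y - x))\<^sup>2"
proof -
  define d where "d = y - x"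
  define \<phi> where "\<phi> t = g (x + t *\<^sub>R d) - t * (d \<bullet> G x) - L * t\<^sup>2 / 2 * (norm d)\<^sup>2" for t
  have "\<phi> 1 \<le> \<phi> 0"
  proof (rule DERIV_nonpos_imp_nonincreasing[of 0 1 \<phi>])
    fix t :: real assume t: "0 \<le> t" "t \<le> 1"
    have S: "x + t *\<^sub>R d \<in> S"
      using convexD_alt[OF \<open>convex S\<close> x y t] by (simp add: d_def algebra_simps)
    have "d \<bullet> (G (x + t *\<^sub>R d) - G x) \<le> norm d * norm (G (x + t *\<^sub>R d) - G x)"
      by (rule norm_cauchy_schwarz)
    also have "\<dots> \<le> norm d * (L * (t * norm d))"
      using lip[OF S x] t by (intro mult_left_mono) auto
    finally have "d \<bullet> G (x + t *\<^sub>R d) - d \<bullet> G x - L * t * (norm d)\<^sup>2 \<le> 0"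
      by (simp add: inner_diff_right power2_eq_square algebra_simps)
    moreover have "(\<phi> has_real_derivative (d \<bullet> G (x + t *\<^sub>R d) - d \<bullet> G x - L * t * (norm d)\<^sup>2)) (at t)"
      unfolding \<phi>_def by (auto intro!: derivative_eq_intros GDERIV_along_line G)
    ultimately show "\<exists>D. (\<phi> has_real_derivative D) (at t) \<and> D \<le> 0" by blast
  qed simp
  then show ?thesis by (simp add: \<phi>_def d_def inner_commute)
qed

lemma smooth_lower_bound:
  fixes g :: "'a::euclidean_space \<Rightarrow> real"
  assumes G: "\<And>u. GDERIV g u :> G u" and "convex S"
    and lip: "\<And>u v. u \<in> S \<Longrightarrow> v \<in> S \<Longrightarrow> norm (G u - G v) \<le> L * norm (u - v)"
    and "x \<in> S" "y \<in> S"
  shows "g x + G x \<bullet> (y - x) - L / 2 * (norm (y - x))\<^sup>2 \<le> g y"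
proof -
  have "norm (- G u - - G v) \<le> L * norm (u - v)" if "u \<in> S" "v \<in> S" for u v
    using lip[OF that] by (simp add: norm_minus_commute)
  then have "- g y \<le> - g x + (- G x) \<bullet> (y - x) + L / 2 * (norm (y - x))\<^sup>2"
    using assms(2,4,5) G
    by (intro smooth_upper_bound[where g = "\<lambda>u. - g u" and G = "\<lambda>u. - G u"])
      (auto intro: GDERIV_minus)
  then show ?thesis by simp
qed

lemma norm_fst_diff_le: "norm (fst a - fst b) \<le> norm (a - b)"
  and norm_snd_diff_le: "norm (snd a - snd b) \<le> norm (a - b)"
  by (metis fst_diff norm_fst_le prod.collapse) (metis snd_diff norm_snd_le prod.collapse)

lemma edist_leI: "s \<in> S \<Longrightarrow> dist x s \<le> c \<Longrightarrow> edist x S \<le> ereal c"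
  unfolding edist_def by (rule INF_lower2) auto

lemma epowr_mono:
  assumes "ereal c \<le> t" "0 \<le> c" "0 \<le> s"
  shows "ereal (c powr s) \<le> epowr t s"
  using assms by (cases t) (auto simp: epowr_def intro: powr_mono2)

section \<open>The minimax problem\<close>

locale kl_minimax =
  fixes f :: "'a::euclidean_space \<times> 'b::euclidean_space \<Rightarrow> real"
    and p :: "'a \<Rightarrow> ereal" and q :: "'b \<Rightarrow> ereal"
    and Lf Lg C \<theta> \<gamma> \<sigma> :: real
  assumes f_differentiable: "\<And>z. f differentiable (at z)"
    and Lf_pos: "Lf > 0" and Lg_pos: "Lg > 0"
    and f_lipschitz: "\<And>y. y \<in> edom q \<Longrightarrow> lipschitz_on Lf (edom p) (\<lambda>x. f (x, y))"
    and grad_lipschitz: "lipschitz_on Lg (edom p \<times> edom q) (gradient f)"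
    and p_pcc: "proper_closed_convex p"
    and q_pcc: "proper_closed_convex q"
    and max_attained: "\<And>x. x \<in> edom p \<Longrightarrow> Ymax f q x \<noteq> {} \<and> \<bar>Fmax f q x\<bar> \<noteq> \<infinity>"
    and constants: "C > 0" "1 / 2 \<le> \<theta>" "\<theta> < 1" "\<gamma> > 0" "\<sigma> > 0"
    and KL: "\<And>x y. x \<in> edom p \<Longrightarrow> y \<in> KL_region f p q \<gamma> \<sigma> x \<Longrightarrow>
               ereal C * epowr (Fmax f q x - Fobj f q x y) \<theta> \<le> edist 0 (subdiff_y f q x y)"
begin

abbreviation "X \<equiv> edom p"
abbreviation "Y \<equiv> edom q"
abbreviation "gx x y \<equiv> fst (gradient f (x, y))"
abbreviation "gy x y \<equiv> snd (gradient f (x, y))"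
abbreviation "F_max \<equiv> rv (Fmax f q)"
abbreviation "\<Psi> \<equiv> Psi f p q"

definition gap :: "'a \<Rightarrow> 'b \<Rightarrow> real" where
  "gap x y = F_max x - (f (x, y) - rv q y)"

lemmas p_proper = proper_closed_convexD[OF p_pcc] and q_proper = proper_closed_convexD[OF q_pcc]
lemmas p_eq = proper_eq_ereal[OF p_proper(1)] and q_eq = proper_eq_ereal[OF q_proper(1)]
lemmas convex_X = convex_edom[OF p_proper(1,3)] and convex_Y = convex_edom[OF q_proper(1,3)]

lemma theta_bounds: "0 < \<theta>" "\<theta> \<noteq> 0" "0 < 1 - \<theta>" "1 - \<theta> < 1" using constants by auto

lemma grad_x: "GDERIV (\<lambda>u. f (u, y)) x :> gx x y" and grad_y: "GDERIV (\<lambda>u. f (x, u)) y :> gy x y"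
  by (rule GDERIV_partial[OF f_differentiable])+

lemma gradient_x: "gradient (\<lambda>u. f (u, y)) x = gx x y"
  and gradient_y: "gradient (\<lambda>u. f (x, u)) y = gy x y"
  and gradient_minus_y: "gradient (\<lambda>u. - f (x, u)) y = - gy x y"
  by (intro GDERIV_imp_gradient grad_x grad_y GDERIV_minus)+

lemma continuous_f: "continuous_on S f"
  by (meson continuous_at_imp_continuous_on differentiable_imp_continuous_within f_differentiable)

lemma gradient_dist:
  assumes "x \<in> X" "x' \<in> X" "y \<in> Y" "y' \<in> Y"
  shows "norm (gradient f (x, y) - gradient f (x', y')) \<le> Lg * norm ((x, y) - (x', y'))"
  using lipschitz_onD[OF grad_lipschitz, of "(x, y)" "(x', y')"] assms by (simp add: dist_norm)

lemma gx_dist_x: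
  assumes "x \<in> X" "x' \<in> X" "y \<in> Y"
  shows "norm (gx x y - gx x' y) \<le> Lg * norm (x - x')"
  using order_trans[OF norm_fst_diff_le gradient_dist[OF assms(1-3,3)]] by simp

lemma gx_dist_y:
  assumes "x \<in> X" "y \<in> Y" "y' \<in> Y"
  shows "norm (gx x y - gx x y') \<le> Lg * norm (y - y')"
  using order_trans[OF norm_fst_diff_le gradient_dist[OF assms(1,1-3)]] by simp

lemma gy_dist_x:
  assumes "x \<in> X" "x' \<in> X" "y \<in> Y"
  shows "norm (gy x y - gy x' y) \<le> Lg * norm (x - x')"
  using order_trans[OF norm_snd_diff_le gradient_dist[OF assms(1-3,3)]] by simp

lemma gy_dist_y:
  assumes "x \<in> X" "y \<in> Y" "y' \<in> Y"
  shows "norm (gy x y - gy x y') \<le> Lg * norm (y - y')"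
  using order_trans[OF norm_snd_diff_le gradient_dist[OF assms(1,1-3)]] by simp

lemma f_upper_x:
  assumes "x \<in> X" "x' \<in> X" "y \<in> Y"
  shows "f (x', y) \<le> f (x, y) + gx x y \<bullet> (x' - x) + Lg / 2 * (norm (x' - x))\<^sup>2"
  using smooth_upper_bound[where g = "\<lambda>u. f (u, y)", OF grad_x convex_X gx_dist_x] assms by auto

lemma f_lower_x:
  assumes "x \<in> X" "x' \<in> X" "y \<in> Y"
  shows "f (x, y) + gx x y \<bullet> (x' - x) - Lg / 2 * (norm (x' - x))\<^sup>2 \<le> f (x', y)"
  using smooth_lower_bound[where g = "\<lambda>u. f (u, y)", OF grad_x convex_X gx_dist_x] assms by auto

lemma f_lower_y:
  assumes "x \<in> X" "y \<in> Y" "y' \<in> Y"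
  shows "f (x, y) + gy x y \<bullet> (y' - y) - Lg / 2 * (norm (y' - y))\<^sup>2 \<le> f (x, y')"
  using smooth_lower_bound[where g = "\<lambda>u. f (x, u)", OF grad_y convex_Y gy_dist_y] assms by auto

lemma Fobj_eq: "y \<in> Y \<Longrightarrow> Fobj f q x y = ereal (f (x, y) - rv q y)"
  unfolding Fobj_def using q_eq[of y] by (metis ereal_minus(1))

lemma Fmax_eq: "x \<in> X \<Longrightarrow> Fmax f q x = ereal (F_max x)"
  using max_attained[of x] by (cases "Fmax f q x") auto

lemma Fmax_minus_Fobj: "x \<in> X \<Longrightarrow> y \<in> Y \<Longrightarrow> Fmax f q x - Fobj f q x y = ereal (gap x y)"
  unfolding gap_def using Fmax_eq[of x] Fobj_eq[of y x] by (metis ereal_minus(1))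

lemma gap_nonneg: "x \<in> X \<Longrightarrow> y \<in> Y \<Longrightarrow> 0 \<le> gap x y"
proof -
  assume x: "x \<in> X" and y: "y \<in> Y"
  have "Fobj f q x y \<le> Fmax f q x" unfolding Fmax_def by (rule SUP_upper) simp
  then show ?thesis using Fobj_eq[OF y] Fmax_eq[OF x] unfolding gap_def
    by (metis diff_ge_0_iff_ge ereal_less_eq(3))
qed

lemma Ymax_iff: "x \<in> X \<Longrightarrow> y \<in> Ymax f q x \<longleftrightarrow> y \<in> Y \<and> gap x y = 0"
proof -
  assume x: "x \<in> X"
  have "y \<in> Y" if "y \<in> Ymax f q x"
  proof (rule ccontr)
    assume "y \<notin> Y"
    then show False using that Fmax_eq[OF x]
      by (metis (mono_tags, lifting) Fobj_def MInfty_neq_ereal(1) Ymax_def ereal_minus(3) mem_Collect_eq notin_edom)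
  qed
  moreover have "y \<in> Ymax f q x \<longleftrightarrow> gap x y = 0" if "y \<in> Y"
  proof -
    have "y \<in> Ymax f q x \<longleftrightarrow> ereal (f (x, y) - rv q y) = ereal (F_max x)"
      using Fobj_eq[OF that, of x] Fmax_eq[OF x] unfolding Ymax_def by (metis mem_Collect_eq)
    then show ?thesis by (auto simp: gap_def)
  qed
  ultimately show ?thesis by blast
qed

lemma Psi_eq: "x \<in> X \<Longrightarrow> \<Psi> x = ereal (F_max x + rv p x)"
  unfolding Psi_def using Fmax_eq[of x] p_eq[of x] by (metis plus_ereal.simps(1))

lemma rv_Psi: "x \<in> X \<Longrightarrow> rv \<Psi> x = F_max x + rv p x"
  by (simp add: Psi_eq)

lemma Psi_outside: "x \<notin> X \<Longrightarrow> \<Psi> x = \<infinity>"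
proof -
  assume "x \<notin> X"
  obtain y where y: "y \<in> Y" using q_proper(1) by (auto simp: proper_fun_def)
  have "Fobj f q x y \<le> Fmax f q x" unfolding Fmax_def by (rule SUP_upper) simp
  then have "Fmax f q x \<noteq> - \<infinity>" using Fobj_eq[OF y, of x] by auto
  then show ?thesis using \<open>x \<notin> X\<close> by (simp add: Psi_def notin_edom)
qed

lemma edom_Psi: "edom \<Psi> = X"
  using Psi_eq Psi_outside by (auto simp: edom_def)

lemma F_max_lipschitz:
  assumes "x \<in> X" "x' \<in> X"
  shows "F_max x \<le> F_max x' + Lf * norm (x - x')"
proof -
  obtain y where "y \<in> Ymax f q x" using max_attained[OF assms(1)] by auto
  then have y: "y \<in> Y" "gap x y = 0" using Ymax_iff assms by auto
  have "f (x, y) \<le> f (x', y) + Lf * norm (x - x')"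
    using lipschitz_onD[OF f_lipschitz[OF y(1)] assms] by (simp add: dist_norm)
  then show ?thesis using y gap_nonneg[OF assms(2) y(1)] by (simp add: gap_def)
qed

lemma gap_lipschitz:
  assumes "x \<in> X" "x' \<in> X" "y \<in> Y"
  shows "gap x y \<le> gap x' y + 2 * Lf * norm (x - x')"
proof -
  have "f (x', y) \<le> f (x, y) + Lf * norm (x - x')"
    using lipschitz_onD[OF f_lipschitz[OF assms(3)] assms(1,2)] by (simp add: dist_norm)
  then show ?thesis using F_max_lipschitz[OF assms(1,2)] by (simp add: gap_def)
qed

text \<open>For a maximizer \<open>y\<close> at \<open>x\<close> the function \<open>f(\<cdot>, y) -
  q y + p\<close> is a minorant of \<open>\<Psi>\<close> that touches it at \<open>x\<close>, so the
  smoothness of \<open>f(\<cdot>, y)\<close> gives an element of the subdifferential.\<close>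

lemma Psi_subgradient:
  assumes x: "x \<in> X" and y: "y \<in> Ymax f q x" and s: "convex_subgradient p x s"
  shows "gx x y + s \<in> limiting_subdiff \<Psi> x"
proof (rule limiting_subdiffI[where B = "Lg / 2"])
  have y': "y \<in> Y" "gap x y = 0" using y Ymax_iff[OF x] by auto
  show "\<Psi> x = ereal (F_max x + rv p x)" by (rule Psi_eq[OF x])
  show "ereal (F_max x + rv p x + (gx x y + s) \<bullet> (z - x) - Lg / 2 * (norm (z - x))\<^sup>2) \<le> \<Psi> z" for z
  proof (cases "z \<in> X")
    case True
    have "p x + ereal (s \<bullet> (z - x)) \<le> p z" using s by (auto simp: convex_subgradient_def)
    then have "rv p x + s \<bullet> (z - x) \<le> rv p z"
      using p_eq[OF x] p_eq[OF True] by (metis ereal_less_eq(3) plus_ereal.simps(1))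
    moreover have "f (x, y) + gx x y \<bullet> (z - x) - Lg / 2 * (norm (z - x))\<^sup>2 \<le> f (z, y)"
      by (rule f_lower_x[OF x True y'(1)])
    moreover have "0 \<le> gap z y" using True y' by (intro gap_nonneg)
    ultimately show ?thesis using y'(2) by (simp add: Psi_eq[OF True] gap_def inner_add_left)
  qed (simp add: Psi_outside)
qed

text \<open>At a point that is not \<open>\<epsilon>\<close>-critical the KL region contains the
  fixed gap level \<open>\<gamma> \<epsilon>\<^sup>\<sigma>\<close>. All later uses of the KL
  condition go through this form, with a convex subgradient of \<open>q\<close>.\<close>

lemma KL_at_noncritical:
  assumes x: "x \<in> X" "x \<notin> eps_critical \<Psi> \<epsilon>" and "\<epsilon> > 0"
    and y: "y \<in> Y" "0 < gap x y" "gap x y \<le> \<gamma> * \<epsilon> powr \<sigma>" and v: "convex_subgradient q y v"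
  shows "C * gap x y powr \<theta> \<le> norm (gy x y - v)"
proof -
  have "ereal \<epsilon> \<le> edist 0 (limiting_subdiff \<Psi> x)" using x(2) by (simp add: eps_critical_def)
  then have "ereal (\<epsilon> powr \<sigma>) \<le> epowr (edist 0 (limiting_subdiff \<Psi> x)) \<sigma>"
    using \<open>\<epsilon> > 0\<close> constants by (intro epowr_mono) auto
  then have "ereal \<gamma> * ereal (\<epsilon> powr \<sigma>) \<le> ereal \<gamma> * epowr (edist 0 (limiting_subdiff \<Psi> x)) \<sigma>"
    using constants by (intro ereal_mult_left_mono) auto
  then have "ereal (gap x y) \<le> ereal \<gamma> * epowr (edist 0 (limiting_subdiff \<Psi> x)) \<sigma>"
    using y(3) by (metis ereal_less_eq(3) order_trans times_ereal.simps(1))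
  then have "y \<in> KL_region f p q \<gamma> \<sigma> x"
    using y(2) by (simp add: KL_region_def Fmax_minus_Fobj[OF x(1) y(1)])
  from KL[OF x(1) this] have "ereal (C * gap x y powr \<theta>) \<le> edist 0 (subdiff_y f q x y)"
    by (simp add: Fmax_minus_Fobj[OF x(1) y(1)] epowr_def)
  also have "\<dots> \<le> ereal (norm (gy x y - v))"
  proof (rule edist_leI)
    show "gy x y - v \<in> subdiff_y f q x y"
      using convex_subgradient_limiting[OF q_proper(1) y(1) v] by (auto simp: subdiff_y_def gradient_y)
  qed simp
  finally show ?thesis by simp
qed

end

section \<open>The error bound and Hoelder upper bounds\<close>

context kl_minimax
begin

lemma closed_Ymax:
  assumes "x \<in> X"
  shows "closed (Ymax f q x)"
proof -
  have "y \<in> Ymax f q x \<longleftrightarrow> (y, f (x, y) - F_max x) \<in> epi q" for y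
  proof (cases "y \<in> Y")
    case True
    then have "(y, f (x, y) - F_max x) \<in> epi q \<longleftrightarrow> rv q y \<le> f (x, y) - F_max x"
      using q_eq[OF True] by (simp add: epi_def) (metis ereal_less_eq(3))
    then show ?thesis using Ymax_iff[OF assms, of y] True gap_nonneg[OF assms True]
      by (auto simp: gap_def)
  next
    case False
    then show ?thesis using Ymax_iff[OF assms, of y] by (auto simp: epi_def notin_edom)
  qed
  then have "Ymax f q x = (\<lambda>y. (y, f (x, y) - F_max x)) -` epi q" by auto
  moreover have "continuous_on UNIV (\<lambda>y. (y, f (x, y) - F_max x))"
    by (intro continuous_intros continuous_on_compose2[OF continuous_f[of UNIV]]) auto
  ultimately show ?thesis using q_proper(2) by (simp add: continuous_on_closed_vimage)
qed

text \<open>By convexity the one-sided estimate along segments passes from \<open>f(x,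
  \<cdot>)\<close> to its linearization at \<open>z\<close>; then the sum rule applies. For
  \<open>\<kappa> = 0\<close> this is the optimality condition of a maximizer.\<close>

lemma subgradient_of_perturbed_maximizer:
  assumes x: "x \<in> X" and z: "z \<in> Y" and "\<kappa> \<ge> 0"
    and max: "\<And>u. u \<in> Y \<Longrightarrow> gap x z - \<kappa> * norm (u - z) \<le> gap x u"
  shows "\<exists>v. convex_subgradient q z v \<and> norm (gy x z - v) \<le> \<kappa>"
proof (rule subgradient_near_perturbed_minorant[OF q_proper(1,3) z \<open>\<kappa> \<ge> 0\<close>])
  fix u assume u: "u \<in> Y"
  define \<alpha> where "\<alpha> = rv q u - rv q z - gy x z \<bullet> (u - z) + \<kappa> * norm (u - z)"
  have "0 \<le> \<alpha> + t * (Lg / 2 * (norm (u - z))\<^sup>2)" if t: "0 < t" "t \<le> 1" for t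
  proof -
    let ?v = "z + t *\<^sub>R (u - z)"
    have v: "?v \<in> Y" "rv q ?v \<le> (1 - t) * rv q z + t * rv q u"
      using proper_convex_combination[OF q_proper(1,3) z u, of t] t by auto
    have "gap x z - \<kappa> * (t * norm (u - z)) \<le> gap x ?v" using max[OF v(1)] t by simp
    moreover have "f (x, z) + t * (gy x z \<bullet> (u - z)) - Lg / 2 * (t * norm (u - z))\<^sup>2 \<le> f (x, ?v)"
      using f_lower_y[OF x z v(1)] t by simp
    ultimately have "0 \<le> t * rv q u - t * rv q z - t * (gy x z \<bullet> (u - z))
        + \<kappa> * (t * norm (u - z)) + Lg / 2 * (t * norm (u - z))\<^sup>2"
      using v(2) by (simp add: gap_def algebra_simps)
    also have "\<dots> = t * (\<alpha> + t * (Lg / 2 * (norm (u - z))\<^sup>2))"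
      by (simp add: \<alpha>_def power2_eq_square algebra_simps)
    finally show ?thesis using t(1) zero_le_mult_iff[of t] by (metis not_less_iff_gr_or_eq not_le)
  qed
  then have "0 \<le> \<alpha>" by (rule nonneg_of_affine_nonneg[of 1, rotated]) auto
  then show "rv q z + gy x z \<bullet> (u - z) - \<kappa> * norm (u - z) \<le> rv q u" by (simp add: \<alpha>_def)
qed

text \<open>If \<open>y\<close> is too far from the maximizers, minimize \<open>gap powr (1 -
  \<theta>) + c |\<cdot> - y|\<close> with a slope \<open>c < C (1 - \<theta>)\<close> as in
  Ekeland's principle. The minimizer \<open>z\<close> is closer to \<open>y\<close> than the
  maximizers are, so its gap is positive. The tangent inequality of the concave power \<open>1 -
  \<theta>\<close> turns minimality into a linear perturbation bound for the gap itself, with the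
  constant \<open>\<kappa> = c gap\<^sup>\<theta> / (1 - \<theta>)\<close>. So \<open>z\<close> has
  a residual of at most \<open>\<kappa>\<close>, which is less than \<open>C
  gap\<^sup>\<theta>\<close> and contradicts KL.\<close>

lemma error_bound:
  assumes x: "x \<in> X" "x \<notin> eps_critical \<Psi> \<epsilon>" and "\<epsilon> > 0"
    and y: "y \<in> Y" "gap x y \<le> \<gamma> * \<epsilon> powr \<sigma>"
  shows "\<exists>z\<in>Ymax f q x. dist y z \<le> gap x y powr (1 - \<theta>) / (C * (1 - \<theta>))"
proof (rule ccontr)
  assume far: "\<not> ?thesis"
  define \<phi>0 where "\<phi>0 = gap x y powr (1 - \<theta>)"
  obtain z0 where z0: "z0 \<in> Ymax f q x" "\<And>z. z \<in> Ymax f q x \<Longrightarrow> dist y z0 \<le> dist y z"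
    using distance_attains_inf[OF closed_Ymax[OF x(1)], of y] max_attained[OF x(1)] by blast
  have D: "dist y z0 > \<phi>0 / (C * (1 - \<theta>))" using far z0(1) by (force simp: \<phi>0_def)
  have "\<phi>0 \<ge> 0" by (simp add: \<phi>0_def)
  have C': "C * (1 - \<theta>) > 0" using constants by simp
  have D_pos: "dist y z0 > 0"
    using D divide_nonneg_pos[OF \<open>\<phi>0 \<ge> 0\<close> C'] by linarith
  have "\<phi>0 / dist y z0 < C * (1 - \<theta>)" using D C' D_pos by (simp add: field_simps)
  then obtain c where c: "\<phi>0 / dist y z0 < c" "c < C * (1 - \<theta>)" using dense by blast
  have "c > 0" using c(1) divide_nonneg_pos[OF \<open>\<phi>0 \<ge> 0\<close> D_pos] by linarith
  define R where "R = \<phi>0 / c"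
  have R: "0 \<le> R" "R < dist y z0"
    using \<open>\<phi>0 \<ge> 0\<close> \<open>c > 0\<close> c(1) D_pos by (simp_all add: R_def field_simps)
  have cR: "c * R = \<phi>0" using \<open>c > 0\<close> by (simp add: R_def)
  define G where "G = (\<lambda>s :: 'b \<times> real. F_max x - f (x, fst s) + snd s)"
  define \<Phi> where "\<Phi> s = G s powr (1 - \<theta>) + c * norm (fst s - y)" for s
  \<comment> \<open>A variable \<open>t \<ge> q z\<close> replaces \<open>q z\<close> to make the objective continuous; it increases with \<open>t\<close>, so a minimizer is no worse at \<open>t = q z\<close>.\<close>
  define T where "T = epi q \<inter> {s \<in> cball y R \<times> UNIV. G s \<le> gap x y}"
  have G_gap: "G (z, rv q z) = gap x z" for z by (simp add: G_def gap_def)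
  have G_nonneg: "0 \<le> G s" and gap_le_G: "fst s \<in> Y" "gap x (fst s) \<le> G s" if "s \<in> epi q" for s
  proof -
    obtain z t where s: "s = (z, t)" by (cases s)
    have le: "q z \<le> ereal t" using that by (simp add: s epi_def)
    then have z: "z \<in> Y" by (rule edomI)
    then have "rv q z \<le> t" using le q_eq[OF z] by (metis ereal_less_eq(3))
    then show "0 \<le> G s" "fst s \<in> Y" "gap x (fst s) \<le> G s"
      using gap_nonneg[OF x(1) z] z by (auto simp: G_def s gap_def)
  qed
  have G_cont: "continuous_on S G" for S
    unfolding G_def by (intro continuous_intros continuous_on_compose2[OF continuous_f[of UNIV]]) auto
  have "closed T"
  proof -
    have "closed {s. G s \<le> gap x y}"
      using G_cont by (intro closed_Collect_le continuous_intros) auto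
    moreover have "T = epi q \<inter> (cball y R \<times> UNIV) \<inter> {s. G s \<le> gap x y}" by (auto simp: T_def)
    ultimately show ?thesis using q_proper(2) by (auto intro!: closed_Int closed_Times)
  qed
  moreover have "bounded T"
  proof -
    have "compact ((\<lambda>z. f (x, z)) ` cball y R)"
      by (intro compact_continuous_image continuous_on_compose2[OF continuous_f[of UNIV]] continuous_intros) auto
    then obtain B where B: "\<bar>f (x, z)\<bar> \<le> B" if "z \<in> cball y R" for z
      using compact_imp_bounded bounded_iff by (metis imageI real_norm_def)
    have "T \<subseteq> cball y R \<times> {- B - F_max x..gap x y + B - F_max x}"
    proof
      fix s assume s: "s \<in> T"
      then have "0 \<le> G s" "G s \<le> gap x y" "fst s \<in> cball y R"
        using G_nonneg by (auto simp: T_def)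
      moreover from this have "\<bar>f (x, fst s)\<bar> \<le> B" using B by blast
      ultimately show "s \<in> cball y R \<times> {- B - F_max x..gap x y + B - F_max x}"
        by (cases s) (auto simp: G_def)
    qed
    then show ?thesis by (rule bounded_subset[rotated]) (intro bounded_Times bounded_cball bounded_closed_interval)
  qed
  ultimately have "compact T" by (simp add: compact_eq_bounded_closed)
  moreover have y_T: "(y, rv q y) \<in> T"
    using q_eq[OF y(1)] R(1) by (simp add: T_def epi_def G_gap)
  moreover have "continuous_on T \<Phi>"
    unfolding \<Phi>_def using G_nonneg theta_bounds
    by (intro continuous_intros continuous_on_powr' G_cont) (auto simp: T_def)
  ultimately obtain s where s: "s \<in> T" "\<And>s'. s' \<in> T \<Longrightarrow> \<Phi> s \<le> \<Phi> s'"
    using continuous_attains_inf[of T \<Phi>] by blast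
  define z where "z = fst s"
  have s_epi: "s \<in> epi q" using s(1) by (simp add: T_def)
  have z: "z \<in> Y" "norm (z - y) \<le> R" "gap x z \<le> gap x y"
    using gap_le_G[OF s_epi] s(1) by (auto simp: z_def T_def dist_norm norm_minus_commute)
  have gz_nonneg: "0 \<le> gap x z" by (rule gap_nonneg[OF x(1) z(1)])
  have s_value: "gap x z powr (1 - \<theta>) + c * norm (z - y) \<le> \<Phi> s"
    using gap_le_G[OF s_epi] gz_nonneg theta_bounds unfolding \<Phi>_def z_def
    by (intro add_mono powr_mono2) auto
  have y_value: "\<Phi> (y, rv q y) = \<phi>0" by (simp add: \<Phi>_def G_gap \<phi>0_def)
  have z_min: "gap x z powr (1 - \<theta>) + c * norm (z - y) \<le> gap x u powr (1 - \<theta>) + c * norm (u - y)"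
    if u: "u \<in> Y" for u
  proof (cases "(u, rv q u) \<in> T")
    case True
    then show ?thesis using s(2)[OF True] s_value by (simp add: \<Phi>_def G_gap)
  next
    case False
    then consider "R < norm (u - y)" | "gap x y < gap x u"
      using q_eq[OF u] by (force simp: T_def epi_def G_gap dist_norm norm_minus_commute)
    then have "\<phi>0 \<le> gap x u powr (1 - \<theta>) + c * norm (u - y)"
    proof cases
      case 1
      then have "c * R \<le> c * norm (u - y)" using \<open>c > 0\<close> by simp
      then show ?thesis using powr_ge_zero[of "gap x u" "1 - \<theta>"] unfolding cR by linarith
    next
      case 2
      then have "\<phi>0 \<le> gap x u powr (1 - \<theta>)"
        unfolding \<phi>0_def using gap_nonneg[OF x(1) y(1)] theta_bounds by (intro powr_mono2) auto
      then show ?thesis using \<open>c > 0\<close> by (simp add: add_increasing2)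
    qed
    then show ?thesis using s_value s(2)[OF y_T] y_value by linarith
  qed
  have "gap x z \<noteq> 0"
  proof
    assume "gap x z = 0"
    then have "dist y z0 \<le> dist y z" using z0(2) Ymax_iff[OF x(1)] z(1) by blast
    then show False using z(2) R(2) by (simp add: dist_norm norm_minus_commute)
  qed
  with gz_nonneg have gz: "gap x z > 0" by simp
  define \<kappa> where "\<kappa> = c * gap x z powr \<theta> / (1 - \<theta>)"
  have "\<kappa> \<ge> 0" using \<open>c > 0\<close> theta_bounds by (simp add: \<kappa>_def)
  have "gap x z - \<kappa> * norm (u - z) \<le> gap x u" if u: "u \<in> Y" for u
  proof -
    have gu: "0 \<le> gap x u" by (rule gap_nonneg[OF x(1) u])
    have "norm (u - y) \<le> norm (u - z) + norm (z - y)"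
      using norm_triangle_ineq[of "u - z" "z - y"] by simp
    then have "c * norm (u - y) \<le> c * norm (u - z) + c * norm (z - y)"
      using \<open>c > 0\<close> by (metis distrib_left mult_le_cancel_left_pos)
    then have "gap x z powr (1 - \<theta>) - c * norm (u - z) \<le> gap x u powr (1 - \<theta>)"
      using z_min[OF u] by linarith
    then have "(gap x z powr (1 - \<theta>) - c * norm (u - z)) * gap x z powr \<theta>
        \<le> gap x u powr (1 - \<theta>) * gap x z powr \<theta>"
      by (rule mult_right_mono) simp
    \<comment> \<open>In this form Young's inequality is the tangent inequality of the power \<open>1 - \<theta>\<close> at \<open>gap x z\<close>.\<close>
    also have "\<dots> \<le> (1 - \<theta>) * gap x u + \<theta> * gap x z"
    proof (cases "gap x u = 0")
      case False
      then show ?thesis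
        using Youngs_inequality_0[of "1 - \<theta>" \<theta> "gap x u" "gap x z"] theta_bounds gu gz by simp
    qed (use theta_bounds gz in simp)
    finally have "gap x z powr (1 - \<theta>) * gap x z powr \<theta> - c * norm (u - z) * gap x z powr \<theta>
        \<le> (1 - \<theta>) * gap x u + \<theta> * gap x z" by (simp add: left_diff_distrib)
    moreover have "gap x z powr (1 - \<theta>) * gap x z powr \<theta> = gap x z"
      using gz by (simp flip: powr_add)
    ultimately have "(1 - \<theta>) * gap x z - c * norm (u - z) * gap x z powr \<theta> \<le> (1 - \<theta>) * gap x u"
      by (simp add: algebra_simps)
    moreover have "c * norm (u - z) * gap x z powr \<theta> = (1 - \<theta>) * (\<kappa> * norm (u - z))"
      using theta_bounds by (simp add: \<kappa>_def)
    ultimately have "(1 - \<theta>) * (gap x z - \<kappa> * norm (u - z)) \<le> (1 - \<theta>) * gap x u"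
      by (simp add: right_diff_distrib)
    then show ?thesis using theta_bounds by simp
  qed
  then obtain v where v: "convex_subgradient q z v" "norm (gy x z - v) \<le> \<kappa>"
    using subgradient_of_perturbed_maximizer[OF x(1) z(1) \<open>\<kappa> \<ge> 0\<close>] by blast
  have "C * gap x z powr \<theta> \<le> \<kappa>"
    using KL_at_noncritical[OF x \<open>\<epsilon> > 0\<close> z(1) gz _ v(1)] z(3) y(2) v(2) by linarith
  moreover have "\<kappa> < C * gap x z powr \<theta>"
  proof -
    have "c / (1 - \<theta>) < C" using c(2) theta_bounds by (simp add: field_simps)
    then have "c / (1 - \<theta>) * gap x z powr \<theta> < C * gap x z powr \<theta>"
      using gz by (intro mult_strict_right_mono) auto
    then show ?thesis by (simp add: \<kappa>_def)
  qed
  ultimately show False by simp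
qed

text \<open>At \<open>x\<close> the residual of the maximizer \<open>y\<close> vanishes, so at
  \<open>x'\<close> it is at most \<open>Lg |x' - x|\<close>, and KL at \<open>x'\<close> converts
  it into a gap. The distance bound on \<open>x' - x\<close> ensures that the gap is in the KL
  region.\<close>

lemma maximizer_is_near_optimal_nearby:
  assumes x: "x \<in> X" and x': "x' \<in> X" "x' \<notin> eps_critical \<Psi> \<epsilon>" and "\<epsilon> > 0"
    and near: "2 * Lf * norm (x' - x) \<le> \<gamma> * \<epsilon> powr \<sigma>" and y: "y \<in> Ymax f q x"
  shows "gap x' y \<le> (Lg / C * norm (x' - x)) powr (1 / \<theta>)"
proof -
  have y': "y \<in> Y" "gap x y = 0" using y Ymax_iff[OF x] by auto
  have gap_small: "gap x' y \<le> \<gamma> * \<epsilon> powr \<sigma>"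
    using gap_lipschitz[OF x'(1) x y'(1)] y'(2) near by simp
  have "gap x y - 0 * norm (u - y) \<le> gap x u" if "u \<in> Y" for u
    using gap_nonneg[OF x that] y'(2) by simp
  then obtain v where "convex_subgradient q y v" "norm (gy x y - v) \<le> 0"
    using subgradient_of_perturbed_maximizer[OF x y'(1), of 0] by auto
  then have v: "convex_subgradient q y (gy x y)" by simp
  show ?thesis
  proof (cases "gap x' y = 0")
    case False
    then have pos: "gap x' y > 0" using gap_nonneg[OF x'(1) y'(1)] by simp
    have "C * gap x' y powr \<theta> \<le> norm (gy x' y - gy x y)"
      by (rule KL_at_noncritical[OF x' \<open>\<epsilon> > 0\<close> y'(1) pos gap_small v])
    also have "\<dots> \<le> Lg * norm (x' - x)" by (rule gy_dist_x[OF x'(1) x y'(1)])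
    finally have "gap x' y powr \<theta> \<le> Lg / C * norm (x' - x)"
      using constants by (simp add: field_simps)
    then have "(gap x' y powr \<theta>) powr (1 / \<theta>) \<le> (Lg / C * norm (x' - x)) powr (1 / \<theta>)"
      using theta_bounds by (intro powr_mono2) auto
    then show ?thesis using pos theta_bounds by (simp add: powr_powr)
  qed simp
qed

lemma maximizer_near_maximizer:
  assumes x: "x \<in> X" and x': "x' \<in> X" "x' \<notin> eps_critical \<Psi> \<epsilon>" and "\<epsilon> > 0"
    and near: "2 * Lf * norm (x' - x) \<le> \<gamma> * \<epsilon> powr \<sigma>" and y: "y \<in> Ymax f q x"
  shows "\<exists>y'\<in>Ymax f q x'. dist y y' \<le> (Lg / C * norm (x' - x)) powr ((1 - \<theta>) / \<theta>) / (C * (1 - \<theta>))"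
proof -
  have y': "y \<in> Y" "gap x y = 0" using y Ymax_iff[OF x] by auto
  have gap_small: "gap x' y \<le> \<gamma> * \<epsilon> powr \<sigma>"
    using gap_lipschitz[OF x'(1) x y'(1)] y'(2) near by simp
  obtain z where z: "z \<in> Ymax f q x'" "dist y z \<le> gap x' y powr (1 - \<theta>) / (C * (1 - \<theta>))"
    using error_bound[OF x' \<open>\<epsilon> > 0\<close> y'(1) gap_small] by blast
  have "gap x' y powr (1 - \<theta>) \<le> ((Lg / C * norm (x' - x)) powr (1 / \<theta>)) powr (1 - \<theta>)"
    using maximizer_is_near_optimal_nearby[OF assms] theta_bounds gap_nonneg[OF x'(1) y'(1)]
    by (intro powr_mono2) auto
  also have "\<dots> = (Lg / C * norm (x' - x)) powr ((1 - \<theta>) / \<theta>)" by (simp add: powr_powr)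
  finally have "gap x' y powr (1 - \<theta>) / (C * (1 - \<theta>))
      \<le> (Lg / C * norm (x' - x)) powr ((1 - \<theta>) / \<theta>) / (C * (1 - \<theta>))"
    using constants by (intro divide_right_mono) auto
  with z show ?thesis by force
qed

text \<open>It suffices to fix a maximizer \<open>y\<close> at \<open>x\<close>: \<open>F_max
  x'\<close> exceeds \<open>f (x', y) - q y\<close> by the gap of \<open>y\<close> at
  \<open>x'\<close>, which is of the order \<open>|x' - x| powr (1 / \<theta>)\<close>.\<close>

lemma F_max_Holder_upper_bound:
  assumes x: "x \<in> X" and x': "x' \<in> X" "x' \<notin> eps_critical \<Psi> \<epsilon>" and "\<epsilon> > 0"
    and near: "2 * Lf * norm (x' - x) \<le> \<gamma> * \<epsilon> powr \<sigma>" and y: "y \<in> Ymax f q x"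
  shows "F_max x' \<le> F_max x + gx x y \<bullet> (x' - x) + Lg / 2 * (norm (x' - x))\<^sup>2
    + (Lg / C * norm (x' - x)) powr (1 / \<theta>)"
proof -
  have y': "y \<in> Y" "gap x y = 0" using y Ymax_iff[OF x] by auto
  have "f (x', y) \<le> f (x, y) + gx x y \<bullet> (x' - x) + Lg / 2 * (norm (x' - x))\<^sup>2"
    by (rule f_upper_x[OF x x'(1) y'(1)])
  then show ?thesis using maximizer_is_near_optimal_nearby[OF assms] y'(2) by (simp add: gap_def)
qed

end

section \<open>The proximal gradient subroutine\<close>

lemma is_arg_min_finite:
  fixes \<phi> :: "'a \<Rightarrow> ereal"
  assumes "is_arg_min (\<lambda>u. ereal (r u) + \<phi> u) P w" "P z" "z \<in> edom \<phi>"
  shows "w \<in> edom \<phi>"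
proof (rule ccontr)
  assume "w \<notin> edom \<phi>"
  then have "ereal (r w) + \<phi> w = \<infinity>" by (simp add: notin_edom)
  moreover have "ereal (r w) + \<phi> w \<le> ereal (r z) + \<phi> z"
    using assms(1,2) by (auto simp: is_arg_min_linorder)
  ultimately show False using assms(3) by (simp add: edom_def)
qed

context kl_minimax
begin

abbreviation "prox x lam z w \<equiv> prox_trial (\<lambda>y. - f (x, y)) q lam z w"
abbreviation "accept x lam z w \<equiv> pg_accept (\<lambda>y. - f (x, y)) q lam z w"

lemma prox_exists: "lam > 0 \<Longrightarrow> \<exists>w. prox x lam z w"
  unfolding prox_trial_def by (rule proximal_point_exists[OF q_pcc]) simp

lemma prox_in_Y: "prox x lam z w \<Longrightarrow> z \<in> Y \<Longrightarrow> w \<in> Y"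
  unfolding prox_trial_def by (rule is_arg_min_finite) auto

lemma prox_subgradient:
  assumes "prox x lam z w" "z \<in> Y"
  shows "convex_subgradient q w (gy x z - (1 / lam) *\<^sub>R (w - z))"
proof (rule convex_subgradientI[OF q_proper(1) prox_in_Y[OF assms]])
  fix u assume u: "u \<in> Y"
  show "rv q w + (gy x z - (1 / lam) *\<^sub>R (w - z)) \<bullet> (u - w) \<le> rv q u"
    using prox_variational_inequality[OF q_proper(1,3) assms(1)[unfolded prox_trial_def]
        prox_in_Y[OF assms] u, of 1]
    by (simp add: gradient_minus_y inner_diff_left inner_add_left)
qed

lemma prox_residual:
  assumes "x \<in> X" "prox x lam z w" "z \<in> Y" "lam \<ge> lam_low" "lam_low > 0"
  shows "\<exists>v. convex_subgradient q w v \<and> norm (gy x w - v) \<le> (Lg + inverse lam_low) * norm (w - z)"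
proof -
  have "norm (gy x w - (gy x z - (1 / lam) *\<^sub>R (w - z))) = norm ((gy x w - gy x z) + (1 / lam) *\<^sub>R (w - z))"
    by (rule arg_cong[of _ _ norm]) (simp only: algebra_simps)
  also have "\<dots> \<le> Lg * norm (w - z) + (1 / lam) * norm (w - z)"
    using norm_triangle_ineq[of "gy x w - gy x z" "(1 / lam) *\<^sub>R (w - z)"]
      gy_dist_y[OF assms(1) prox_in_Y[OF assms(2,3)] assms(3)] assms(4,5) by simp
  also have "\<dots> \<le> Lg * norm (w - z) + inverse lam_low * norm (w - z)"
    using assms(4,5) by (intro add_left_mono mult_right_mono) (auto simp: field_simps)
  finally show ?thesis using prox_subgradient[OF assms(2,3)] by (auto simp: algebra_simps)
qed

lemma accept_iff:
  assumes "z \<in> Y" "w \<in> Y"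
  shows "accept x lam z w \<longleftrightarrow> gap x w + 1 / (2 * lam) * (norm (w - z))\<^sup>2 \<le> gap x z"
proof -
  have "accept x lam z w \<longleftrightarrow>
      ereal (- f (x, w)) + ereal (rv q w) + ereal (1 / (2 * lam) * (norm (w - z))\<^sup>2)
        \<le> ereal (- f (x, z)) + ereal (rv q z)"
    unfolding pg_accept_def using q_eq[OF assms(1)] q_eq[OF assms(2)] by metis
  then show ?thesis by (simp add: gap_def algebra_simps)
qed

text \<open>The proximal inequality gains \<open>|w - z|\<^sup>2 / lam\<close>, of which smoothness
  costs \<open>Lg/2 |w - z|\<^sup>2\<close>. Therefore backtracking stops, and never below
  \<open>min (\<rho> / Lg) lam_bar\<close>.\<close>

lemma small_step_accepted:
  assumes "x \<in> X" "prox x lam z w" "z \<in> Y" "0 < lam" "lam \<le> 1 / Lg"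
  shows "accept x lam z w"
proof -
  note w = prox_in_Y[OF assms(2,3)]
  have "q w + ereal ((gy x z - (1 / lam) *\<^sub>R (w - z)) \<bullet> (z - w)) \<le> q z"
    using prox_subgradient[OF assms(2,3)] by (simp add: convex_subgradient_def)
  then have "rv q w + (gy x z - (1 / lam) *\<^sub>R (w - z)) \<bullet> (z - w) \<le> rv q z"
    using q_eq[OF w] q_eq[OF assms(3)] by (metis ereal_less_eq(3) plus_ereal.simps(1))
  moreover have "(gy x z - (1 / lam) *\<^sub>R (w - z)) \<bullet> (z - w)
      = - (gy x z \<bullet> (w - z)) + 1 / lam * (norm (w - z))\<^sup>2"
    unfolding power2_norm_eq_inner by (simp add: inner_diff_left inner_diff_right inner_commute algebra_simps)
  moreover have "f (x, z) + gy x z \<bullet> (w - z) - Lg / 2 * (norm (w - z))\<^sup>2 \<le> f (x, w)"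
    by (rule f_lower_y[OF assms(1,3) w])
  moreover have "Lg / 2 * (norm (w - z))\<^sup>2 \<le> 1 / (2 * lam) * (norm (w - z))\<^sup>2"
    using assms(4,5) Lg_pos by (intro mult_right_mono) (auto simp: field_simps)
  ultimately have "gap x w + 1 / (2 * lam) * (norm (w - z))\<^sup>2 \<le> gap x z"
    by (simp add: gap_def field_simps)
  then show ?thesis using accept_iff[OF assms(3) w] by simp
qed

lemma pg_step_exists:
  assumes "x \<in> X" "z \<in> Y" "lam_bar > 0" "0 < \<rho>" "\<rho> < 1"
  shows "\<exists>z'. pg_step (\<lambda>y. - f (x, y)) q lam_bar \<rho> z z'"
proof -
  define P where "P i \<longleftrightarrow> (\<exists>w. prox x (lam_bar * \<rho> ^ i) z w \<and> accept x (lam_bar * \<rho> ^ i) z w)" for i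
  \<comment> \<open>Any trial parameter up to \<open>1 / Lg\<close> is accepted.\<close>
  obtain i where "\<rho> ^ i < 1 / Lg / lam_bar"
    using real_arch_pow_inv[of "1 / Lg / lam_bar" \<rho>] assms Lg_pos by auto
  then have "lam_bar * \<rho> ^ i \<le> lam_bar * (1 / Lg / lam_bar)" using assms by (intro mult_left_mono) auto
  then have "lam_bar * \<rho> ^ i \<le> 1 / Lg" using assms by simp
  then have "P i" unfolding P_def
    using prox_exists[of "lam_bar * \<rho> ^ i"] small_step_accepted assms by (metis mult_pos_pos zero_less_power)
  then have "P (LEAST i. P i)" by (rule LeastI)
  moreover have "\<exists>w. prox x (lam_bar * \<rho> ^ j) z w \<and> \<not> accept x (lam_bar * \<rho> ^ j) z w"
    if "j < (LEAST i. P i)" for j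
    using not_less_Least[OF that] prox_exists[of "lam_bar * \<rho> ^ j"] assms unfolding P_def
    by (metis mult_pos_pos zero_less_power)
  ultimately show ?thesis unfolding pg_step_def P_def by blast
qed

lemma pg_step_properties:
  assumes step: "pg_step (\<lambda>y. - f (x, y)) q lam_bar \<rho> z z'"
    and "x \<in> X" "z \<in> Y" "lam_bar > 0" "0 < \<rho>" "\<rho> < 1"
  shows "z' \<in> Y"
    and "gap x z' + 1 / (2 * lam_bar) * (norm (z' - z))\<^sup>2 \<le> gap x z"
    and "\<exists>v. convex_subgradient q z' v \<and>
           norm (gy x z' - v) \<le> (Lg + inverse (min (\<rho> / Lg) lam_bar)) * norm (z' - z)"
proof -
  obtain i where i: "prox x (lam_bar * \<rho> ^ i) z z'" "accept x (lam_bar * \<rho> ^ i) z z'"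
    and rejected: "\<And>j. j < i \<Longrightarrow> \<exists>w. prox x (lam_bar * \<rho> ^ j) z w \<and> \<not> accept x (lam_bar * \<rho> ^ j) z w"
    using step unfolding pg_step_def by blast
  show z': "z' \<in> Y" by (rule prox_in_Y[OF i(1) assms(3)])
  have le_bar: "lam_bar * \<rho> ^ i \<le> lam_bar" and pos: "lam_bar * \<rho> ^ i > 0"
    using assms by (auto simp: power_le_one mult_le_cancel_left2)
  have "1 / (2 * lam_bar) * (norm (z' - z))\<^sup>2 \<le> 1 / (2 * (lam_bar * \<rho> ^ i)) * (norm (z' - z))\<^sup>2"
    using le_bar pos by (intro mult_right_mono divide_left_mono) (auto simp: assms)
  then show "gap x z' + 1 / (2 * lam_bar) * (norm (z' - z))\<^sup>2 \<le> gap x z"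
    using i(2) accept_iff[OF assms(3) z', of x "lam_bar * \<rho> ^ i"] by linarith
  have "min (\<rho> / Lg) lam_bar \<le> lam_bar * \<rho> ^ i"
  proof (cases i)
    case (Suc j)
    then have "\<not> lam_bar * \<rho> ^ j \<le> 1 / Lg"
      using rejected[of j] small_step_accepted[OF assms(2) _ assms(3)] assms by auto
    then have "\<rho> * (1 / Lg) \<le> \<rho> * (lam_bar * \<rho> ^ j)" using assms by (intro mult_left_mono) auto
    then show ?thesis by (simp add: Suc mult.left_commute min_le_iff_disj)
  qed simp
  moreover have "min (\<rho> / Lg) lam_bar > 0" using assms Lg_pos by simp
  ultimately show "\<exists>v. convex_subgradient q z' v \<and>
      norm (gy x z' - v) \<le> (Lg + inverse (min (\<rho> / Lg) lam_bar)) * norm (z' - z)"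
    using prox_residual[OF assms(2) i(1) assms(3)] by blast
qed

text \<open>Every step longer than \<open>\<tau>\<close> lowers the gap by at least
  \<open>\<tau>\<^sup>2 / (2 lam_bar)\<close>, and the gap is nonnegative.\<close>

lemma pg_returns_exists:
  assumes "x \<in> X" "z \<in> Y" "lam_bar > 0" "0 < \<rho>" "\<rho> < 1" "\<tau> > 0"
  shows "\<exists>w. pg_returns (\<lambda>y. - f (x, y)) q lam_bar \<rho> \<tau> z w"
proof -
  have unit: "1 / (2 * lam_bar) * \<tau>\<^sup>2 > 0" using assms by simp
  have "\<exists>w. pg_returns (\<lambda>y. - f (x, y)) q lam_bar \<rho> \<tau> z w"
    if "z \<in> Y" "gap x z < real n * (1 / (2 * lam_bar) * \<tau>\<^sup>2)" for n z
    using that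
  proof (induction n arbitrary: z)
    case 0
    then show ?case using gap_nonneg[OF assms(1), of z] by simp
  next
    case (Suc n)
    obtain z' where step: "pg_step (\<lambda>y. - f (x, y)) q lam_bar \<rho> z z'"
      using pg_step_exists assms Suc.prems by blast
    note z' = pg_step_properties[OF step assms(1) Suc.prems(1) assms(3-5)]
    show ?case
    proof (cases "norm (z' - z) \<le> \<tau>")
      case True
      then show ?thesis using pg_returns.stop[OF step] by blast
    next
      case False
      then have "\<tau>\<^sup>2 \<le> (norm (z' - z))\<^sup>2" using assms by (intro power_mono) auto
      then have "1 / (2 * lam_bar) * \<tau>\<^sup>2 \<le> 1 / (2 * lam_bar) * (norm (z' - z))\<^sup>2"
        using assms by (intro mult_left_mono) auto
      then have "gap x z' < real n * (1 / (2 * lam_bar) * \<tau>\<^sup>2)"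
        using z'(2) Suc.prems(2) unfolding of_nat_Suc distrib_right by linarith
      then show ?thesis using Suc.IH[OF z'(1)] pg_returns.continue[OF step False] by blast
    qed
  qed
  moreover obtain n :: nat where "gap x z < real n * (1 / (2 * lam_bar) * \<tau>\<^sup>2)"
    using reals_Archimedean3[OF unit] by blast
  ultimately show ?thesis using assms(2) by blast
qed

lemma pg_returns_properties:
  assumes "pg_returns (\<lambda>y. - f (x, y)) q lam_bar \<rho> \<tau> z w"
    and "x \<in> X" "z \<in> Y" "lam_bar > 0" "0 < \<rho>" "\<rho> < 1"
  shows "w \<in> Y \<and> gap x w \<le> gap x z \<and> (\<exists>v. convex_subgradient q w v \<and>
     norm (gy x w - v) \<le> (Lg + inverse (min (\<rho> / Lg) lam_bar)) * \<tau>)"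
  using assms(1,3)
proof induction
  case (stop z z')
  note z' = pg_step_properties[OF stop.hyps(1) assms(2) stop.prems assms(4-6)]
  have "min (\<rho> / Lg) lam_bar > 0" using assms Lg_pos by simp
  then have "(Lg + inverse (min (\<rho> / Lg) lam_bar)) * norm (z' - z) \<le> (Lg + inverse (min (\<rho> / Lg) lam_bar)) * \<tau>"
    using stop.hyps(2) Lg_pos by (intro mult_left_mono add_nonneg_nonneg) auto
  moreover have "0 \<le> 1 / (2 * lam_bar) * (norm (z' - z))\<^sup>2" using assms by simp
  ultimately show ?case using z' by fastforce
next
  case (continue z z' w)
  note z' = pg_step_properties[OF continue.hyps(1) assms(2) continue.prems assms(4-6)]
  have "0 \<le> 1 / (2 * lam_bar) * (norm (z' - z))\<^sup>2" using assms by simp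
  then have "gap x z' \<le> gap x z" using z'(2) by linarith
  then show ?case using continue.IH[OF z'(1)] by force
qed

text \<open>The tolerance \<open>\<tau>\<close> is calibrated so that the residual at the returned
  point is at most \<open>C b powr \<theta>\<close>; KL then bounds the gap by
  \<open>b\<close>.\<close>

lemma pg_returns_gap:
  assumes returns: "pg_returns (\<lambda>y. - f (x, y)) q lam_bar \<rho> \<tau> z w"
    and x: "x \<in> X" "x \<notin> eps_critical \<Psi> \<epsilon>" "\<epsilon> > 0"
    and z: "z \<in> Y" "gap x z \<le> \<gamma> * \<epsilon> powr \<sigma>"
    and inputs: "lam_bar > 0" "0 < \<rho>" "\<rho> < 1"
    and \<tau>: "\<tau> = C / (Lg + inverse (min (\<rho> / Lg) lam_bar)) * b powr \<theta>" "b \<ge> 0"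
  shows "gap x w \<le> b"
proof (cases "gap x w = 0")
  case False
  obtain v where w: "w \<in> Y" "gap x w \<le> gap x z" and v: "convex_subgradient q w v"
    "norm (gy x w - v) \<le> (Lg + inverse (min (\<rho> / Lg) lam_bar)) * \<tau>"
    using pg_returns_properties[OF returns x(1) z(1) inputs] by blast
  have pos: "gap x w > 0" using False gap_nonneg[OF x(1) w(1)] by simp
  have "min (\<rho> / Lg) lam_bar > 0" using inputs Lg_pos by simp
  then have "Lg + inverse (min (\<rho> / Lg) lam_bar) > 0" using Lg_pos by (simp add: add_pos_pos)
  then have "C * gap x w powr \<theta> \<le> C * b powr \<theta>"
    using KL_at_noncritical[OF x w(1) pos _ v(1)] w(2) z(2) v(2) by (simp add: \<tau>)
  then have "gap x w powr \<theta> \<le> b powr \<theta>" using constants by simp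
  then show ?thesis using pos \<tau>(2) theta_bounds powr_less_mono2[of \<theta> b "gap x w"] by linarith
qed (use \<tau> in simp)

end

section \<open>Estimates for the iteration bound\<close>

text \<open>Linearize \<open>ln\<close> at \<open>2 c\<close>, where its slope is \<open>1 / (2
  c)\<close>: half of \<open>T\<close> pays for this linear part, the other half for the
  constant.\<close>

lemma log_le_linear:
  fixes c T :: real
  assumes "c > 0" "T > 0" "2 * c * ln c \<le> T"
  shows "c * ln T \<le> T"
proof -
  have "ln T = ln (2 * c) + ln (T / (2 * c))" using assms by (simp add: ln_div)
  also have "\<dots> \<le> ln 2 + ln c + (T / (2 * c) - 1)"
    using assms ln_le_minus_one[of "T / (2 * c)"] by (simp add: ln_mult)
  also have "\<dots> \<le> ln c + T / (2 * c)" using ln2_le_25_over_36 by simp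
  finally have "c * ln T \<le> c * (ln c + T / (2 * c))" using \<open>c > 0\<close> by simp
  also have "\<dots> = c * ln c + T / 2" using \<open>c > 0\<close> by (simp add: field_simps)
  finally show ?thesis using assms(3) by simp
qed

text \<open>With \<open>T = K powr \<kappa>\<close> and \<open>c = B \<epsilon> powr (- s)\<close>
  this is \<open>c ln T \<le> T\<close>. The hypothesis gives \<open>2 c ln c \<le> T\<close>: in
  \<open>ln c = ln B + s ln (1 / \<epsilon>)\<close> the factor \<open>ln (1 / \<epsilon>) \<ge>
  1\<close> can be pulled out.\<close>

lemma log_term_bound:
  fixes B \<epsilon> \<kappa> s K :: real
  assumes "B > 0" "\<epsilon> > 0" "\<epsilon> \<le> 1 / exp 1" "\<kappa> > 0" "s \<ge> 0" "K > 0"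
    and K: "(2 * B * pos_ceiling (ln B) + 2 * s * B + 1) powr (1 / \<kappa>) * \<epsilon> powr (- s / \<kappa>)
      * ln (1 / \<epsilon>) powr (1 / \<kappa>) \<le> K"
  shows "B * \<kappa> * ln K \<le> \<epsilon> powr s * K powr \<kappa>"
proof -
  define E where "E = 2 * B * pos_ceiling (ln B) + 2 * s * B + 1"
  define l where "l = ln (1 / \<epsilon>)"
  have "exp 1 \<le> 1 / \<epsilon>" using assms(2,3) by (simp add: field_simps)
  then have l: "l \<ge> 1" unfolding l_def using assms(2) by (subst ln_ge_iff) auto
  have ceiling: "0 \<le> pos_ceiling (ln B)" "ln B \<le> pos_ceiling (ln B)"
    by (auto simp: pos_ceiling_def) linarith
  have E: "E > 0" using assms ceiling by (simp add: E_def add_nonneg_pos)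
  define T where "T = K powr \<kappa>"
  have "E * \<epsilon> powr (- s) * l = (E powr (1 / \<kappa>) * \<epsilon> powr (- s / \<kappa>) * l powr (1 / \<kappa>)) powr \<kappa>"
    using assms E l by (simp add: powr_mult powr_powr)
  also have "\<dots> \<le> K powr \<kappa>"
    using K assms unfolding E_def l_def by (intro powr_mono2) auto
  finally have T: "E * \<epsilon> powr (- s) * l \<le> T" by (simp add: T_def)
  define c where "c = B * \<epsilon> powr (- s)"
  have "c > 0" using assms by (simp add: c_def)
  have "ln c = ln B + s * l" using assms by (simp add: c_def l_def ln_mult ln_powr ln_div)
  then have "2 * c * ln c = \<epsilon> powr (- s) * (2 * B * ln B + 2 * s * B * l)"
    by (simp add: c_def algebra_simps)
  also have "\<dots> \<le> \<epsilon> powr (- s) * (E * l)"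
  proof (rule mult_left_mono)
    have "2 * B * ln B \<le> 2 * B * pos_ceiling (ln B)" using ceiling assms by simp
    also have "\<dots> \<le> 2 * B * pos_ceiling (ln B) * l"
      using mult_left_mono[OF l, of "2 * B * pos_ceiling (ln B)"] ceiling assms(1) by simp
    finally show "2 * B * ln B + 2 * s * B * l \<le> E * l" using l by (simp add: E_def algebra_simps)
  qed simp
  also have "\<dots> \<le> T" using T by (simp add: mult.commute mult.left_commute)
  finally have "c * ln T \<le> T" using \<open>c > 0\<close> assms by (intro log_le_linear) (auto simp: T_def)
  then have "\<epsilon> powr s * (c * ln T) \<le> \<epsilon> powr s * T" by (intro mult_left_mono) auto
  moreover have "\<epsilon> powr s * (c * ln T) = B * \<kappa> * ln K"
  proof -
    have "\<epsilon> powr s * c = B" using assms by (simp add: c_def powr_minus)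
    moreover have "ln T = \<kappa> * ln K" using assms by (simp add: T_def ln_powr)
    ultimately show ?thesis by (metis mult.assoc)
  qed
  ultimately show ?thesis by (metis T_def)
qed

lemma const_term_bound:
  fixes D \<epsilon> \<kappa> s K :: real
  assumes "D \<ge> 0" "\<epsilon> > 0" "\<kappa> > 0" and K: "D powr (1 / \<kappa>) * \<epsilon> powr (- s / \<kappa>) \<le> K"
  shows "D \<le> \<epsilon> powr s * K powr \<kappa>"
proof -
  have "\<epsilon> powr (- s) * D = (D powr (1 / \<kappa>) * \<epsilon> powr (- s / \<kappa>)) powr \<kappa>"
    using assms by (simp add: powr_mult powr_powr)
  also have "\<dots> \<le> K powr \<kappa>" using assms by (intro powr_mono2) auto
  finally have "\<epsilon> powr s * (\<epsilon> powr (- s) * D) \<le> \<epsilon> powr s * K powr \<kappa>" by (intro mult_left_mono) auto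
  moreover have "\<epsilon> powr s * (\<epsilon> powr (- s) * D) = D" using assms by (simp add: powr_minus)
  ultimately show ?thesis by simp
qed

lemma log_plus_const_bound:
  fixes B \<epsilon> \<kappa> s K c a b :: real
  assumes "B > 0" "0 < \<epsilon>" "\<epsilon> \<le> 1 / exp 1" "\<kappa> > 0" "s \<ge> 0" "K > 0" "c * a \<ge> 0"
    and B: "B * \<kappa> = c * b"
    and "(2 * B * pos_ceiling (ln B) + 2 * s * B + 1) powr (1 / \<kappa>) * \<epsilon> powr (- s / \<kappa>)
      * ln (1 / \<epsilon>) powr (1 / \<kappa>) \<le> K"
    and "(c * a) powr (1 / \<kappa>) * \<epsilon> powr (- s / \<kappa>) \<le> K"
  shows "c * (a + b * ln K) \<le> 2 * (\<epsilon> powr s * K powr \<kappa>)"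
proof -
  have "c * b * ln K \<le> \<epsilon> powr s * K powr \<kappa>"
    using log_term_bound[OF assms(1-6,9)] unfolding B .
  moreover have "c * a \<le> \<epsilon> powr s * K powr \<kappa>"
    by (rule const_term_bound) (use assms in auto)
  ultimately show ?thesis by (simp add: algebra_simps)
qed

text \<open>Young's inequality with the conjugate weights \<open>(1 + \<nu>) / 2\<close> and
  \<open>(1 - \<nu>) / 2\<close>; the power of \<open>\<delta>\<close> is the one that makes the
  product equal to \<open>M D powr (1 + \<nu>)\<close>.\<close>

lemma young_power_le_quadratic:
  fixes M D \<delta> \<nu> :: real
  assumes "M > 0" "D \<ge> 0" "\<delta> > 0" "0 < \<nu>" "\<nu> \<le> 1"
  shows "M / (1 + \<nu>) * D powr (1 + \<nu>)
    \<le> \<delta> powr ((\<nu> - 1) / (1 + \<nu>)) * M powr (2 / (1 + \<nu>)) / 2 * D\<^sup>2 + \<delta> / 2"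
proof (cases "D = 0")
  case False
  then have D: "D > 0" using assms by simp
  define u where "u = \<delta> powr ((\<nu> - 1) / (1 + \<nu>)) * M powr (2 / (1 + \<nu>)) * D\<^sup>2"
  have u: "u > 0" using assms D by (simp add: u_def)
  have "u powr ((1 + \<nu>) / 2) = (\<delta> powr ((\<nu> - 1) / (1 + \<nu>))) powr ((1 + \<nu>) / 2)
      * (M powr (2 / (1 + \<nu>))) powr ((1 + \<nu>) / 2) * (D powr 2) powr ((1 + \<nu>) / 2)"
    using assms D by (simp add: u_def powr_mult)
  also have "\<dots> = \<delta> powr ((\<nu> - 1) / (1 + \<nu>) * ((1 + \<nu>) / 2)) * M powr (2 / (1 + \<nu>) * ((1 + \<nu>) / 2))
      * D powr (2 * ((1 + \<nu>) / 2))"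
    by (simp only: powr_powr)
  also have "(\<nu> - 1) / (1 + \<nu>) * ((1 + \<nu>) / 2) = (\<nu> - 1) / 2" using assms by simp
  also have "2 / (1 + \<nu>) * ((1 + \<nu>) / 2) = 1" using assms by simp
  also have "2 * ((1 + \<nu>) / 2) = 1 + \<nu>" by simp
  also have "M powr 1 = M" using assms by simp
  finally have "u powr ((1 + \<nu>) / 2) * \<delta> powr ((1 - \<nu>) / 2)
      = M * D powr (1 + \<nu>) * (\<delta> powr ((\<nu> - 1) / 2) * \<delta> powr ((1 - \<nu>) / 2))"
    by simp
  also have "\<delta> powr ((\<nu> - 1) / 2) * \<delta> powr ((1 - \<nu>) / 2) = 1"
    using assms by (simp flip: powr_add add: add_divide_distrib[symmetric])
  finally have "M * D powr (1 + \<nu>) \<le> (1 + \<nu>) / 2 * u + (1 - \<nu>) / 2 * \<delta>"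
    using Youngs_inequality_0[of "(1 + \<nu>) / 2" "(1 - \<nu>) / 2" u \<delta>] assms u by (simp add: field_simps)
  also have "\<dots> \<le> (1 + \<nu>) * (u / 2 + \<delta> / 2)"
  proof -
    have "(1 - \<nu>) / 2 * \<delta> \<le> (1 + \<nu>) / 2 * \<delta>" using assms by (intro mult_right_mono) auto
    then show ?thesis by (simp add: field_simps)
  qed
  finally have "M * D powr (1 + \<nu>) / (1 + \<nu>) \<le> u / 2 + \<delta> / 2"
    using assms by (simp add: divide_le_eq mult.commute)
  then show ?thesis by (simp add: u_def)
qed (use assms in simp)

lemma sum_inverse_le_ln:
  assumes "n \<ge> 1"
  shows "(\<Sum>k<n. 1 / (real k + 1)) \<le> 1 + ln (real n)"
  using assms
proof (induction n rule: dec_induct)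
  case (step n)
  have "ln (real n / (real n + 1)) \<le> real n / (real n + 1) - 1"
    using step.hyps by (intro ln_le_minus_one) auto
  also have "\<dots> = - (1 / (real n + 1))" by (simp add: field_simps)
  finally have "1 / (real n + 1) \<le> ln (real n + 1) - ln (real n)"
    using step.hyps by (simp add: ln_div)
  then show ?case using step.IH by (simp add: add.commute)
qed simp

text \<open>Averaging over the second half of the indices costs a factor 2, but there \<open>1 / (k
  + 1)\<close> is at most \<open>2 / n\<close>.\<close>

lemma exists_small_term_in_second_half:
  fixes w :: "nat \<Rightarrow> real"
  assumes "n \<ge> 1" "\<And>k. 0 \<le> w k" "(\<Sum>k<n. w k) < s"
  shows "\<exists>k<n. n \<le> 2 * (k + 1) \<and> w k < 2 * s / real n"
proof (rule ccontr)
  assume none: "\<not> ?thesis"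
  \<comment> \<open>For \<open>k \<ge> m\<close> one has \<open>n \<le> 2 (k + 1)\<close>, and at least half of the indices satisfy this.\<close>
  define m where "m = (n - 1) div 2"
  have "2 * s / real n \<le> w k" if "k \<in> {m..<n}" for k
  proof -
    have "n \<le> 2 * (k + 1)" "k < n" using that unfolding m_def by auto
    then show ?thesis using none by force
  qed
  then have "real (card {m..<n}) * (2 * s / real n) \<le> (\<Sum>k\<in>{m..<n}. w k)"
    by (intro sum_bounded_below)
  also have "\<dots> \<le> (\<Sum>k<n. w k)" by (intro sum_mono2) (use assms in auto)
  finally have le: "real (n - m) * (2 * s / real n) < s" using assms(3) by simp
  have "0 \<le> (\<Sum>k<n. w k)" by (rule sum_nonneg) (use assms in auto)
  then have "s > 0" using assms(3) by linarith
  have "n \<le> 2 * (n - m)" using assms(1) unfolding m_def by linarith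
  then have "real n \<le> 2 * real (n - m)" by (metis of_nat_le_iff of_nat_mult of_nat_numeral)
  then have "real n * s \<le> 2 * real (n - m) * s" using \<open>s > 0\<close> by (intro mult_right_mono) auto
  then have "s \<le> real (n - m) * (2 * s / real n)" using assms(1) by (simp add: field_simps)
  then show False using le by simp
qed

text \<open>The arithmetic behind the iteration bound. Here \<open>n\<close> stands for \<open>k +
  1\<close> and lies in the second half of \<open>{1..K}\<close>, so \<open>L\<close> is comparable
  with \<open>K powr ((1 - \<nu>) / (1 + \<nu>))\<close> from both sides; hence
  \<open>D\<^sup>2\<close> is of the order \<open>S K powr (- 2 / (1 + \<nu>))\<close> and \<open>(L
  D)\<^sup>2\<close> of the order \<open>S K powr (- 2 \<nu> / (1 + \<nu>))\<close>. The tolerance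
  \<open>\<epsilon>\<close> is shared out as \<open>\<epsilon>/3\<close> for \<open>L D\<close>,
  \<open>\<epsilon>/3\<close> for \<open>M D powr \<nu>\<close>, \<open>\<epsilon>/6\<close> for
  \<open>Lg D\<close> and \<open>\<epsilon>/6\<close> for the inexactness of the gradient.\<close>

lemma small_step_small_residual:
  fixes Lg Lf M N \<nu> \<gamma> \<sigma> \<epsilon> A S K n L_low L D :: real
  assumes pos: "Lg > 0" "Lf > 0" "M > 0" "\<gamma> > 0" "\<epsilon> > 0" "0 < \<nu>" "\<nu> \<le> 1" "A \<ge> 0" "K \<ge> 1" "D \<ge> 0"
    and N: "N = M powr (2 / (1 + \<nu>))" and L_low: "L_low = Lg + N"
    and n: "K \<le> 2 * n" "n \<le> K"  "n \<ge> 1"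
    and L: "L = Lg + (1 / n) powr ((\<nu> - 1) / (1 + \<nu>)) * N"
    and LD: "L * D\<^sup>2 < S / K"
    and K1: "18 * L_low * S \<le> \<epsilon>\<^sup>2 * K powr (2 * \<nu> / (1 + \<nu>))"
    and K2: "2 * (3 * M) powr (2 / \<nu>) * S \<le> N * (\<epsilon> powr (2 / \<nu>) * K powr (2 / (1 + \<nu>)))"
    and K3: "72 * Lg\<^sup>2 * S \<le> N * (\<epsilon>\<^sup>2 * K powr (2 / (1 + \<nu>)))"
    and K4: "32 * Lf\<^sup>2 * S \<le> \<gamma>\<^sup>2 * N * (\<epsilon> powr (2 * \<sigma>) * K powr (2 / (1 + \<nu>)))"
    and K5: "72 * A * \<epsilon> powr (- 2) \<le> K"
  shows "D < \<gamma> * \<epsilon> powr \<sigma> / (4 * Lf)"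
    and "(L + Lg) * D + M * D powr \<nu> + sqrt (A / n) \<le> \<epsilon>"
proof -
  have N_pos: "N > 0" using pos by (simp add: N)
  define \<beta> where "\<beta> = (1 - \<nu>) / (1 + \<nu>)"
  have \<beta>: "0 \<le> \<beta>" "\<beta> \<le> 1" using pos by (auto simp: \<beta>_def field_simps)
  have L_eq: "L = Lg + n powr \<beta> * N"
  proof -
    have "(\<nu> - 1) / (1 + \<nu>) = - \<beta>" by (simp add: \<beta>_def minus_divide_left)
    moreover have "(1 / n) powr (- \<beta>) = n powr \<beta>"
      using n by (simp add: powr_minus_divide powr_divide)
    ultimately show ?thesis by (simp add: L)
  qed
  have K_pow: "K * K powr \<beta> = K powr (2 / (1 + \<nu>))" "K powr (2 * \<nu> / (1 + \<nu>)) * K powr \<beta> = K"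
  proof -
    have "1 + \<nu> \<noteq> 0" using pos by simp
    then have "1 + \<beta> = 2 / (1 + \<nu>)" "2 * \<nu> / (1 + \<nu>) + \<beta> = 1"
      unfolding \<beta>_def by (simp_all add: divide_simps)
    then show "K * K powr \<beta> = K powr (2 / (1 + \<nu>))" "K powr (2 * \<nu> / (1 + \<nu>)) * K powr \<beta> = K"
      using pos powr_add[of K 1 \<beta>] powr_add[of K "2 * \<nu> / (1 + \<nu>)" \<beta>] by simp_all
  qed
  have L_pos: "L > 0" using pos N_pos by (simp add: L_eq add_pos_nonneg)
  have "0 \<le> L * D\<^sup>2" using L_pos by simp
  then have "0 < S / K" using LD by linarith
  then have S: "S > 0" using pos by (simp add: zero_less_divide_iff)
  have L_upper: "L \<le> L_low * K powr \<beta>"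
  proof -
    have "1 \<le> K powr \<beta>" using pos \<beta> by (simp add: ge_one_powr_ge_zero)
    then have "Lg \<le> Lg * K powr \<beta>" using pos by simp
    moreover have "n powr \<beta> \<le> K powr \<beta>" using n \<beta> by (intro powr_mono2) auto
    then have "n powr \<beta> * N \<le> N * K powr \<beta>" using N_pos by (simp add: mult.commute)
    ultimately show ?thesis by (simp add: L_eq L_low algebra_simps)
  qed
  have L_lower: "N * K powr \<beta> / 2 \<le> L"
  proof -
    have "(K / 2) powr \<beta> \<le> n powr \<beta>" using n \<beta> pos by (intro powr_mono2) auto
    moreover have "(K / 2) powr \<beta> = K powr \<beta> / 2 powr \<beta>" using pos by (simp add: powr_divide)
    moreover have "(2::real) powr \<beta> \<le> 2 powr 1" using \<beta> by (intro powr_mono) auto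
    then have "K powr \<beta> / 2 \<le> K powr \<beta> / 2 powr \<beta>" by (intro divide_left_mono) auto
    ultimately have "K powr \<beta> / 2 \<le> n powr \<beta>" by linarith
    then have "N * (K powr \<beta> / 2) \<le> N * n powr \<beta>" using N_pos by (intro mult_left_mono) auto
    then show ?thesis using pos by (simp add: L_eq mult.commute)
  qed
  define T where "T = N * K powr (2 / (1 + \<nu>))"
  have T: "T > 0" using N_pos pos by (simp add: T_def)
  have TD: "T * D\<^sup>2 < 2 * S"
  proof -
    have "N * K powr \<beta> / 2 * D\<^sup>2 \<le> L * D\<^sup>2" using L_lower by (rule mult_right_mono) simp
    then have "N * K powr \<beta> / 2 * D\<^sup>2 < S / K" using LD by linarith
    then have "N * (K * K powr \<beta>) * D\<^sup>2 < 2 * S" using pos by (simp add: field_simps)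
    then show ?thesis by (simp add: K_pow T_def)
  qed
  have compare: "c * D\<^sup>2 < e" if "2 * c * S \<le> T * e" "c > 0" for c e
  proof -
    have "T * (c * D\<^sup>2) = c * (T * D\<^sup>2)" by simp
    also have "\<dots> < c * (2 * S)" using TD that by (intro mult_strict_left_mono)
    also have "\<dots> \<le> T * e" using that by simp
    finally show ?thesis using T by simp
  qed
  have "(4 * Lf * D)\<^sup>2 < (\<gamma> * \<epsilon> powr \<sigma>)\<^sup>2"
  proof -
    have "16 * Lf\<^sup>2 * D\<^sup>2 < \<gamma>\<^sup>2 * \<epsilon> powr (2 * \<sigma>)"
      using K4 pos by (intro compare) (auto simp: T_def algebra_simps)
    moreover have "\<epsilon> powr (2 * \<sigma>) = (\<epsilon> powr \<sigma>)\<^sup>2"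
      using pos by (simp add: power2_eq_square flip: powr_add)
    ultimately show ?thesis by (simp add: power_mult_distrib)
  qed
  then have "4 * Lf * D < \<gamma> * \<epsilon> powr \<sigma>"
    by (rule power2_less_imp_less) (use \<open>\<gamma> > 0\<close> in simp)
  then show "D < \<gamma> * \<epsilon> powr \<sigma> / (4 * Lf)" using pos by (simp add: field_simps)
  have "(6 * Lg * D)\<^sup>2 < \<epsilon>\<^sup>2"
    using compare[of "36 * Lg\<^sup>2" "\<epsilon>\<^sup>2"] K3 pos by (simp add: T_def power_mult_distrib algebra_simps)
  then have part1: "6 * Lg * D < \<epsilon>" by (rule power2_less_imp_less) (use \<open>\<epsilon> > 0\<close> in simp)
  have part2: "3 * M * D powr \<nu> \<le> \<epsilon>"
  proof -
    have "(3 * M) powr (2 / \<nu>) * D\<^sup>2 < \<epsilon> powr (2 / \<nu>)"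
      using compare[of "(3 * M) powr (2 / \<nu>)"] K2 pos by (simp add: T_def algebra_simps)
    then have "((3 * M) powr (2 / \<nu>) * D\<^sup>2) powr (\<nu> / 2) \<le> (\<epsilon> powr (2 / \<nu>)) powr (\<nu> / 2)"
      using pos by (intro powr_mono2) auto
    moreover have "(D\<^sup>2) powr (\<nu> / 2) = D powr \<nu>"
    proof (cases "D = 0")
      case False
      then have "D\<^sup>2 = D powr 2" using pos by simp
      then show ?thesis by (simp only: powr_powr) simp
    qed (use pos in simp)
    ultimately show ?thesis using pos by (simp add: powr_mult powr_powr)
  qed
  have part3: "3 * (L * D) \<le> \<epsilon>"
  proof -
    have "L * (L * D\<^sup>2) \<le> L_low * K powr \<beta> * (S / K)"
      using L_upper LD L_pos S pos by (intro mult_mono) auto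
    moreover have "18 * (L * D)\<^sup>2 = 18 * (L * (L * D\<^sup>2))" by (simp add: power2_eq_square)
    moreover have "18 * L_low * S * (K powr \<beta> / K) = 18 * (L_low * K powr \<beta> * (S / K))" by simp
    ultimately have "18 * (L * D)\<^sup>2 \<le> 18 * L_low * S * (K powr \<beta> / K)" by linarith
    also have "\<dots> \<le> \<epsilon>\<^sup>2 * K powr (2 * \<nu> / (1 + \<nu>)) * (K powr \<beta> / K)"
      using K1 pos by (intro mult_right_mono) auto
    also have "\<dots> = \<epsilon>\<^sup>2 * ((K powr (2 * \<nu> / (1 + \<nu>)) * K powr \<beta>) / K)" by simp
    also have "\<dots> = \<epsilon>\<^sup>2" using pos unfolding K_pow by simp
    finally have "9 * (L * D)\<^sup>2 \<le> \<epsilon>\<^sup>2" using zero_le_power2[of "L * D"] by linarith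
    then have "(3 * (L * D))\<^sup>2 \<le> \<epsilon>\<^sup>2" unfolding power_mult_distrib[of 3] by simp
    then show ?thesis by (rule power2_le_imp_le) (use \<open>\<epsilon> > 0\<close> in simp)
  qed
  have part4: "sqrt (A / n) \<le> \<epsilon> / 6"
  proof (rule real_le_lsqrt)
    have "\<epsilon>\<^sup>2 * (72 * A * \<epsilon> powr (- 2)) \<le> \<epsilon>\<^sup>2 * K" using K5 by (intro mult_left_mono) auto
    moreover have "\<epsilon>\<^sup>2 * \<epsilon> powr (- 2) = 1" using pos by (simp add: powr_minus)
    moreover have "\<epsilon>\<^sup>2 * (72 * A * \<epsilon> powr (- 2)) = 72 * A * (\<epsilon>\<^sup>2 * \<epsilon> powr (- 2))" by simp
    ultimately have "72 * A \<le> \<epsilon>\<^sup>2 * K" by (metis mult.right_neutral)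
    also have "\<dots> \<le> \<epsilon>\<^sup>2 * (2 * n)" using n by (intro mult_left_mono) auto
    finally show "A / n \<le> (\<epsilon> / 6)\<^sup>2" using n by (simp add: field_simps power2_eq_square)
  qed (use pos in auto)
  show "(L + Lg) * D + M * D powr \<nu> + sqrt (A / n) \<le> \<epsilon>"
    using part1 part2 part3 part4 by (simp add: algebra_simps)
qed

text \<open>The exponent \<open>\<kappa> = 2 / (1 + \<nu>)\<close> is that of the three conditions
  that bound the step length itself; the factor \<open>1 / M\<close> of the constant term is the
  power \<open>(1 + \<nu>) / 2\<close> of \<open>1 / N\<close>.\<close>

lemma iteration_term_bound:
  fixes M \<nu> \<epsilon> s c a b K :: real
  defines "N \<equiv> M powr (2 / (1 + \<nu>))" and "B \<equiv> (1 + \<nu>) * c * b / (2 * M powr (2 / (1 + \<nu>)))"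
  assumes "M > 0" "0 < \<nu>" "0 < \<epsilon>" "\<epsilon> \<le> 1 / exp 1" "s \<ge> 0" "c > 0" "a \<ge> 0" "b > 0" "K > 0"
    and log_term: "(2 * B * pos_ceiling (ln B) + 2 * s * B + 1) powr ((1 + \<nu>) / 2)
      * \<epsilon> powr (- (1 + \<nu>) * s / 2) * ln (1 / \<epsilon>) powr ((1 + \<nu>) / 2) \<le> K"
    and const_term: "(c * a) powr ((1 + \<nu>) / 2) / M * \<epsilon> powr (- (1 + \<nu>) * s / 2) \<le> K"
  shows "c * (a + b * ln K) \<le> 2 * N * (\<epsilon> powr s * K powr (2 / (1 + \<nu>)))"
proof -
  have N: "N > 0" using assms by (simp add: N_def)
  have B: "B = (1 + \<nu>) * c * b / (2 * N)" by (simp add: B_def N_def)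
  have exponents: "1 / (2 / (1 + \<nu>)) = (1 + \<nu>) / 2" "- s / (2 / (1 + \<nu>)) = - (1 + \<nu>) * s / 2"
    by (auto simp: algebra_simps)
  have "N powr ((1 + \<nu>) / 2) = M"
  proof -
    have "2 / (1 + \<nu>) * ((1 + \<nu>) / 2) = 1" using \<open>0 < \<nu>\<close> by simp
    then show ?thesis using \<open>M > 0\<close> by (simp only: N_def powr_powr) simp
  qed
  then have "(c / N * a) powr ((1 + \<nu>) / 2) = (c * a) powr ((1 + \<nu>) / 2) / M"
    using powr_divide[of "c * a" N "(1 + \<nu>) / 2"] by simp
  then have "c / N * (a + b * ln K) \<le> 2 * (\<epsilon> powr s * K powr (2 / (1 + \<nu>)))"
    using assms N log_term const_term
    by (intro log_plus_const_bound[where B = B], unfold exponents) (simp_all add: B)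
  then have "N * (c / N * (a + b * ln K)) \<le> N * (2 * (\<epsilon> powr s * K powr (2 / (1 + \<nu>))))"
    using N by (intro mult_left_mono) auto
  then show ?thesis using N by simp
qed

section \<open>One iteration of the outer method\<close>

locale kl_minimax_algorithm = kl_minimax f p q Lf Lg C \<theta> \<gamma> \<sigma>
  for f :: "'a::euclidean_space \<times> 'b::euclidean_space \<Rightarrow> real"
    and p :: "'a \<Rightarrow> ereal" and q :: "'b \<Rightarrow> ereal" and Lf Lg C \<theta> \<gamma> \<sigma> +
  fixes \<epsilon> lam_bar \<rho> :: real
  assumes inputs: "\<epsilon> > 0" "lam_bar > 0" "0 < \<rho>" "\<rho> < 1"
begin

definition "r = \<gamma> * \<epsilon> powr \<sigma> / (4 * Lf)"
definition "M = inverse (1 - \<theta>) * C powr (- 1 / \<theta>) * Lg powr (1 / \<theta>)"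
definition "\<nu> = inverse \<theta> * (1 - \<theta>)"
definition "N = M powr (2 / (1 + \<nu>))"
definition "L_low = Lg + N"
definition "A = Lg\<^sup>2 / ((1 - \<theta>)\<^sup>2 * C\<^sup>2)"
definition "\<eta> k = 1 / (real k + 1)"
definition "L k = Lg + \<eta> k powr ((\<nu> - 1) / (1 + \<nu>)) * N"
text \<open>The gap guaranteed at iterate \<open>k\<close>. The exponent is chosen so that the error
  bound, which takes the power \<open>1 - \<theta>\<close>, turns the second entry into \<open>1 /
  sqrt (k + 1)\<close>.\<close>

definition "gap_tol k = min (\<gamma> * \<epsilon> powr \<sigma> / 2) (\<eta> k powr (1 / (2 * (1 - \<theta>))))"

abbreviation "potential x \<equiv> F_max x + rv p x"

abbreviation "stationary x \<equiv> stationary_point \<Psi> r \<epsilon> x"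

abbreviation "x_step k x y x' \<equiv> is_arg_min
  (\<lambda>u. ereal (gradient (\<lambda>u. f (u, y)) x \<bullet> u + L k / 2 * (norm (u - x))\<^sup>2) + p u)
  (\<lambda>u. u \<in> cball x r) x'"

lemma nu_facts: "0 < \<nu>" "\<nu> \<le> 1" "1 + \<nu> = 1 / \<theta>" "(1 - \<theta>) / \<theta> = \<nu>"
proof -
  show "0 < \<nu>" using constants by (simp add: \<nu>_def)
  show eq: "(1 - \<theta>) / \<theta> = \<nu>" by (simp add: \<nu>_def divide_inverse mult.commute)
  show "\<nu> \<le> 1" unfolding eq[symmetric] using constants by (simp add: divide_le_eq)
  show "1 + \<nu> = 1 / \<theta>" unfolding eq[symmetric] using theta_bounds by (simp add: diff_divide_distrib)
qed

lemma M_powr_eq: "M = (Lg / C) powr (1 / \<theta>) / (1 - \<theta>)"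
proof -
  have "C powr (- 1 / \<theta>) = inverse (C powr (1 / \<theta>))" using powr_minus[of C "1 / \<theta>"] by simp
  moreover have "(Lg / C) powr (1 / \<theta>) = Lg powr (1 / \<theta>) / C powr (1 / \<theta>)"
    by (rule powr_divide)
  ultimately show ?thesis by (simp add: M_def divide_inverse mult.commute mult.left_commute)
qed

lemma M_pos: "M > 0" using constants Lg_pos by (simp add: M_powr_eq)

lemma N_pos: "N > 0" using M_pos by (simp add: N_def)

lemma eta_bounds: "0 < \<eta> k" "\<eta> k \<le> 1" by (auto simp: \<eta>_def)

lemma L_low_pos: "L_low > 0" using N_pos Lg_pos by (simp add: L_low_def)

lemma L_ge: "L_low \<le> L k"
proof -
  have "1 = \<eta> k powr 0" using eta_bounds[of k] by simp
  also have "\<dots> \<le> \<eta> k powr ((\<nu> - 1) / (1 + \<nu>))"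
    using eta_bounds[of k] nu_facts(1,2) by (intro powr_mono') (auto simp: divide_le_0_iff)
  finally have "1 * N \<le> \<eta> k powr ((\<nu> - 1) / (1 + \<nu>)) * N" using N_pos by (intro mult_right_mono) auto
  then show ?thesis by (simp add: L_def L_low_def)
qed

lemma L_pos: "L k > 0" using L_ge[of k] L_low_pos by linarith

lemma r_pos: "r > 0" using constants Lf_pos inputs by (simp add: r_def)

lemma Lf_r: "4 * Lf * r = \<gamma> * \<epsilon> powr \<sigma>" using Lf_pos by (simp add: r_def)

lemma gap_tol_pos: "gap_tol k > 0" using constants inputs eta_bounds[of k] by (simp add: gap_tol_def)

lemma gap_tol_powr:
  assumes "s \<ge> 0"
  shows "gap_tol k powr s = min ((\<gamma> * \<epsilon> powr \<sigma> / 2) powr s) (\<eta> k powr (s / (2 * (1 - \<theta>))))"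
proof -
  have "\<eta> k powr (s / (2 * (1 - \<theta>))) = (\<eta> k powr (1 / (2 * (1 - \<theta>)))) powr s"
    by (simp add: powr_powr)
  moreover have "min a b powr s = min (a powr s) (b powr s)" if "0 \<le> a" "0 \<le> b" for a b
    using powr_mono2[OF assms, of a b] powr_mono2[OF assms, of b a] that by (auto simp: min_def)
  ultimately show ?thesis using constants by (simp add: gap_tol_def)
qed

lemma gap_tol_le_eta: "gap_tol k \<le> \<eta> k"
proof -
  have "\<eta> k powr (1 / (2 * (1 - \<theta>))) \<le> \<eta> k powr 1"
    using eta_bounds[of k] constants by (intro powr_mono') (auto simp: field_simps)
  then show ?thesis using eta_bounds[of k] by (simp add: gap_tol_def min_le_iff_disj)
qed

lemma not_critical_near_nonstationary:
  assumes "x \<in> X" "\<not> stationary x" "norm (u - x) \<le> r"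
  shows "u \<notin> eps_critical \<Psi> \<epsilon>"
proof
  assume "u \<in> eps_critical \<Psi> \<epsilon>"
  then have "edist x (eps_critical \<Psi> \<epsilon>) \<le> ereal r"
    using assms(3) by (intro edist_leI[of u]) (auto simp: dist_norm norm_minus_commute)
  then show False using assms(1,2) by (simp add: stationary_point_def edom_Psi)
qed

lemma gap_tol_error_bound:
  assumes "x \<in> X" "x \<notin> eps_critical \<Psi> \<epsilon>" "y \<in> Y" "gap x y \<le> gap_tol k"
  shows "\<exists>z\<in>Ymax f q x. dist y z \<le> 1 / (C * (1 - \<theta>)) *
    min ((\<gamma> / 2) powr (1 - \<theta>) * \<epsilon> powr (\<sigma> * (1 - \<theta>))) (1 / sqrt (real k + 1))"
proof -
  have "gap_tol k \<le> \<gamma> * \<epsilon> powr \<sigma> / 2" by (simp add: gap_tol_def)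
  moreover have "\<gamma> * \<epsilon> powr \<sigma> \<ge> 0" using constants by simp
  ultimately have "gap x y \<le> \<gamma> * \<epsilon> powr \<sigma>" using assms(4) by linarith
  then obtain z where z: "z \<in> Ymax f q x" "dist y z \<le> gap x y powr (1 - \<theta>) / (C * (1 - \<theta>))"
    using error_bound[OF assms(1,2) inputs(1) assms(3)] by blast
  have "gap x y powr (1 - \<theta>) \<le> gap_tol k powr (1 - \<theta>)"
    using assms gap_nonneg theta_bounds by (intro powr_mono2) auto
  also have "\<dots> = min ((\<gamma> / 2) powr (1 - \<theta>) * \<epsilon> powr (\<sigma> * (1 - \<theta>))) (1 / sqrt (real k + 1))"
  proof -
    have "(\<gamma> * \<epsilon> powr \<sigma> / 2) powr (1 - \<theta>) = (\<gamma> / 2) powr (1 - \<theta>) * \<epsilon> powr (\<sigma> * (1 - \<theta>))"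
      using powr_mult[of "\<gamma> / 2" "\<epsilon> powr \<sigma>" "1 - \<theta>"] constants by (simp add: powr_powr)
    moreover have "\<eta> k powr ((1 - \<theta>) / (2 * (1 - \<theta>))) = \<eta> k powr (1 / 2)"
      using theta_bounds by (intro arg_cong2[of _ _ _ _ "(powr)"]) auto
    moreover have "\<eta> k powr (1 / 2) = 1 / sqrt (real k + 1)"
      using eta_bounds[of k] by (simp add: powr_half_sqrt \<eta>_def real_sqrt_divide)
    ultimately show ?thesis using gap_tol_powr[of "1 - \<theta>" k] theta_bounds(3) by (metis less_imp_le)
  qed
  finally have "gap x y powr (1 - \<theta>) / (C * (1 - \<theta>)) \<le> 1 / (C * (1 - \<theta>)) *
      min ((\<gamma> / 2) powr (1 - \<theta>) * \<epsilon> powr (\<sigma> * (1 - \<theta>))) (1 / sqrt (real k + 1))"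
    using divide_right_mono[of _ _ "C * (1 - \<theta>)"] constants by simp
  with z show ?thesis by force
qed

text \<open>The constant \<open>A\<close> is the squared Lipschitz constant \<open>Lg\<close> times
  the squared constant of the error bound.\<close>

lemma nearest_maximizer:
  assumes "x \<in> X" "x \<notin> eps_critical \<Psi> \<epsilon>" "y \<in> Y" "gap x y \<le> gap_tol k"
  shows "\<exists>z\<in>Ymax f q x. (Lg * dist y z)\<^sup>2 \<le> A * \<eta> k"
proof -
  obtain z where z: "z \<in> Ymax f q x" "dist y z \<le> 1 / (C * (1 - \<theta>)) *
      min ((\<gamma> / 2) powr (1 - \<theta>) * \<epsilon> powr (\<sigma> * (1 - \<theta>))) (1 / sqrt (real k + 1))"
    using gap_tol_error_bound[OF assms] by blast
  have C': "C * (1 - \<theta>) > 0" using constants by simp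
  note z(2)
  also have "1 / (C * (1 - \<theta>)) * min ((\<gamma> / 2) powr (1 - \<theta>) * \<epsilon> powr (\<sigma> * (1 - \<theta>))) (1 / sqrt (real k + 1))
      \<le> 1 / (C * (1 - \<theta>)) * (1 / sqrt (real k + 1))"
    using C' by (intro mult_left_mono) auto
  finally have "(Lg * dist y z)\<^sup>2 \<le> (Lg * (1 / (C * (1 - \<theta>)) * (1 / sqrt (real k + 1))))\<^sup>2"
    using Lg_pos by (intro power_mono mult_left_mono) auto
  also have "\<dots> = A * \<eta> k"
    by (simp add: A_def \<eta>_def power_mult_distrib power_divide mult.commute)
  finally show ?thesis using z(1) by blast
qed

lemma x_step_in_domain:
  assumes "x \<in> X" "x_step k x y x'"
  shows "x' \<in> X" "norm (x' - x) \<le> r"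
proof -
  show "x' \<in> X" using r_pos assms(1) by (intro is_arg_min_finite[OF assms(2), of x]) auto
  show "norm (x' - x) \<le> r" using assms(2) by (simp add: is_arg_min_def dist_norm norm_minus_commute)
qed

lemma x_step_exists:
  assumes "x \<in> X"
  shows "\<exists>x'. x_step k x y x'"
proof -
  have "\<exists>w\<in>cball x r. w \<in> X \<and> (\<forall>u\<in>cball x r.
      ereal (gradient (\<lambda>u. f (u, y)) x \<bullet> w + L k / 2 * (norm (w - x))\<^sup>2) + p w
      \<le> ereal (gradient (\<lambda>u. f (u, y)) x \<bullet> u + L k / 2 * (norm (u - x))\<^sup>2) + p u)"
    using r_pos assms by (intro attains_min_on_compact[OF p_proper(1,2), where ?z0.0 = x])
      (auto intro!: continuous_intros)
  then show ?thesis by (auto simp: is_arg_min_linorder)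
qed

lemma x_step_prox_inequality:
  assumes x: "x \<in> X" and step: "x_step k x y x'" and u: "u \<in> X"
    and "t0 > 0" "\<And>t. 0 < t \<Longrightarrow> t \<le> t0 \<Longrightarrow> x' + t *\<^sub>R (u - x') \<in> cball x r"
  shows "rv p x' - (gx x y + L k *\<^sub>R (x' - x)) \<bullet> (u - x') \<le> rv p u"
  using prox_variational_inequality[OF p_proper(1,3) step x_step_in_domain(1)[OF x step] u assms(4,5)]
  by (simp add: gradient_x)

text \<open>An inactive ball constraint makes \<open>- (gx x y + L k (x' - x))\<close> a subgradient
  of \<open>p\<close> at \<open>x'\<close>. Adding the exact partial gradient \<open>gx x'
  z'\<close> gives an element of the subdifferential of \<open>\<Psi>\<close>, and the gradients are
  compared along \<open>(x', z')\<close>, \<open>(x, z')\<close>, \<open>(x, z)\<close>, \<open>(x,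
  y)\<close>.\<close>

lemma residual_bound:
  assumes x: "x \<in> X" and y: "y \<in> Y" and step: "x_step k x y x'" and interior: "norm (x' - x) < r"
    and z: "z \<in> Ymax f q x" and z': "z' \<in> Ymax f q x'"
  shows "\<exists>v\<in>limiting_subdiff \<Psi> x'.
    norm v \<le> (L k + Lg) * norm (x' - x) + Lg * dist y z + Lg * dist z z'"
proof -
  note x' = x_step_in_domain[OF x step]
  have zY: "z \<in> Y" "z' \<in> Y" using z z' Ymax_iff x x' by auto
  let ?s = "- (gx x y + L k *\<^sub>R (x' - x))"
  have "convex_subgradient p x' ?s"
  proof (rule convex_subgradientI[OF p_proper(1) x'(1)])
    fix u assume u: "u \<in> X"
    \<comment> \<open>The summand 1 avoids a division by 0 if \<open>u = x'\<close>.\<close>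
    define t0 where "t0 = (r - norm (x' - x)) / (1 + norm (u - x'))"
    have t0: "t0 > 0" using interior by (simp add: t0_def add_pos_nonneg)
    have "x' + t *\<^sub>R (u - x') \<in> cball x r" if t: "0 < t" "t \<le> t0" for t
    proof -
      have "norm (x' + t *\<^sub>R (u - x') - x) \<le> norm (x' - x) + t * norm (u - x')"
        using norm_triangle_ineq[of "x' - x" "t *\<^sub>R (u - x')"] t by (simp add: diff_add_eq)
      also have "t * norm (u - x') \<le> t0 * (1 + norm (u - x'))" using t by (intro mult_mono) auto
      also have "t0 * (1 + norm (u - x')) = r - norm (x' - x)"
        by (simp add: t0_def add_nonneg_eq_0_iff)
      finally show ?thesis by (simp add: dist_norm norm_minus_commute)
    qed
    from x_step_prox_inequality[OF x step u t0 this]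
    show "rv p x' + ?s \<bullet> (u - x') \<le> rv p u" by (simp only: inner_minus_left add_uminus_conv_diff)
  qed
  then have v: "gx x' z' + ?s \<in> limiting_subdiff \<Psi> x'" by (rule Psi_subgradient[OF x'(1) z'])
  have "gx x' z' + ?s = (gx x' z' - gx x z') + (gx x z' - gx x z) + (gx x z - gx x y) - L k *\<^sub>R (x' - x)"
    by simp
  also have "norm \<dots> \<le> norm (gx x' z' - gx x z') + norm (gx x z' - gx x z) + norm (gx x z - gx x y)
      + norm (L k *\<^sub>R (x' - x))"
    by (meson add_right_mono norm_triangle_ineq norm_triangle_ineq4 order_trans)
  also have "\<dots> \<le> Lg * norm (x' - x) + Lg * norm (z' - z) + Lg * norm (z - y) + L k * norm (x' - x)"
    using gx_dist_x[OF x'(1) x zY(2)] gx_dist_y[OF x zY(2,1)] gx_dist_y[OF x zY(1) y] L_pos[of k]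
    by simp
  finally show ?thesis using v
    by (intro bexI[of _ "gx x' z' + ?s"]) (auto simp: dist_norm norm_minus_commute algebra_simps)
qed

text \<open>The strongly convex subproblem gains \<open>L k |d|\<^sup>2\<close>. The Hoelder upper
  bound of \<open>F_max\<close> costs half of this and \<open>\<eta> k / 2\<close>; the inexact
  gradient, by completing a square, a quarter and \<open>A \<eta> k / L_low\<close>.\<close>

lemma descent:
  assumes x: "x \<in> X" "\<not> stationary x" and y: "y \<in> Y" and step: "x_step k x y x'"
    and z: "z \<in> Ymax f q x" "(Lg * dist y z)\<^sup>2 \<le> A * \<eta> k"
  shows "potential x' + L k / 4 * (norm (x' - x))\<^sup>2 \<le> potential x + (1 / 2 + A / L_low) * \<eta> k"
proof -
  note x' = x_step_in_domain[OF x(1) step]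
  have zY: "z \<in> Y" using z Ymax_iff x by auto
  define D where "D = norm (x' - x)"
  define e where "e = Lg * dist y z"
  have "D \<ge> 0" by (simp add: D_def)
  have "x' \<notin> eps_critical \<Psi> \<epsilon>" by (rule not_critical_near_nonstationary[OF x x'(2)])
  moreover have "2 * Lf * D \<le> \<gamma> * \<epsilon> powr \<sigma>"
  proof -
    have "Lf * D \<le> Lf * r" using x'(2) Lf_pos by (simp add: D_def)
    moreover have "Lf * r \<ge> 0" using Lf_pos r_pos by simp
    ultimately show ?thesis using Lf_r by linarith
  qed
  ultimately have "F_max x' \<le> F_max x + gx x z \<bullet> (x' - x) + Lg / 2 * D\<^sup>2 + (Lg / C * D) powr (1 / \<theta>)"
    unfolding D_def using x x' z inputs by (intro F_max_Holder_upper_bound) auto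
  moreover have "(Lg / C * D) powr (1 / \<theta>) \<le> \<eta> k powr ((\<nu> - 1) / (1 + \<nu>)) * N / 2 * D\<^sup>2 + \<eta> k / 2"
  proof -
    have "(Lg / C * D) powr (1 / \<theta>) = (1 - \<theta>) * M * D powr (1 + \<nu>)"
      using \<open>D \<ge> 0\<close> Lg_pos constants powr_mult[of "Lg / C" D "1 / \<theta>"] by (simp add: M_powr_eq nu_facts)
    also have "\<dots> \<le> \<theta> * M * D powr (1 + \<nu>)"
      using constants M_pos by (intro mult_right_mono) auto
    also have "\<dots> = M / (1 + \<nu>) * D powr (1 + \<nu>)" using theta_bounds by (simp add: nu_facts)
    also have "\<dots> \<le> \<eta> k powr ((\<nu> - 1) / (1 + \<nu>)) * N / 2 * D\<^sup>2 + \<eta> k / 2"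
      unfolding N_def using M_pos \<open>D \<ge> 0\<close> eta_bounds nu_facts by (intro young_power_le_quadratic) auto
    finally show ?thesis .
  qed
  moreover have "rv p x' + gx x y \<bullet> (x' - x) + L k * D\<^sup>2 \<le> rv p x"
  proof -
    have segment: "x' + t *\<^sub>R (x - x') \<in> cball x r" if "0 < t" "t \<le> 1" for t
    proof -
      have "x' + t *\<^sub>R (x - x') - x = (1 - t) *\<^sub>R (x' - x)" by (simp add: algebra_simps)
      then have "norm (x' + t *\<^sub>R (x - x') - x) = (1 - t) * D" using that by (simp add: D_def)
      also have "\<dots> \<le> D" using that \<open>D \<ge> 0\<close> by (simp add: mult_left_le_one_le)
      finally show ?thesis using x'(2) by (simp add: D_def dist_norm norm_minus_commute)
    qed
    have "rv p x' - (gx x y + L k *\<^sub>R (x' - x)) \<bullet> (x - x') \<le> rv p x"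
      by (rule x_step_prox_inequality[OF x(1) step x(1) zero_less_one segment])
    moreover have "(gx x y + L k *\<^sub>R (x' - x)) \<bullet> (x - x') = - (gx x y \<bullet> (x' - x) + L k * D\<^sup>2)"
      unfolding D_def power2_norm_eq_inner
      by (simp add: inner_diff_left inner_diff_right inner_add_left inner_commute algebra_simps)
    ultimately show ?thesis by simp
  qed
  moreover have "gx x z \<bullet> (x' - x) - gx x y \<bullet> (x' - x) \<le> e * D"
  proof -
    have "(gx x z - gx x y) \<bullet> (x' - x) \<le> norm (gx x z - gx x y) * D"
      unfolding D_def by (rule norm_cauchy_schwarz)
    also have "\<dots> \<le> e * D"
      using gx_dist_y[OF x(1) zY y] \<open>D \<ge> 0\<close>
      by (intro mult_right_mono) (auto simp: e_def dist_norm norm_minus_commute)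
    finally show ?thesis by (simp add: inner_diff_left)
  qed
  moreover have "e * D \<le> L k / 4 * D\<^sup>2 + A / L_low * \<eta> k"
  proof -
    have "0 \<le> (L k * D / 2 - e)\<^sup>2" by simp
    then have "L k * (e * D) \<le> L k * (L k / 4 * D\<^sup>2) + e\<^sup>2"
      by (simp add: power2_eq_square algebra_simps)
    then have "L k * (e * D) \<le> L k * (L k / 4 * D\<^sup>2 + e\<^sup>2 / L k)"
      using L_pos[of k] by (simp add: distrib_left)
    then have "e * D \<le> L k / 4 * D\<^sup>2 + e\<^sup>2 / L k" using L_pos[of k] by (simp only: mult_le_cancel_left_pos)
    moreover have "e\<^sup>2 / L k \<le> A * \<eta> k / L_low"
      using z(2) L_ge[of k] L_low_pos order_trans[OF zero_le_power2 z(2)] unfolding e_def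
      by (intro frac_le) auto
    ultimately show ?thesis by simp
  qed
  moreover have "L k * D\<^sup>2 = Lg * D\<^sup>2 + \<eta> k powr ((\<nu> - 1) / (1 + \<nu>)) * N * D\<^sup>2"
    by (simp add: L_def algebra_simps)
  moreover have "(1 / 2 + A / L_low) * \<eta> k = \<eta> k / 2 + A / L_low * \<eta> k"
    by (simp add: distrib_right)
  moreover have "Lg / 2 * D\<^sup>2 = Lg * D\<^sup>2 / 2" "L k / 4 * D\<^sup>2 = L k * D\<^sup>2 / 4"
    "\<eta> k powr ((\<nu> - 1) / (1 + \<nu>)) * N / 2 * D\<^sup>2 = \<eta> k powr ((\<nu> - 1) / (1 + \<nu>)) * N * D\<^sup>2 / 2"
    by simp_all
  ultimately show ?thesis unfolding D_def[symmetric] by linarith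
qed

lemma maximizer_step:
  assumes x: "x \<in> X" "\<not> stationary x" and x': "x' \<in> X" "norm (x' - x) \<le> r" and z: "z \<in> Ymax f q x"
  shows "\<exists>z'\<in>Ymax f q x'. Lg * dist z z' \<le> M * norm (x' - x) powr \<nu>"
proof -
  define D where "D = norm (x' - x)"
  have "Lf * D \<le> Lf * r" using x'(2) Lf_pos by (simp add: D_def)
  moreover have "Lf * r \<ge> 0" using Lf_pos r_pos by simp
  ultimately have "2 * Lf * D \<le> \<gamma> * \<epsilon> powr \<sigma>" using Lf_r by linarith
  moreover have "x' \<notin> eps_critical \<Psi> \<epsilon>" by (rule not_critical_near_nonstationary[OF x x'(2)])
  ultimately obtain z' where z': "z' \<in> Ymax f q x'"
      "dist z z' \<le> (Lg / C * D) powr ((1 - \<theta>) / \<theta>) / (C * (1 - \<theta>))"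
    using maximizer_near_maximizer[OF x(1) x'(1) _ inputs(1) _ z] unfolding D_def by blast
  have "Lg * dist z z' \<le> Lg * ((Lg / C * D) powr \<nu> / (C * (1 - \<theta>)))"
    using z'(2) Lg_pos unfolding nu_facts(4) by (intro mult_left_mono) auto
  also have "\<dots> = (Lg / C * (Lg / C) powr \<nu>) / (1 - \<theta>) * D powr \<nu>"
    using Lg_pos constants powr_mult[of "Lg / C" D \<nu>] by (simp add: D_def)
  also have "Lg / C * (Lg / C) powr \<nu> = (Lg / C) powr (1 + \<nu>)"
    using Lg_pos constants by (simp add: powr_add)
  also have "\<dots> / (1 - \<theta>) = M" by (simp add: M_powr_eq nu_facts)
  finally show ?thesis using z'(1) by (auto simp: D_def)
qed

end

section \<open>Runs of the method\<close>

context kl_minimax_algorithm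
begin

definition "\<tau> k = C / (Lg + inverse (min (\<rho> / Lg) lam_bar)) *
  min ((\<gamma> * \<epsilon> powr \<sigma> / 2) powr \<theta>) (\<eta> (Suc k) powr (\<theta> / (2 * (1 - \<theta>))))"

abbreviation "run x0 y0 xs ys \<equiv> ipg_run f p q Lf Lg C \<theta> \<gamma> \<sigma> \<epsilon> lam_bar \<rho> x0 y0 xs ys"

lemma tau_eq: "\<tau> k = C / (Lg + inverse (min (\<rho> / Lg) lam_bar)) * gap_tol (Suc k) powr \<theta>"
  using theta_bounds by (simp add: \<tau>_def gap_tol_powr)

lemma tau_pos: "\<tau> k > 0"
proof -
  have "min (\<rho> / Lg) lam_bar > 0" using inputs Lg_pos by simp
  then show ?thesis
    unfolding tau_eq using constants Lg_pos gap_tol_pos[of "Suc k"]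
    by (intro mult_pos_pos divide_pos_pos add_pos_pos) auto
qed

lemma run_iff:
  "run x0 y0 xs ys \<longleftrightarrow> xs 0 = x0 \<and> ys 0 = y0 \<and>
    (\<forall>k. x_step k (xs k) (ys k) (xs (Suc k)) \<and>
      pg_returns (\<lambda>y. - f (xs (Suc k), y)) q lam_bar \<rho> (\<tau> k) (ys k) (ys (Suc k)))"
  unfolding ipg_run_def Let_def \<tau>_def L_def N_def M_def \<nu>_def r_def \<eta>_def by (rule refl)

lemma run_exists:
  assumes "x0 \<in> X" "y0 \<in> Y"
  shows "\<exists>xs ys. run x0 y0 xs ys"
proof -
  define P where "P n s \<longleftrightarrow> fst s \<in> X \<and> snd s \<in> Y \<and> (n = 0 \<longrightarrow> s = (x0, y0))" for n :: nat and s
  define Q where "Q k s s' \<longleftrightarrow> x_step k (fst s) (snd s) (fst s') \<and>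
    pg_returns (\<lambda>y. - f (fst s', y)) q lam_bar \<rho> (\<tau> k) (snd s) (snd s')" for k s s'
  have "\<exists>h. \<forall>n. P n (h n) \<and> Q n (h n) (h (Suc n))"
  proof (rule dependent_nat_choice)
    show "\<exists>s. P 0 s" using assms by (auto simp: P_def)
    fix s n assume "P n s"
    then have s: "fst s \<in> X" "snd s \<in> Y" by (auto simp: P_def)
    obtain x' where x': "x_step n (fst s) (snd s) x'" using x_step_exists[OF s(1)] by blast
    note X = x_step_in_domain(1)[OF s(1) x']
    obtain y' where y': "pg_returns (\<lambda>y. - f (x', y)) q lam_bar \<rho> (\<tau> n) (snd s) y'"
      using pg_returns_exists[OF X s(2) inputs(2-4) tau_pos] by blast
    have "y' \<in> Y" using pg_returns_properties[OF y' X s(2) inputs(2-4)] by blast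
    then show "\<exists>s'. P (Suc n) s' \<and> Q n s s'"
      using X x' y' by (intro exI[of _ "(x', y')"]) (simp add: P_def Q_def)
  qed
  then obtain h where h: "\<And>n. P n (h n)" "\<And>n. Q n (h n) (h (Suc n))" by blast
  have "run x0 y0 (\<lambda>n. fst (h n)) (\<lambda>n. snd (h n))"
    unfolding run_iff using h(1)[of 0] h(2) by (auto simp: P_def Q_def)
  then show ?thesis by blast
qed

lemma run_in_domain:
  assumes "run x0 y0 xs ys" "x0 \<in> X" "y0 \<in> Y"
  shows "xs k \<in> X" "ys k \<in> Y"
proof -
  have "xs k \<in> X \<and> ys k \<in> Y"
  proof (induction k)
    case 0
    then show ?case using assms by (simp add: run_iff)
  next
    case (Suc k)
    have step: "x_step k (xs k) (ys k) (xs (Suc k))"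
      and returns: "pg_returns (\<lambda>y. - f (xs (Suc k), y)) q lam_bar \<rho> (\<tau> k) (ys k) (ys (Suc k))"
      using assms(1) by (auto simp: run_iff)
    have X: "xs (Suc k) \<in> X" using x_step_in_domain(1) Suc.IH step by blast
    then show ?case using pg_returns_properties[OF returns X _ inputs(2-4)] Suc.IH by blast
  qed
  then show "xs k \<in> X" "ys k \<in> Y" by auto
qed

text \<open>Moving by at most \<open>r\<close> raises the gap by at most \<open>2 Lf r = \<gamma>
  \<epsilon>\<^sup>\<sigma> / 2\<close>, so from \<open>gap_tol k \<le> \<gamma>
  \<epsilon>\<^sup>\<sigma> / 2\<close> one arrives within the KL region at
  \<open>x\<^sup>k\<^sup>+\<^sup>1\<close>, and the subroutine restores the tolerance.\<close>

lemma run_gap: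
  assumes run: "run x0 y0 xs ys" and start: "x0 \<in> X" "y0 \<in> Y" "gap x0 y0 \<le> gap_tol 0"
    and "\<And>j. j < k \<Longrightarrow> \<not> stationary (xs j)"
  shows "gap (xs k) (ys k) \<le> gap_tol k"
  using assms(5)
proof (induction k)
  case 0
  then show ?case using start run by (simp add: run_iff)
next
  case (Suc k)
  note dom = run_in_domain[OF run start(1,2)]
  have step: "x_step k (xs k) (ys k) (xs (Suc k))"
    and returns: "pg_returns (\<lambda>y. - f (xs (Suc k), y)) q lam_bar \<rho> (\<tau> k) (ys k) (ys (Suc k))"
    using run by (auto simp: run_iff)
  have near: "norm (xs (Suc k) - xs k) \<le> r" by (rule x_step_in_domain(2)[OF dom(1) step])
  have noncritical: "xs (Suc k) \<notin> eps_critical \<Psi> \<epsilon>"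
    by (rule not_critical_near_nonstationary[OF dom(1) Suc.prems near]) simp
  have "Lf * norm (xs (Suc k) - xs k) \<le> Lf * r" using near Lf_pos by simp
  then have "gap (xs (Suc k)) (ys k) \<le> gap (xs k) (ys k) + 2 * (Lf * r)"
    using gap_lipschitz[OF dom(1) dom(1) dom(2), of "Suc k" k k] by linarith
  moreover have "gap (xs k) (ys k) \<le> \<gamma> * \<epsilon> powr \<sigma> / 2"
    using Suc by (auto simp: gap_tol_def)
  ultimately have "gap (xs (Suc k)) (ys k) \<le> \<gamma> * \<epsilon> powr \<sigma>" using Lf_r by linarith
  then show ?case
    by (rule pg_returns_gap[OF returns dom(1) noncritical inputs(1) dom(2) _ inputs(2-4) tau_eq
          less_imp_le[OF gap_tol_pos]])
qed

text \<open>If no iterate were stationary, telescoping the descent would produce a short step in the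
  second half, whose end point is \<open>\<epsilon>\<close>-critical. \<open>S\<close> strictly
  exceeds eight times the telescoped sum, which makes the step strictly shorter than
  \<open>r\<close> and the ball constraint inactive.\<close>

lemma stationary_within:
  fixes n :: nat and lb :: real and x0 :: 'a
  defines "S \<equiv> 8 * (potential x0 - lb + 3 + 2 * A / L_low) + 8 * (3 / 2 + A / L_low) * ln (real n)"
  assumes run: "run x0 y0 xs ys" and start: "x0 \<in> X" "y0 \<in> Y" "gap x0 y0 \<le> gap_tol 0"
    and lb: "\<And>x. x \<in> X \<Longrightarrow> lb \<le> potential x"
    and n: "n \<ge> 1"
    and K1: "18 * L_low * S \<le> \<epsilon>\<^sup>2 * real n powr (2 * \<nu> / (1 + \<nu>))"
    and K2: "2 * (3 * M) powr (2 / \<nu>) * S \<le> N * (\<epsilon> powr (2 / \<nu>) * real n powr (2 / (1 + \<nu>)))"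
    and K3: "72 * Lg\<^sup>2 * S \<le> N * (\<epsilon>\<^sup>2 * real n powr (2 / (1 + \<nu>)))"
    and K4: "32 * Lf\<^sup>2 * S \<le> \<gamma>\<^sup>2 * N * (\<epsilon> powr (2 * \<sigma>) * real n powr (2 / (1 + \<nu>)))"
    and K5: "72 * A * \<epsilon> powr (- 2) \<le> real n"
  shows "\<exists>k<n. stationary (xs k)"
proof (rule ccontr)
  assume "\<not> ?thesis"
  then have nonstationary: "\<not> stationary (xs k)" if "k < n" for k using that by blast
  note dom = run_in_domain[OF run start(1,2)]
  have step: "x_step k (xs k) (ys k) (xs (Suc k))" for k using run by (auto simp: run_iff)
  define D where "D k = norm (xs (Suc k) - xs k)" for k
  have near: "D k \<le> r" for k unfolding D_def by (rule x_step_in_domain(2)[OF dom(1) step])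
  have maximizer: "\<exists>z\<in>Ymax f q (xs k). (Lg * dist (ys k) z)\<^sup>2 \<le> A * \<eta> k" if "k < n" for k
  proof (rule nearest_maximizer[OF dom(1) _ dom(2)])
    show "xs k \<notin> eps_critical \<Psi> \<epsilon>"
      by (rule not_critical_near_nonstationary[OF dom(1) nonstationary[OF that]]) (use r_pos in simp)
    show "gap (xs k) (ys k) \<le> gap_tol k"
      by (rule run_gap[OF run start]) (use nonstationary that in auto)
  qed
  define c where "c = 1 / 2 + A / L_low"
  have A: "A \<ge> 0" by (simp add: A_def)
  then have AL: "A / L_low \<ge> 0" using L_low_pos by simp
  have "potential (xs m) + (\<Sum>k<m. L k / 4 * (D k)\<^sup>2) \<le> potential x0 + c * (\<Sum>k<m. \<eta> k)" if "m \<le> n" for m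
    using that
  proof (induction m)
    case 0
    then show ?case using run by (simp add: run_iff)
  next
    case (Suc m)
    then have "m < n" by simp
    then obtain z where "z \<in> Ymax f q (xs m)" "(Lg * dist (ys m) z)\<^sup>2 \<le> A * \<eta> m"
      using maximizer by blast
    from descent[OF dom(1) nonstationary[OF \<open>m < n\<close>] dom(2) step this]
    have "potential (xs (Suc m)) + L m / 4 * (D m)\<^sup>2 \<le> potential (xs m) + c * \<eta> m"
      by (simp add: D_def c_def)
    then show ?case using Suc by (simp add: distrib_left)
  qed
  from this[of n] have "(\<Sum>k<n. L k / 4 * (D k)\<^sup>2) \<le> potential x0 - lb + c * (\<Sum>k<n. \<eta> k)"
    using lb[OF dom(1), of n] by simp
  also have "\<dots> \<le> potential x0 - lb + c * (1 + ln (real n))"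
    using sum_inverse_le_ln[OF n] AL unfolding \<eta>_def c_def by (intro add_left_mono mult_left_mono) auto
  also have "\<dots> < S / 8"
  proof -
    have arith: "x + (1 / 2 + \<alpha> + l / 2 + \<alpha> * l) < x + 3 + 2 * \<alpha> + 3 / 2 * l + \<alpha> * l"
      if "0 \<le> \<alpha>" "0 \<le> l" for x \<alpha> l :: real
      using that by simp
    have "0 \<le> ln (real n)" using n by simp
    note arith[OF AL this, of "potential x0 - lb"]
    moreover have "c * (1 + ln (real n)) = 1 / 2 + A / L_low + ln (real n) / 2 + A / L_low * ln (real n)"
      by (simp add: c_def distrib_left distrib_right add_divide_distrib)
    moreover have "S = 8 * (potential x0 - lb + 3 + 2 * (A / L_low) + 3 / 2 * ln (real n)
        + A / L_low * ln (real n))"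
      by (simp add: S_def algebra_simps)
    ultimately show ?thesis by (simp only: nonzero_mult_div_cancel_left[OF zero_neq_numeral[symmetric]])
  qed
  finally have "4 * (\<Sum>k<n. L k / 4 * (D k)\<^sup>2) < S / 2" by simp
  then have "(\<Sum>k<n. L k * (D k)\<^sup>2) < S / 2" by (simp add: sum_distrib_left)
  then obtain k where k: "k < n" "n \<le> 2 * (k + 1)" "L k * (D k)\<^sup>2 < 2 * (S / 2) / real n"
    using exists_small_term_in_second_half[OF n, of "\<lambda>k. L k * (D k)\<^sup>2" "S / 2"] less_imp_le[OF L_pos]
    by auto
  have "real n \<le> real (2 * (k + 1))" using k(2) of_nat_le_iff by blast
  then have k_real: "real n \<le> 2 * (real k + 1)" "real k + 1 \<le> real n" using k(1) by auto
  have small: "D k < r" "(L k + Lg) * D k + M * D k powr \<nu> + sqrt (A / (real k + 1)) \<le> \<epsilon>"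
    unfolding r_def
    using small_step_small_residual[OF Lg_pos Lf_pos M_pos constants(4) inputs(1) nu_facts(1,2) A _ _
        N_def L_low_def k_real _ L_def[unfolded \<eta>_def] _ K1 K2 K3 K4 K5, of "D k"] n k(3)
    by (auto simp: D_def)
  obtain z where z: "z \<in> Ymax f q (xs k)" "(Lg * dist (ys k) z)\<^sup>2 \<le> A * \<eta> k"
    using maximizer[OF k(1)] by blast
  obtain z' where z': "z' \<in> Ymax f q (xs (Suc k))" "Lg * dist z z' \<le> M * D k powr \<nu>"
    using maximizer_step[OF dom(1) nonstationary[OF k(1)] dom(1) _ z(1), of "Suc k"] near[of k]
    unfolding D_def by blast
  obtain v where v: "v \<in> limiting_subdiff \<Psi> (xs (Suc k))"
      "norm v \<le> (L k + Lg) * D k + Lg * dist (ys k) z + Lg * dist z z'"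
    using residual_bound[OF dom(1) dom(2) step _ z(1) z'(1)] small(1) unfolding D_def by blast
  have "Lg * dist (ys k) z \<le> sqrt (A / (real k + 1))"
    using z(2) by (intro real_le_rsqrt) (simp add: \<eta>_def)
  then have "norm v \<le> \<epsilon>" using v(2) z'(2) small(2) by linarith
  then have "xs (Suc k) \<in> eps_critical \<Psi> \<epsilon>"
    unfolding eps_critical_def using edist_leI[OF v(1), of 0 \<epsilon>] by simp
  moreover have "xs (Suc k) \<notin> eps_critical \<Psi> \<epsilon>"
    using not_critical_near_nonstationary[OF dom(1) nonstationary[OF k(1)]] near[of k]
    unfolding D_def by blast
  ultimately show False by simp
qed

text \<open>The first stationary iterate is either \<open>x0\<close> or a point in the
  \<open>r\<close>-ball of a non-stationary predecessor, and hence not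
  \<open>\<epsilon>\<close>-critical unless \<open>x0\<close> is.\<close>

lemma first_stationary_iterate:
  assumes run: "run x0 y0 xs ys" and start: "x0 \<in> X" "y0 \<in> Y" "gap x0 y0 \<le> gap_tol 0"
    and "j < n" "stationary (xs j)"
  shows "\<exists>k<n. stationary (xs k) \<and> gap (xs k) (ys k) \<le> gap_tol k \<and>
    (x0 \<notin> eps_critical \<Psi> \<epsilon> \<longrightarrow> xs k \<notin> eps_critical \<Psi> \<epsilon>)"
proof -
  \<comment> \<open>The estimates below need that all predecessors are non-stationary.\<close>
  define k where "k = (LEAST k. stationary (xs k))"
  have k: "stationary (xs k)" unfolding k_def by (rule LeastI) fact
  have before: "\<not> stationary (xs i)" if "i < k" for i
    using that not_less_Least unfolding k_def by blast
  have "k \<le> j" unfolding k_def by (rule Least_le) fact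
  moreover have "gap (xs k) (ys k) \<le> gap_tol k" by (rule run_gap[OF run start before])
  moreover have "xs k \<notin> eps_critical \<Psi> \<epsilon>" if "x0 \<notin> eps_critical \<Psi> \<epsilon>"
  proof (cases k)
    case 0
    then show ?thesis using that run by (simp add: run_iff)
  next
    case (Suc i)
    note dom = run_in_domain[OF run start(1,2)]
    have "x_step i (xs i) (ys i) (xs (Suc i))" using run by (auto simp: run_iff)
    then show ?thesis
      using not_critical_near_nonstationary[OF dom(1) before[of i]] x_step_in_domain(2)[OF dom(1)] Suc
      by auto
  qed
  ultimately show ?thesis using k \<open>j < n\<close> by (intro exI[of _ k]) auto
qed

end

section \<open>The complexity bound\<close>

theorem theorem4:
  fixes f :: "'a::euclidean_space \<times> 'b::euclidean_space \<Rightarrow> real"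
    and p :: "'a \<Rightarrow> ereal" and q :: "'b \<Rightarrow> ereal"
    and Lf Lg C \<theta> \<gamma> \<sigma> \<epsilon> lam_bar \<rho> :: real
    and x0 :: 'a and y0 :: 'b
    and M \<nu> A L_low a b C1 C2 C3 C4 C5 C6 C7 C8 :: real
    and K :: int
  assumes f_smooth: "\<And>z. f differentiable (at z)" "continuous_on UNIV (gradient f)"
    and Lf_pos: "Lf > 0" and Lg_pos: "Lg > 0"
    and f_lipschitz: "\<And>y. y \<in> edom q \<Longrightarrow> lipschitz_on Lf (edom p) (\<lambda>x. f (x, y))"
    and grad_lipschitz: "lipschitz_on Lg (edom p \<times> edom q) (gradient f)"
    and p_pcc: "proper_closed_convex p"
    and q_pcc: "proper_closed_convex q"
    and aff_dom_p: "affine hull (edom p) = UNIV"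
    and max_attained: "\<And>x. x \<in> edom p \<Longrightarrow> Ymax f q x \<noteq> {} \<and> \<bar>Fmax f q x\<bar> \<noteq> \<infinity>"
    and constants: "C > 0" "1 / 2 \<le> \<theta>" "\<theta> < 1" "\<gamma> > 0" "\<sigma> > 0"
    and KL: "\<And>x y. x \<in> edom p \<Longrightarrow> y \<in> KL_region f p q \<gamma> \<sigma> x \<Longrightarrow>
               ereal C * epowr (Fmax f q x - Fobj f q x y) \<theta> \<le> edist 0 (subdiff_y f q x y)"
    and Psi_min_finite: "\<bar>Psi_min f p q\<bar> \<noteq> \<infinity>"
    and inputs: "\<epsilon> > 0" "lam_bar > 0" "0 < \<rho>" "\<rho> < 1"
    and initial: "x0 \<in> edom p" "y0 \<in> edom q"
      "Fmax f q x0 - Fobj f q x0 y0 \<le> ereal (min (\<gamma> * \<epsilon> powr \<sigma> / 2) 1)"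
    and M_eq: "M = inverse (1 - \<theta>) * C powr (- 1 / \<theta>) * Lg powr (1 / \<theta>)"
    and nu_eq: "\<nu> = inverse \<theta> * (1 - \<theta>)"
    and A_eq: "A = Lg\<^sup>2 / ((1 - \<theta>)\<^sup>2 * C\<^sup>2)"
    and L_low_eq: "L_low = Lg + M powr (2 / (1 + \<nu>))"
    and a_eq: "a = 8 * (real_of_ereal (Psi f p q x0) - real_of_ereal (Psi_min f p q)
                         + 3 + 2 * A / L_low)"
    and b_eq: "b = 8 * (3 / 2 + A / L_low)"
    and C1_eq: "C1 =
       (36 * (1 + \<nu>) / \<nu> * b * L_low * pos_ceiling (ln (18 * (1 + \<nu>) / \<nu> * b * L_low))
         + 72 * (1 + \<nu>) / \<nu> * b * L_low + 1) powr ((1 + \<nu>) / (2 * \<nu>))"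
    and C2_eq: "C2 =
       (4 * b * (1 + \<nu>) * (3 * M) powr (2 / \<nu>) / M powr (2 / (1 + \<nu>))
           * pos_ceiling (ln (2 * b * (1 + \<nu>) * (3 * M) powr (2 / \<nu>) / M powr (2 / (1 + \<nu>))))
         + 8 * b * (1 + \<nu>) * (3 * M) powr (2 / \<nu>) / (\<nu> * M powr (2 / (1 + \<nu>))) + 1)
       powr ((1 + \<nu>) / 2)"
    and C3_eq: "C3 =
       (36 * L_low * a) powr ((1 + \<nu>) / (2 * \<nu>))
         + (4 * a * (3 * M) powr (2 / \<nu>)) powr ((1 + \<nu>) / 2) / M"
    and C4_eq: "C4 = 72 * A"
    and C5_eq: "C5 =
       (144 * (1 + \<nu>) * b * Lg\<^sup>2 / M powr (2 / (1 + \<nu>))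
           * pos_ceiling (ln (72 * (1 + \<nu>) * b * Lg\<^sup>2 / M powr (2 / (1 + \<nu>))))
         + 288 * (1 + \<nu>) * b * Lg\<^sup>2 / M powr (2 / (1 + \<nu>)) + 1) powr ((1 + \<nu>) / 2)"
    and C6_eq: "C6 = (144 * a * Lg\<^sup>2) powr ((1 + \<nu>) / 2) / M"
    and C7_eq: "C7 =
       (64 * (1 + \<nu>) * b * Lf\<^sup>2 / (\<gamma>\<^sup>2 * M powr (2 / (1 + \<nu>)))
           * pos_ceiling (ln (32 * (1 + \<nu>) * b * Lf\<^sup>2 / (\<gamma>\<^sup>2 * M powr (2 / (1 + \<nu>)))))
         + 128 * \<sigma> * (1 + \<nu>) * b * Lf\<^sup>2 / (\<gamma>\<^sup>2 * M powr (2 / (1 + \<nu>))) + 1)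
       powr ((1 + \<nu>) / 2)"
    and C8_eq: "C8 = (64 * a * Lf\<^sup>2) powr ((1 + \<nu>) / 2) / (\<gamma> powr (1 + \<nu>) * M)"
    and K_eq: "K = \<lceil>C1 * \<epsilon> powr (- (1 + \<nu>) / \<nu>) * ln (1 / \<epsilon>) powr ((1 + \<nu>) / (2 * \<nu>))
         + C2 * \<epsilon> powr (- (1 + \<nu>) / \<nu>) * ln (1 / \<epsilon>) powr ((1 + \<nu>) / 2)
         + C3 * \<epsilon> powr (- (1 + \<nu>) / \<nu>)
         + C4 * \<epsilon> powr (- 2)
         + C5 * \<epsilon> powr (- (1 + \<nu>)) * ln (1 / \<epsilon>) powr ((1 + \<nu>) / 2)
         + C6 * \<epsilon> powr (- (1 + \<nu>))
         + C7 * \<epsilon> powr (- (1 + \<nu>) * \<sigma>) * ln (1 / \<epsilon>) powr ((1 + \<nu>) / 2)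
         + C8 * \<epsilon> powr (- (1 + \<nu>) * \<sigma>)\<rceil>"
    and eps_le: "\<epsilon> \<le> 1 / exp 1"
  shows "(\<exists>xs ys. ipg_run f p q Lf Lg C \<theta> \<gamma> \<sigma> \<epsilon> lam_bar \<rho> x0 y0 xs ys) \<and>
    (\<forall>xs ys. ipg_run f p q Lf Lg C \<theta> \<gamma> \<sigma> \<epsilon> lam_bar \<rho> x0 y0 xs ys \<longrightarrow>
      (\<exists>k. int k \<le> K \<and>
         stationary_point (Psi f p q) (\<gamma> * \<epsilon> powr \<sigma> / (4 * Lf)) \<epsilon> (xs k) \<and>
         Fmax f q (xs k) - Fobj f q (xs k) (ys k)
           \<le> ereal (min (\<gamma> * \<epsilon> powr \<sigma> / 2) (1 / (real k + 1))) \<and>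
         (x0 \<notin> eps_critical (Psi f p q) \<epsilon> \<longrightarrow>
           edist (ys k) (Ymax f q (xs k))
             \<le> ereal (1 / (C * (1 - \<theta>)) *
                  min ((\<gamma> / 2) powr (1 - \<theta>) * \<epsilon> powr (\<sigma> * (1 - \<theta>))) (1 / sqrt (real k + 1))))))"
proof -
  interpret alg: kl_minimax_algorithm f p q Lf Lg C \<theta> \<gamma> \<sigma> \<epsilon> lam_bar \<rho>
    by unfold_locales (fact f_smooth(1) Lf_pos Lg_pos f_lipschitz grad_lipschitz p_pcc q_pcc
      max_attained constants KL inputs)+
  have M: "alg.M = M" by (simp only: alg.M_def M_eq)
  have \<nu>: "alg.\<nu> = \<nu>" by (simp only: alg.\<nu>_def nu_eq)
  define N where "N = M powr (2 / (1 + \<nu>))"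
  have N: "alg.N = N" by (simp only: alg.N_def M \<nu> N_def)
  have L_low: "alg.L_low = L_low" by (simp only: alg.L_low_def N L_low_eq N_def)
  have A: "alg.A = A" by (simp only: alg.A_def A_eq)
  have r: "alg.r = \<gamma> * \<epsilon> powr \<sigma> / (4 * Lf)" by (rule alg.r_def)
  have M_pos: "M > 0" using alg.M_pos by (simp only: M)
  have N_pos: "N > 0" using alg.N_pos by (simp only: N)
  have nu: "0 < \<nu>" "\<nu> \<le> 1" using alg.nu_facts(1,2) by (simp_all only: \<nu>)
  have L_low_pos: "L_low > 0" using alg.L_low_pos by (simp only: L_low)
  have A_nonneg: "A \<ge> 0" by (simp add: A_eq)

  define lb where "lb = real_of_ereal (Psi_min f p q)"
  have lb: "lb \<le> alg.potential x" if "x \<in> edom p" for x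
  proof -
    have "Psi_min f p q \<le> Psi f p q x" unfolding Psi_min_def by (rule INF_lower) simp
    then show ?thesis using Psi_min_finite unfolding lb_def alg.Psi_eq[OF that]
      by (cases "Psi_min f p q") auto
  qed
  have a_alt: "a = 8 * (alg.potential x0 - lb + 3 + 2 * A / L_low)"
    by (simp add: a_eq lb_def alg.rv_Psi[OF initial(1)])
  have "0 \<le> A / L_low" using A_nonneg L_low_pos by simp
  then have a_pos: "a > 0" and b_pos: "b > 0"
    using lb[OF initial(1)] unfolding a_alt b_eq by (simp_all add: add_pos_nonneg)

  define n where "n = nat K"
  have C_nonneg: "C1 \<ge> 0" "C2 \<ge> 0" "C3 \<ge> 0" "C4 \<ge> 0" "C5 \<ge> 0" "C6 \<ge> 0" "C7 \<ge> 0"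
    using A_nonneg M_pos by (auto simp: C1_eq C2_eq C3_eq C4_eq C5_eq C6_eq C7_eq)
  have C8_pos: "C8 > 0" using a_pos Lf_pos constants M_pos by (simp add: C8_eq)
  let ?l = "ln (1 / \<epsilon>)"
  let ?t1 = "C1 * \<epsilon> powr (- (1 + \<nu>) / \<nu>) * ?l powr ((1 + \<nu>) / (2 * \<nu>))"
  let ?t2 = "C2 * \<epsilon> powr (- (1 + \<nu>) / \<nu>) * ?l powr ((1 + \<nu>) / 2)"
  let ?t3 = "C3 * \<epsilon> powr (- (1 + \<nu>) / \<nu>)"
  let ?t4 = "C4 * \<epsilon> powr (- 2)"
  let ?t5 = "C5 * \<epsilon> powr (- (1 + \<nu>)) * ?l powr ((1 + \<nu>) / 2)"
  let ?t6 = "C6 * \<epsilon> powr (- (1 + \<nu>))"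
  let ?t7 = "C7 * \<epsilon> powr (- (1 + \<nu>) * \<sigma>) * ?l powr ((1 + \<nu>) / 2)"
  let ?t8 = "C8 * \<epsilon> powr (- (1 + \<nu>) * \<sigma>)"
  have t_nonneg: "0 \<le> ?t1" "0 \<le> ?t2" "0 \<le> ?t3" "0 \<le> ?t4" "0 \<le> ?t5" "0 \<le> ?t6" "0 \<le> ?t7"
    using C_nonneg by (auto intro!: mult_nonneg_nonneg)
  have t8_pos: "0 < ?t8" using C8_pos inputs(1) by simp
  have K_ge: "?t1 + ?t2 + ?t3 + ?t4 + ?t5 + ?t6 + ?t7 + ?t8 \<le> real_of_int K"
    unfolding K_eq by (rule le_of_int_ceiling)
  then have "0 < real_of_int K" using t_nonneg t8_pos by linarith
  then have K_pos: "0 < K" by simp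
  then have n: "real n = real_of_int K" "n \<ge> 1" by (auto simp: n_def)
  then have n_pos: "real n > 0" by simp
  have t_le: "?t1 \<le> real n" "?t2 \<le> real n" "?t3 \<le> real n" "?t4 \<le> real n"
    "?t5 \<le> real n" "?t6 \<le> real n" "?t7 \<le> real n" "?t8 \<le> real n"
    using K_ge t_nonneg t8_pos unfolding n(1) by linarith+
  define S where "S = a + b * ln (real n)"
  have C3_split: "(36 * L_low * a) powr ((1 + \<nu>) / (2 * \<nu>)) \<le> C3"
    "(4 * (3 * M) powr (2 / \<nu>) * a) powr ((1 + \<nu>) / 2) / M \<le> C3"
    using M_pos by (simp_all add: C3_eq mult_ac)
  \<comment> \<open>In each of the following four conditions one term of \<open>K\<close> pays for \<open>a\<close> and another one, with the factor \<open>ln (1 / \<epsilon>)\<close>, for \<open>b ln n\<close>.\<close>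
  have K1: "18 * L_low * S \<le> \<epsilon>\<^sup>2 * real n powr (2 * \<nu> / (1 + \<nu>))"
  proof -
    define B where "B = 18 * (1 + \<nu>) / \<nu> * b * L_low"
    have "B > 0" using nu b_pos L_low_pos by (simp add: B_def)
    have exponents: "1 / (2 * \<nu> / (1 + \<nu>)) = (1 + \<nu>) / (2 * \<nu>)" "- 2 / (2 * \<nu> / (1 + \<nu>)) = - (1 + \<nu>) / \<nu>"
      using nu by (auto simp: field_simps)
    have C1: "C1 = (2 * B * pos_ceiling (ln B) + 2 * 2 * B + 1) powr ((1 + \<nu>) / (2 * \<nu>))"
    proof -
      have "36 * (1 + \<nu>) / \<nu> * b * L_low = 2 * B" "72 * (1 + \<nu>) / \<nu> * b * L_low = 2 * 2 * B"
        by (simp_all add: B_def algebra_simps)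
      then show ?thesis unfolding C1_eq B_def[symmetric] by (simp only:)
    qed
    have "36 * L_low * (a + b * ln (real n)) \<le> 2 * (\<epsilon> powr 2 * real n powr (2 * \<nu> / (1 + \<nu>)))"
    proof (rule log_plus_const_bound[where B = B], unfold exponents)
      have "1 + \<nu> \<noteq> 0" "\<nu> \<noteq> 0" using nu by simp_all
      then have "(1 + \<nu>) / \<nu> * (2 * \<nu> / (1 + \<nu>)) = 2" by (simp add: divide_simps)
      moreover have "B * (2 * \<nu> / (1 + \<nu>)) = 18 * b * L_low * ((1 + \<nu>) / \<nu> * (2 * \<nu> / (1 + \<nu>)))"
        by (simp add: B_def)
      ultimately show "B * (2 * \<nu> / (1 + \<nu>)) = 36 * L_low * b" by simp
      show "(2 * B * pos_ceiling (ln B) + 2 * 2 * B + 1) powr ((1 + \<nu>) / (2 * \<nu>)) * \<epsilon> powr (- (1 + \<nu>) / \<nu>)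
          * ln (1 / \<epsilon>) powr ((1 + \<nu>) / (2 * \<nu>)) \<le> real n"
        using t_le(1) by (simp only: C1)
      have "(36 * L_low * a) powr ((1 + \<nu>) / (2 * \<nu>)) * \<epsilon> powr (- (1 + \<nu>) / \<nu>) \<le> ?t3"
        by (intro mult_right_mono C3_split) simp
      then show "(36 * L_low * a) powr ((1 + \<nu>) / (2 * \<nu>)) * \<epsilon> powr (- (1 + \<nu>) / \<nu>) \<le> real n"
        using t_le(3) by linarith
    qed (use \<open>B > 0\<close> inputs eps_le nu L_low_pos a_pos n_pos in auto)
    then show ?thesis using inputs(1) by (simp add: S_def)
  qed
  have K2: "2 * (3 * M) powr (2 / \<nu>) * S \<le> N * (\<epsilon> powr (2 / \<nu>) * real n powr (2 / (1 + \<nu>)))"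
  proof -
    define B where "B = (1 + \<nu>) * (4 * (3 * M) powr (2 / \<nu>)) * b / (2 * M powr (2 / (1 + \<nu>)))"
    have B: "B = 2 * b * (1 + \<nu>) * (3 * M) powr (2 / \<nu>) / M powr (2 / (1 + \<nu>))"
      by (simp add: B_def)
    have C2: "C2 = (2 * B * pos_ceiling (ln B) + 2 * (2 / \<nu>) * B + 1) powr ((1 + \<nu>) / 2)"
      unfolding C2_eq B by (rule arg_cong[of _ _ "\<lambda>x. x powr _"]) simp
    have exponent: "- (1 + \<nu>) * (2 / \<nu>) / 2 = - (1 + \<nu>) / \<nu>" using nu by (simp add: field_simps)
    have "4 * (3 * M) powr (2 / \<nu>) * (a + b * ln (real n))
        \<le> 2 * M powr (2 / (1 + \<nu>)) * (\<epsilon> powr (2 / \<nu>) * real n powr (2 / (1 + \<nu>)))"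
    proof (rule iteration_term_bound[of M \<nu> \<epsilon> "2 / \<nu>" "4 * (3 * M) powr (2 / \<nu>)" a b], unfold exponent B_def[symmetric])
      show "(2 * B * pos_ceiling (ln B) + 2 * (2 / \<nu>) * B + 1) powr ((1 + \<nu>) / 2) * \<epsilon> powr (- (1 + \<nu>) / \<nu>)
          * ln (1 / \<epsilon>) powr ((1 + \<nu>) / 2) \<le> real n"
        using t_le(2) by (simp only: C2)
      have "(4 * (3 * M) powr (2 / \<nu>) * a) powr ((1 + \<nu>) / 2) / M * \<epsilon> powr (- (1 + \<nu>) / \<nu>) \<le> ?t3"
        by (intro mult_right_mono C3_split) simp
      then show "(4 * (3 * M) powr (2 / \<nu>) * a) powr ((1 + \<nu>) / 2) / M * \<epsilon> powr (- (1 + \<nu>) / \<nu>) \<le> real n"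
        using t_le(3) by linarith
    qed (use inputs eps_le nu M_pos a_pos b_pos n_pos in auto)
    then show ?thesis by (simp add: S_def N_def mult_ac)
  qed
  have K3: "72 * Lg\<^sup>2 * S \<le> N * (\<epsilon>\<^sup>2 * real n powr (2 / (1 + \<nu>)))"
  proof -
    define B where "B = (1 + \<nu>) * (144 * Lg\<^sup>2) * b / (2 * M powr (2 / (1 + \<nu>)))"
    have B: "B = 72 * (1 + \<nu>) * b * Lg\<^sup>2 / M powr (2 / (1 + \<nu>))"
      by (simp add: B_def)
    have C5: "C5 = (2 * B * pos_ceiling (ln B) + 2 * 2 * B + 1) powr ((1 + \<nu>) / 2)"
    proof -
      have "144 * (1 + \<nu>) * b * Lg\<^sup>2 / M powr (2 / (1 + \<nu>)) = 2 * B"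
        "288 * (1 + \<nu>) * b * Lg\<^sup>2 / M powr (2 / (1 + \<nu>)) = 2 * 2 * B"
        by (simp_all add: B algebra_simps)
      then show ?thesis unfolding C5_eq B[symmetric] by (simp only:)
    qed
    have C6: "C6 = (144 * Lg\<^sup>2 * a) powr ((1 + \<nu>) / 2) / M" by (simp add: C6_eq mult_ac)
    have exponent: "- (1 + \<nu>) * 2 / 2 = - (1 + \<nu>)" by simp
    have "144 * Lg\<^sup>2 * (a + b * ln (real n))
        \<le> 2 * M powr (2 / (1 + \<nu>)) * (\<epsilon> powr 2 * real n powr (2 / (1 + \<nu>)))"
    proof (rule iteration_term_bound[of M \<nu> \<epsilon> 2 "144 * Lg\<^sup>2" a b], unfold exponent B_def[symmetric])
      show "(2 * B * pos_ceiling (ln B) + 2 * 2 * B + 1) powr ((1 + \<nu>) / 2) * \<epsilon> powr (- (1 + \<nu>))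
          * ln (1 / \<epsilon>) powr ((1 + \<nu>) / 2) \<le> real n"
        using t_le(5) by (simp only: C5)
      show "(144 * Lg\<^sup>2 * a) powr ((1 + \<nu>) / 2) / M * \<epsilon> powr (- (1 + \<nu>)) \<le> real n"
        using t_le(6) by (simp only: C6)
    qed (use inputs eps_le nu M_pos a_pos b_pos n_pos Lg_pos in auto)
    moreover have "144 * Lg\<^sup>2 * (a + b * ln (real n)) = 2 * (72 * Lg\<^sup>2 * S)" by (simp add: S_def)
    moreover have "2 * M powr (2 / (1 + \<nu>)) * (\<epsilon> powr 2 * real n powr (2 / (1 + \<nu>)))
        = 2 * (N * (\<epsilon>\<^sup>2 * real n powr (2 / (1 + \<nu>))))"
      using inputs(1) by (simp add: N_def)
    ultimately show ?thesis by linarith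
  qed
  have K4: "32 * Lf\<^sup>2 * S \<le> \<gamma>\<^sup>2 * N * (\<epsilon> powr (2 * \<sigma>) * real n powr (2 / (1 + \<nu>)))"
  proof -
    define B where "B = (1 + \<nu>) * (64 * Lf\<^sup>2 / \<gamma>\<^sup>2) * b / (2 * M powr (2 / (1 + \<nu>)))"
    have B: "B = 32 * (1 + \<nu>) * b * Lf\<^sup>2 / (\<gamma>\<^sup>2 * M powr (2 / (1 + \<nu>)))"
      by (simp add: B_def)
    have C7: "C7 = (2 * B * pos_ceiling (ln B) + 2 * (2 * \<sigma>) * B + 1) powr ((1 + \<nu>) / 2)"
    proof -
      have "64 * (1 + \<nu>) * b * Lf\<^sup>2 / (\<gamma>\<^sup>2 * M powr (2 / (1 + \<nu>))) = 2 * B"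
        "128 * \<sigma> * (1 + \<nu>) * b * Lf\<^sup>2 / (\<gamma>\<^sup>2 * M powr (2 / (1 + \<nu>))) = 2 * (2 * \<sigma>) * B"
        by (simp_all add: B algebra_simps)
      then show ?thesis unfolding C7_eq B[symmetric] by (simp only:)
    qed
    have "(\<gamma>\<^sup>2) powr ((1 + \<nu>) / 2) = \<gamma> powr (1 + \<nu>)"
    proof -
      have "(\<gamma> powr 2) powr ((1 + \<nu>) / 2) = \<gamma> powr (2 * ((1 + \<nu>) / 2))" by (rule powr_powr)
      also have "2 * ((1 + \<nu>) / 2) = 1 + \<nu>" by simp
      finally show ?thesis using constants by simp
    qed
    then have C8: "C8 = (64 * Lf\<^sup>2 / \<gamma>\<^sup>2 * a) powr ((1 + \<nu>) / 2) / M"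
      using powr_divide[of "64 * a * Lf\<^sup>2" "\<gamma>\<^sup>2" "(1 + \<nu>) / 2"] by (simp add: C8_eq mult_ac)
    have exponent: "- (1 + \<nu>) * (2 * \<sigma>) / 2 = - (1 + \<nu>) * \<sigma>" by simp
    have "64 * Lf\<^sup>2 / \<gamma>\<^sup>2 * (a + b * ln (real n))
        \<le> 2 * M powr (2 / (1 + \<nu>)) * (\<epsilon> powr (2 * \<sigma>) * real n powr (2 / (1 + \<nu>)))"
    proof (rule iteration_term_bound[of M \<nu> \<epsilon> "2 * \<sigma>" "64 * Lf\<^sup>2 / \<gamma>\<^sup>2" a b], unfold exponent B_def[symmetric])
      show "(2 * B * pos_ceiling (ln B) + 2 * (2 * \<sigma>) * B + 1) powr ((1 + \<nu>) / 2)
          * \<epsilon> powr (- (1 + \<nu>) * \<sigma>) * ln (1 / \<epsilon>) powr ((1 + \<nu>) / 2) \<le> real n"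
        using t_le(7) by (simp only: C7)
      show "(64 * Lf\<^sup>2 / \<gamma>\<^sup>2 * a) powr ((1 + \<nu>) / 2) / M * \<epsilon> powr (- (1 + \<nu>) * \<sigma>) \<le> real n"
        using t_le(8) by (simp only: C8)
    qed (use inputs eps_le nu M_pos a_pos b_pos n_pos Lf_pos constants in auto)
    then have "\<gamma>\<^sup>2 * (64 * Lf\<^sup>2 / \<gamma>\<^sup>2 * S) \<le> \<gamma>\<^sup>2 * (2 * N * (\<epsilon> powr (2 * \<sigma>) * real n powr (2 / (1 + \<nu>))))"
      unfolding S_def N_def by (rule mult_left_mono) simp
    then show ?thesis using constants by (simp add: mult_ac)
  qed
  have K5: "72 * A * \<epsilon> powr (- 2) \<le> real n" using t_le(4) by (simp only: C4_eq)

  have gap0: "alg.gap x0 y0 \<le> alg.gap_tol 0"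
    using initial(3) alg.Fmax_minus_Fobj[OF initial(1,2)] by (simp add: alg.gap_tol_def alg.\<eta>_def)
  show ?thesis
  proof (intro conjI allI impI)
    show "\<exists>xs ys. ipg_run f p q Lf Lg C \<theta> \<gamma> \<sigma> \<epsilon> lam_bar \<rho> x0 y0 xs ys"
      by (rule alg.run_exists[OF initial(1,2)])
  next
    fix xs ys
    assume run: "ipg_run f p q Lf Lg C \<theta> \<gamma> \<sigma> \<epsilon> lam_bar \<rho> x0 y0 xs ys"
    have "8 * (alg.potential x0 - lb + 3 + 2 * A / L_low) + 8 * (3 / 2 + A / L_low) * ln (real n) = S"
      by (simp only: S_def a_alt b_eq)
    then have "\<exists>j<n. alg.stationary (xs j)"
      using alg.stationary_within[OF run initial(1,2) gap0 lb n(2), unfolded A L_low M N \<nu>] K1 K2 K3 K4 K5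
      by simp
    then obtain k where k: "k < n" "alg.stationary (xs k)" "alg.gap (xs k) (ys k) \<le> alg.gap_tol k"
      "x0 \<notin> eps_critical (Psi f p q) \<epsilon> \<Longrightarrow> xs k \<notin> eps_critical (Psi f p q) \<epsilon>"
      using alg.first_stationary_iterate[OF run initial(1,2) gap0] by blast
    note dom = alg.run_in_domain[OF run initial(1,2)]
    have "int k \<le> K" using k(1) by (simp add: n_def)
    moreover have "stationary_point (Psi f p q) (\<gamma> * \<epsilon> powr \<sigma> / (4 * Lf)) \<epsilon> (xs k)"
      using k(2) by (simp only: r)
    moreover have "Fmax f q (xs k) - Fobj f q (xs k) (ys k)
        \<le> ereal (min (\<gamma> * \<epsilon> powr \<sigma> / 2) (1 / (real k + 1)))"
    proof -
      have "alg.gap_tol k \<le> \<gamma> * \<epsilon> powr \<sigma> / 2" by (simp add: alg.gap_tol_def)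
      then show ?thesis
        using k(3) alg.gap_tol_le_eta[of k] alg.Fmax_minus_Fobj[OF dom, of k k]
        by (simp add: alg.\<eta>_def)
    qed
    moreover have "edist (ys k) (Ymax f q (xs k)) \<le> ereal (1 / (C * (1 - \<theta>)) *
        min ((\<gamma> / 2) powr (1 - \<theta>) * \<epsilon> powr (\<sigma> * (1 - \<theta>))) (1 / sqrt (real k + 1)))"
      if "x0 \<notin> eps_critical (Psi f p q) \<epsilon>"
      using alg.gap_tol_error_bound[OF dom(1) k(4)[OF that] dom(2) k(3)] edist_leI by blast
    ultimately show "\<exists>k. int k \<le> K \<and>
         stationary_point (Psi f p q) (\<gamma> * \<epsilon> powr \<sigma> / (4 * Lf)) \<epsilon> (xs k) \<and>
         Fmax f q (xs k) - Fobj f q (xs k) (ys k)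
           \<le> ereal (min (\<gamma> * \<epsilon> powr \<sigma> / 2) (1 / (real k + 1))) \<and>
         (x0 \<notin> eps_critical (Psi f p q) \<epsilon> \<longrightarrow>
           edist (ys k) (Ymax f q (xs k))
             \<le> ereal (1 / (C * (1 - \<theta>)) *
                  min ((\<gamma> / 2) powr (1 - \<theta>) * \<epsilon> powr (\<sigma> * (1 - \<theta>))) (1 / sqrt (real k + 1))))"
      by blast
  qed
qed

end
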